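(* For a ring $A$ with prime radical $P$, the following conditions are equivalent. (1) $A$ is a right distributive, right invariant, centrally essential ring and $P$ is a finitely generated right ideal such that the factor ring $A/P$ does not contain an infinite direct sum of non-zero ideals. (2) $A=A_1\times\cdots\times A_n$ is a finite direct product of rings, where every ring $A_k$ is either a commutative Prüfer domain or an Artinian uniserial ring.
   Context: All rings are associative with non-zero identity element; "ideal" without a side means two-sided ideal. The prime radical of a ring is the intersection of its prime ideals. A ring $A$ with center $C$ is centrally essential if either $A$ is commutative or for every non-zero non-central element $a\in A$ there exist non-zero central elements $x,y\in C$ with $ax=y$. A ring $A$ is right distributive if the lattice of all submodules of $A_A$ (i.e. of all right ideals) is distributive. A ring $A$ is right invariant if every right ideal of $A$ is a two-sided ideal. A module is uniserial if any two of its submodules are comparable with respect to inclusion. A module is Artinian if it contains no infinite properly descending chain of submodules. A ring $A$ is Artinian (resp. uniserial) if both modules $A_A$ and ${}_AA$ are Artinian (resp. uniserial). A domain is a ring without non-zero zero-divisors. A commutative Prüfer domain is a commutative domain in which every finitely generated ideal is projective.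
   Formalization: In (2) the Artinian uniserial factors are additionally required to be centrally essential; without this (2) does not imply (1), since the real quaternions are an Artinian uniserial ring that is not centrally essential. *)

theory Defs
  imports "HOL-Algebra.Chinese_Remainder" "HOL-Algebra.Ideal_Product" "HOL-Algebra.Module"
begin

text \<open>
  Rings are those of HOL-Algebra (associative, with identity, not necessarily commutative). The
  condition \<open>\<one> \<noteq> \<zero>\<close> is not part of the locale \<^locale>\<open>ring\<close> and is stated separately. The
  HOL-Algebra predicate \<^locale>\<open>ideal\<close> means a two-sided ideal.
\<close>

section \<open>One-sided ideals\<close>

definition right_ideal :: "'a set \<Rightarrow> ('a, 'm) ring_scheme \<Rightarrow> bool" where
  "right_ideal I R \<longleftrightarrow>
     additive_subgroup I R \<and> (\<forall>a\<in>I. \<forall>r\<in>carrier R. a \<otimes>\<^bsub>R\<^esub> r \<in> I)"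

definition left_ideal :: "'a set \<Rightarrow> ('a, 'm) ring_scheme \<Rightarrow> bool" where
  "left_ideal I R \<longleftrightarrow>
     additive_subgroup I R \<and> (\<forall>a\<in>I. \<forall>r\<in>carrier R. r \<otimes>\<^bsub>R\<^esub> a \<in> I)"

definition fin_gen_right_ideal :: "('a, 'm) ring_scheme \<Rightarrow> 'a set \<Rightarrow> bool" where
  "fin_gen_right_ideal R I \<longleftrightarrow>
     (\<exists>S. finite S \<and> S \<subseteq> carrier R \<and> I = \<Inter>{J. right_ideal J R \<and> S \<subseteq> J})"

text \<open>In the lattice of right ideals the meet is the intersection and the join is the sum.\<close>

definition right_distributive :: "('a, 'm) ring_scheme \<Rightarrow> bool" where
  "right_distributive R \<longleftrightarrow>
     (\<forall>I J K. right_ideal I R \<and> right_ideal J R \<and> right_ideal K R \<longrightarrow>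
        I \<inter> (J <+>\<^bsub>R\<^esub> K) = (I \<inter> J) <+>\<^bsub>R\<^esub> (I \<inter> K))"

definition right_invariant :: "('a, 'm) ring_scheme \<Rightarrow> bool" where
  "right_invariant R \<longleftrightarrow> (\<forall>I. right_ideal I R \<longrightarrow> ideal I R)"

definition uniserial :: "('a, 'm) ring_scheme \<Rightarrow> bool" where
  "uniserial R \<longleftrightarrow>
     (\<forall>I J. right_ideal I R \<and> right_ideal J R \<longrightarrow> I \<subseteq> J \<or> J \<subseteq> I) \<and>
     (\<forall>I J. left_ideal I R \<and> left_ideal J R \<longrightarrow> I \<subseteq> J \<or> J \<subseteq> I)"

definition artinian :: "('a, 'm) ring_scheme \<Rightarrow> bool" where
  "artinian R \<longleftrightarrow>
     \<not> (\<exists>I :: nat \<Rightarrow> 'a set. \<forall>n. right_ideal (I n) R \<and> I (Suc n) \<subset> I n) \<and>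
     \<not> (\<exists>I :: nat \<Rightarrow> 'a set. \<forall>n. left_ideal (I n) R \<and> I (Suc n) \<subset> I n)"


section \<open>Centrally essential rings\<close>

definition ring_center :: "('a, 'm) ring_scheme \<Rightarrow> 'a set" where
  "ring_center R = {c \<in> carrier R. \<forall>a\<in>carrier R. c \<otimes>\<^bsub>R\<^esub> a = a \<otimes>\<^bsub>R\<^esub> c}"

definition centrally_essential :: "('a, 'm) ring_scheme \<Rightarrow> bool" where
  "centrally_essential R \<longleftrightarrow>
     cring R \<or>
     (\<forall>a\<in>carrier R. a \<noteq> \<zero>\<^bsub>R\<^esub> \<and> a \<notin> ring_center R \<longrightarrow>
        (\<exists>x\<in>ring_center R. \<exists>y\<in>ring_center R.
           x \<noteq> \<zero>\<^bsub>R\<^esub> \<and> y \<noteq> \<zero>\<^bsub>R\<^esub> \<and> a \<otimes>\<^bsub>R\<^esub> x = y))"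


section \<open>Prime radical and direct sums of ideals\<close>

text \<open>
  The locale \<^locale>\<open>primeideal\<close> of HOL-Algebra is restricted to commutative rings; over an
  arbitrary ring, primeness is expressed by products of ideals.
\<close>

definition prime_ideal :: "'a set \<Rightarrow> ('a, 'm) ring_scheme \<Rightarrow> bool" where
  "prime_ideal Q R \<longleftrightarrow>
     ideal Q R \<and> Q \<noteq> carrier R \<and>
     (\<forall>I J. ideal I R \<and> ideal J R \<and> I \<cdot>\<^bsub>R\<^esub> J \<subseteq> Q \<longrightarrow> I \<subseteq> Q \<or> J \<subseteq> Q)"

definition prime_radical :: "('a, 'm) ring_scheme \<Rightarrow> 'a set" where
  "prime_radical R = carrier R \<inter> \<Inter>{Q. prime_ideal Q R}"

text \<open>
  A family of non-zero ideals whose sum is direct is injective, so it may be given as a set \<open>\<F>\<close>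
  of ideals; the sum of the members of \<open>\<F>\<close> other than \<open>I\<close> is the ideal generated by their union.
\<close>

definition contains_infinite_direct_sum_of_ideals :: "('a, 'm) ring_scheme \<Rightarrow> bool" where
  "contains_infinite_direct_sum_of_ideals R \<longleftrightarrow>
     (\<exists>\<F>. infinite \<F> \<and>
        (\<forall>I\<in>\<F>. ideal I R \<and> I \<noteq> {\<zero>\<^bsub>R\<^esub>}) \<and>
        (\<forall>I\<in>\<F>. I \<inter> (Idl\<^bsub>R\<^esub> (\<Union>(\<F> - {I}))) = {\<zero>\<^bsub>R\<^esub>}))"


section \<open>Projective modules and Pruefer domains\<close>

text \<open>
  The free module on a basis indexed by \<open>B\<close>: finitely supported functions on \<open>B\<close>, extended by
  zero. The fields \<^const>\<open>mult\<close> and \<^const>\<open>one\<close> of the module record play no role.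
\<close>

definition free_module :: "('a, 'm) ring_scheme \<Rightarrow> 'i set \<Rightarrow> ('a, 'i \<Rightarrow> 'a) module" where
  "free_module R B =
     \<lparr>carrier = {f. (\<forall>i\<in>B. f i \<in> carrier R) \<and> (\<forall>i. i \<notin> B \<longrightarrow> f i = \<zero>\<^bsub>R\<^esub>) \<and>
                  finite {i \<in> B. f i \<noteq> \<zero>\<^bsub>R\<^esub>}},
      mult = undefined, one = undefined,
      zero = (\<lambda>i. \<zero>\<^bsub>R\<^esub>), add = (\<lambda>f g i. f i \<oplus>\<^bsub>R\<^esub> g i),
      smult = (\<lambda>r f i. r \<otimes>\<^bsub>R\<^esub> f i)\<rparr>"

definition module_iso ::
  "('a, 'm) ring_scheme \<Rightarrow> ('a, 'b, 'k) module_scheme \<Rightarrow> ('a, 'c, 'l) module_scheme \<Rightarrow>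
   ('b \<Rightarrow> 'c) set" where
  "module_iso R M N =
     {h. bij_betw h (carrier M) (carrier N) \<and>
         (\<forall>x\<in>carrier M. \<forall>y\<in>carrier M. h (x \<oplus>\<^bsub>M\<^esub> y) = h x \<oplus>\<^bsub>N\<^esub> h y) \<and>
         (\<forall>r\<in>carrier R. \<forall>x\<in>carrier M. h (r \<odot>\<^bsub>M\<^esub> x) = r \<odot>\<^bsub>N\<^esub> h x)}"

definition direct_summand ::
  "'b set \<Rightarrow> ('a, 'm) ring_scheme \<Rightarrow> ('a, 'b, 'k) module_scheme \<Rightarrow> bool" where
  "direct_summand H R M \<longleftrightarrow>
     submodule H R M \<and>
     (\<exists>K. submodule K R M \<and> H \<inter> K = {\<zero>\<^bsub>M\<^esub>} \<and> H <+>\<^bsub>M\<^esub> K = carrier M)"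

text \<open>
  Projective: isomorphic to a direct summand of a free module. Taking the basis index set inside
  the type of elements of \<open>M\<close> loses no generality, since every module is a quotient of the free
  module on its own carrier, and this quotient map splits when \<open>M\<close> is projective.
\<close>

definition projective_module ::
  "('a, 'm) ring_scheme \<Rightarrow> ('a, 'b, 'k) module_scheme \<Rightarrow> bool" where
  "projective_module R M \<longleftrightarrow>
     module R M \<and>
     (\<exists>(B :: 'b set) H. direct_summand H R (free_module R B) \<and>
        module_iso R M (free_module R B\<lparr>carrier := H\<rparr>) \<noteq> {})"

definition ideal_module :: "('a, 'm) ring_scheme \<Rightarrow> 'a set \<Rightarrow> ('a, 'a) module" where
  "ideal_module R I =
     \<lparr>carrier = I, mult = mult R, one = one R, zero = zero R, add = add R, smult = mult R\<rparr>"

text \<open>The locale \<^locale>\<open>domain\<close> of HOL-Algebra includes commutativity.\<close>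

definition pruefer_domain :: "('a, 'm) ring_scheme \<Rightarrow> bool" where
  "pruefer_domain R \<longleftrightarrow>
     domain R \<and>
     (\<forall>S. finite S \<and> S \<subseteq> carrier R \<longrightarrow> projective_module R (ideal_module R (Idl\<^bsub>R\<^esub> S)))"

end

theory Submission
  imports Defs "HOL-Algebra.Divisibility"
begin

text \<open>
  A ring is right distributive iff any two elements \<open>a\<close>, \<open>b\<close> admit \<open>t\<close> with \<open>a t \<in> b A\<close> and
  \<open>b (1 - t) \<in> a A\<close>; in a right invariant ring prime ideals are completely prime, so \<open>P\<close> consists of
  the nilpotent elements. If \<open>a b \<in> P\<close>, then \<open>a t\<close> and \<open>b (1 - t)\<close> lie in \<open>P\<close>. So either orthogonal
  elements modulo \<open>P\<close> can be continued to an infinite orthogonal sequence, or for some pair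
  the element \<open>t\<close> is idempotent modulo \<open>P\<close> and lifts to a central idempotent. Hence \<open>A\<close> is a finite
  product of rings in which \<open>A/P\<close> is a domain.

  In such a factor, if \<open>P = 0\<close>, central multiples of \<open>a\<close> force \<open>a b = b a\<close>, and a partition of unity
  built from the elements \<open>t\<close> gives dual bases of the finitely generated ideals. If \<open>P \<noteq> 0\<close>, then
  \<open>P = a P\<close> for every \<open>a \<notin> P\<close>. Take generators \<open>p\<^sub>i\<close> of \<open>P\<close> and \<open>t\<^sub>i\<close> with \<open>\<Sum> t\<^sub>i = 1\<close> and
  \<open>P t\<^sub>i \<subseteq> p\<^sub>i A\<close>, and a central \<open>x\<close> making every \<open>p\<^sub>i x\<close> central. From \<open>p\<^sub>i = a q\<close> and
  \<open>q t\<^sub>i = p\<^sub>i w\<close> one gets \<open>c t\<^sub>i = c a w\<close> for the central element \<open>c = p\<^sub>i x\<close>; for a suitable \<open>i\<close> this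
  puts \<open>t\<^sub>i\<close> into \<open>a A\<close> for all \<open>a \<notin> P\<close>, so all such \<open>a\<close> are units and \<open>P = p A\<close>. A central
  element \<open>p\<^sup>k u\<close> with \<open>u\<close> a unit then yields \<open>p A = A p\<close>, and the one-sided ideals are generated by
  the powers of \<open>p\<close>.

  Conversely, all conditions can be checked elementwise in each factor; for an Artinian
  uniserial ring the nilpotent elements are the non-units and form a principal right ideal.
\<close>

section \<open>Right ideals, divisibility and the center\<close>

text \<open>Right invariance gives only A a \<subseteq> a A: a left factor can be pushed to the
  right of a, with no converse at hand. Statements are therefore phrased through
  \<open>divides\<close>, whose cofactor stands on the right. Modulo P there is more freedom, since
  membership in P can be tested in completely prime ideals; hence orthogonality is studied modulo P.

  If P \<noteq> 0, central essentiality makes up for two gaps. An equation multiplied by a central c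
  determines its terms only up to the annihilator of c; but this annihilator lies in P, hence in a A
  for every a outside P. The inclusion p A \<subseteq> A p, which gives access to left ideals, comes
  from a central c = p^k u: conjugation by u moves coefficients across p^k, and the error caused by
  moving them across p alone lies in p^2 A, from where it is pushed to ever higher powers of p until
  it vanishes.

  The index i is found by testing the squares of the t_i against the proper right ideal P + ann y,
  because the proof of c t_i \<noteq> 0 consumes t_i twice.\<close>

context ring
begin

lemma right_idealI:
  assumes "I \<subseteq> carrier R" "\<zero> \<in> I"
    and add: "\<And>a b. a \<in> I \<Longrightarrow> b \<in> I \<Longrightarrow> a \<oplus> b \<in> I"
    and mult: "\<And>a r. a \<in> I \<Longrightarrow> r \<in> carrier R \<Longrightarrow> a \<otimes> r \<in> I"
  shows "right_ideal I R"
proof -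
  have "\<ominus> a \<in> I" if "a \<in> I" for a
    using mult[OF that, of "\<ominus> \<one>"] that assms(1) by (metis a_inv_closed one_closed r_minus r_one subsetD)
  then have "subgroup I (add_monoid R)"
    using assms by (intro add.subgroupI) (auto simp: a_inv_def)
  then show ?thesis
    unfolding right_ideal_def using mult by (auto intro: additive_subgroupI)
qed

lemma left_idealI:
  assumes "I \<subseteq> carrier R" "\<zero> \<in> I"
    and add: "\<And>a b. a \<in> I \<Longrightarrow> b \<in> I \<Longrightarrow> a \<oplus> b \<in> I"
    and mult: "\<And>a r. a \<in> I \<Longrightarrow> r \<in> carrier R \<Longrightarrow> r \<otimes> a \<in> I"
  shows "left_ideal I R"
proof -
  have "\<ominus> a \<in> I" if "a \<in> I" for a
    using mult[OF that, of "\<ominus> \<one>"] that assms(1) by (metis a_inv_closed one_closed l_minus l_one subsetD)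
  then have "subgroup I (add_monoid R)"
    using assms by (intro add.subgroupI) (auto simp: a_inv_def)
  then show ?thesis
    unfolding left_ideal_def using mult by (auto intro: additive_subgroupI)
qed

lemma right_idealD:
  assumes "right_ideal I R"
  shows "I \<subseteq> carrier R" "\<zero> \<in> I" "a \<in> I \<Longrightarrow> b \<in> I \<Longrightarrow> a \<oplus> b \<in> I"
    "a \<in> I \<Longrightarrow> r \<in> carrier R \<Longrightarrow> a \<otimes> r \<in> I"
  using assms unfolding right_ideal_def
  by (auto simp: additive_subgroup.a_subset additive_subgroup.zero_closed additive_subgroup.a_closed)

lemma left_idealD:
  assumes "left_ideal I R"
  shows "I \<subseteq> carrier R" "\<zero> \<in> I" "a \<in> I \<Longrightarrow> b \<in> I \<Longrightarrow> a \<oplus> b \<in> I"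
    "a \<in> I \<Longrightarrow> r \<in> carrier R \<Longrightarrow> r \<otimes> a \<in> I"
  using assms unfolding left_ideal_def
  by (auto simp: additive_subgroup.a_subset additive_subgroup.zero_closed additive_subgroup.a_closed)

lemma ideal_iff_right_left: "ideal I R \<longleftrightarrow> right_ideal I R \<and> left_ideal I R"
  unfolding right_ideal_def left_ideal_def ideal_def ideal_axioms_def
  using ring_axioms by auto

lemma minus_eq_zero_iff:
  "a \<in> carrier R \<Longrightarrow> b \<in> carrier R \<Longrightarrow> a \<ominus> b = \<zero> \<longleftrightarrow> a = b"
  unfolding minus_eq by (metis a_inv_closed add.inv_inv local.minus_equality r_neg)

section \<open>Right divisibility\<close>

lemma divides_zero [simp]: "a \<in> carrier R \<Longrightarrow> a divides \<zero>"
  by (rule dividesI[of \<zero>]) auto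

lemma divides_add:
  assumes "a divides b" "a divides c" "a \<in> carrier R"
  shows "a divides (b \<oplus> c)"
proof -
  from assms obtain x y where "x \<in> carrier R" "y \<in> carrier R" "b = a \<otimes> x" "c = a \<otimes> y"
    by (elim dividesE)
  then show ?thesis using assms by (intro dividesI[of "x \<oplus> y"]) (auto simp: r_distr)
qed

lemma divides_minus:
  assumes "a divides b" "a divides c" "a \<in> carrier R"
  shows "a divides (b \<ominus> c)"
proof -
  from assms obtain x y where "x \<in> carrier R" "y \<in> carrier R" "b = a \<otimes> x" "c = a \<otimes> y"
    by (elim dividesE)
  then show ?thesis using assms
    by (intro dividesI[of "x \<ominus> y"]) (auto simp: r_distr r_minus minus_eq)
qed

lemma divides_mult_right:
  assumes "a divides b" "a \<in> carrier R" "r \<in> carrier R"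
  shows "a divides b \<otimes> r"
  using assms by (elim dividesE) (metis dividesI m_assoc m_closed)

text \<open>In \<open>a divides r\<close> the cofactor stands on the right, r = a c, so the set is
  the right ideal a A. Principal right ideals appear in this form throughout.\<close>

lemma right_ideal_principal:
  assumes "a \<in> carrier R" shows "right_ideal {r \<in> carrier R. a divides r} R"
  using assms by (intro right_idealI) (auto intro: divides_add divides_mult_right)

lemma right_ideal_divides:
  assumes "right_ideal I R" "a \<in> I" "a divides b" shows "b \<in> I"
  using assms right_idealD(4) by (elim dividesE) auto

section \<open>Elementwise forms of right invariance and right distributivity\<close>

lemma one_minus_minus: "t \<in> carrier R \<Longrightarrow> \<one> \<ominus> (\<one> \<ominus> t) = t"
  by algebra

text \<open>Principal right ideals suffice: an arbitrary right ideal I contains a A for each of its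
  elements a, hence also b a.\<close>

lemma right_invariant_iff:
  "right_invariant R \<longleftrightarrow> (\<forall>a\<in>carrier R. \<forall>b\<in>carrier R. a divides b \<otimes> a)"
proof
  assume inv: "right_invariant R"
  show "\<forall>a\<in>carrier R. \<forall>b\<in>carrier R. a divides b \<otimes> a"
  proof (intro ballI)
    fix a b assume a: "a \<in> carrier R" and b: "b \<in> carrier R"
    have "ideal {r \<in> carrier R. a divides r} R"
      using inv right_ideal_principal[OF a] by (auto simp: right_invariant_def)
    moreover have "a \<in> {r \<in> carrier R. a divides r}" using a by auto
    ultimately have "b \<otimes> a \<in> {r \<in> carrier R. a divides r}" using b by (rule ideal.I_l_closed)
    then show "a divides b \<otimes> a" by simp
  qed
next
  assume *: "\<forall>a\<in>carrier R. \<forall>b\<in>carrier R. a divides b \<otimes> a"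
  show "right_invariant R"
    unfolding right_invariant_def ideal_iff_right_left
  proof (intro allI impI conjI)
    fix I assume I: "right_ideal I R"
    show "left_ideal I R"
      using right_idealD[OF I] right_ideal_divides[OF I] *
      by (intro left_idealI) (simp, simp, simp, metis subsetD)
  qed
qed

text \<open>The distributive law is applied to a A, b A and (a - b) A, because a = b + (a - b). It
  splits a = u + v with u in a A \<inter> b A and v = (a - b) z in a A, and t = 1 - z works: a t = u
  - b z and b z = a z - v.\<close>

lemma right_distributive_imp:
  assumes dist: "right_distributive R" and a: "a \<in> carrier R" and b: "b \<in> carrier R"
  shows "\<exists>t\<in>carrier R. b divides a \<otimes> t \<and> a divides b \<otimes> (\<one> \<ominus> t)"
proof -
  let ?P = "\<lambda>a. {r \<in> carrier R. a divides r}"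
  have "right_ideal (?P a) R" "right_ideal (?P b) R" "right_ideal (?P (a \<ominus> b)) R"
    using a b by (auto intro!: right_ideal_principal)
  then have eq: "?P a \<inter> (?P b <+>\<^bsub>R\<^esub> ?P (a \<ominus> b)) = (?P a \<inter> ?P b) <+>\<^bsub>R\<^esub> (?P a \<inter> ?P (a \<ominus> b))"
    using dist unfolding right_distributive_def by blast
  have "a = b \<oplus> (a \<ominus> b)" using a b by algebra
  then have "a \<in> ?P b <+>\<^bsub>R\<^esub> ?P (a \<ominus> b)"
    unfolding set_add_def' using a b
    by (intro UN_I[of b] UN_I[of "a \<ominus> b"]) auto
  with a have "a \<in> (?P a \<inter> ?P b) <+>\<^bsub>R\<^esub> (?P a \<inter> ?P (a \<ominus> b))"
    unfolding eq[symmetric] by auto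
  then obtain u v where u: "u \<in> carrier R" "a divides u" "b divides u"
    and v: "v \<in> carrier R" "a divides v" "(a \<ominus> b) divides v" and auv: "a = u \<oplus> v"
    unfolding set_add_def' by blast
  from v obtain z where z: "z \<in> carrier R" "v = (a \<ominus> b) \<otimes> z" by (elim dividesE)
  have bz: "b \<otimes> z = a \<otimes> z \<ominus> v" using a b z by algebra
  have t: "a \<otimes> (\<one> \<ominus> z) = u \<ominus> b \<otimes> z"
  proof -
    have "a \<otimes> (\<one> \<ominus> z) = a \<ominus> a \<otimes> z" using a z(1) by (simp add: r_distr r_minus minus_eq)
    also have "\<dots> = (u \<oplus> v) \<ominus> a \<otimes> z" using auv by simp
    also have "\<dots> = u \<ominus> b \<otimes> z" unfolding bz using a z(1) u(1) v(1) by algebra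
    finally show ?thesis .
  qed
  show ?thesis
  proof (intro bexI conjI)
    show "\<one> \<ominus> z \<in> carrier R" using z by auto
    show "b divides a \<otimes> (\<one> \<ominus> z)" unfolding t using u b z by (auto intro!: divides_minus)
    show "a divides b \<otimes> (\<one> \<ominus> (\<one> \<ominus> z))"
      unfolding one_minus_minus[OF z(1)] bz using v a z by (auto intro!: divides_minus)
  qed
qed

text \<open>For x = y + z with y in J and z in K, the element t of the pair y, z gives x = x (1 - t)
  + x t, where x t = y t + z t lies in K and x (1 - t) lies in J. If x is in I, both summands
  are.\<close>

lemma right_distributiveI:
  assumes *: "\<And>a b. a \<in> carrier R \<Longrightarrow> b \<in> carrier R \<Longrightarrow>
    \<exists>t\<in>carrier R. b divides a \<otimes> t \<and> a divides b \<otimes> (\<one> \<ominus> t)"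
  shows "right_distributive R"
  unfolding right_distributive_def
proof (intro allI impI equalityI subsetI)
  fix I J K x assume IJK: "right_ideal I R \<and> right_ideal J R \<and> right_ideal K R"
  then have I: "right_ideal I R" and J: "right_ideal J R" and K: "right_ideal K R" by auto
  note carr = right_idealD(1)[OF I] right_idealD(1)[OF J] right_idealD(1)[OF K]
  {
    assume "x \<in> I \<inter> (J <+>\<^bsub>R\<^esub> K)"
    then obtain y z where yz: "x \<in> I" "y \<in> J" "z \<in> K" "x = y \<oplus> z" unfolding set_add_def' by auto
    have yzc: "y \<in> carrier R" "z \<in> carrier R" using yz carr by auto
    from *[OF yzc] obtain t where t: "t \<in> carrier R" "z divides y \<otimes> t" "y divides z \<otimes> (\<one> \<ominus> t)" by auto
    have "x \<otimes> t \<in> K"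
      unfolding yz l_distr[OF yzc t(1)] using right_ideal_divides[OF K yz(3) t(2)]
        right_idealD(3,4)[OF K] yz t by blast
    moreover have "x \<otimes> (\<one> \<ominus> t) \<in> J"
      unfolding yz l_distr[OF yzc minus_closed[OF one_closed t(1)]]
      using right_ideal_divides[OF J yz(2) t(3)]
        right_idealD(3,4)[OF J] yz t by (meson minus_closed one_closed)
    moreover have "x \<otimes> t \<in> I" "x \<otimes> (\<one> \<ominus> t) \<in> I" using right_idealD(4)[OF I] yz t by auto
    moreover have "x = x \<otimes> (\<one> \<ominus> t) \<oplus> x \<otimes> t"
      using yz(1) carr t(1) by (subst r_distr[symmetric]) (auto simp: minus_eq a_assoc l_neg subsetD)
    ultimately show "x \<in> (I \<inter> J) <+>\<^bsub>R\<^esub> (I \<inter> K)" unfolding set_add_def' by blast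
  next
    assume "x \<in> (I \<inter> J) <+>\<^bsub>R\<^esub> (I \<inter> K)"
    then show "x \<in> I \<inter> (J <+>\<^bsub>R\<^esub> K)"
      using right_idealD(3)[OF I] unfolding set_add_def' by blast
  }
qed

section \<open>The center and central essentiality\<close>

lemma ring_center_closed:
  assumes "x \<in> ring_center R" shows "x \<in> carrier R"
  using assms by (simp add: ring_center_def)

lemma ring_centerD:
  assumes "x \<in> ring_center R" "a \<in> carrier R" shows "x \<otimes> a = a \<otimes> x"
  using assms by (simp add: ring_center_def)

lemma one_in_center [simp]: "\<one> \<in> ring_center R"
  by (simp add: ring_center_def)

lemma ring_center_mult:
  assumes "x \<in> ring_center R" "y \<in> ring_center R" shows "x \<otimes> y \<in> ring_center R"
proof -
  have "x \<otimes> y \<otimes> a = a \<otimes> (x \<otimes> y)" if "a \<in> carrier R" for a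
  proof -
    note c = assms[THEN ring_center_closed] that
    have "x \<otimes> y \<otimes> a = x \<otimes> a \<otimes> y"
      using c ring_centerD[OF assms(2) that] by (simp add: m_assoc)
    then show ?thesis using c ring_centerD[OF assms(1) that] by (simp add: m_assoc)
  qed
  then show ?thesis using assms[THEN ring_center_closed] unfolding ring_center_def by blast
qed

text \<open>The multiplier x = 1 serves central elements, so the commutative case merges with the
  other one; x \<noteq> 0 follows from a x \<noteq> 0.\<close>

lemma centrally_essential_iff:
  "centrally_essential R \<longleftrightarrow>
    (\<forall>a\<in>carrier R. a \<noteq> \<zero> \<longrightarrow> (\<exists>x\<in>ring_center R. a \<otimes> x \<in> ring_center R \<and> a \<otimes> x \<noteq> \<zero>))"
    (is "_ \<longleftrightarrow> ?R")
proof
  assume ce: "centrally_essential R"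
  show ?R
  proof (intro ballI impI)
    fix a assume a: "a \<in> carrier R" "a \<noteq> \<zero>"
    show "\<exists>x\<in>ring_center R. a \<otimes> x \<in> ring_center R \<and> a \<otimes> x \<noteq> \<zero>"
    proof (cases "a \<in> ring_center R")
      case True
      then show ?thesis using a by (intro bexI[of _ \<one>]) auto
    next
      case False
      then have "\<not> cring R" using a(1) by (auto simp: ring_center_def intro: cring.cring_simprules(14))
      then show ?thesis using ce False a unfolding centrally_essential_def by metis
    qed
  qed
next
  assume R: ?R
  then show "centrally_essential R"
    unfolding centrally_essential_def by (metis r_null)
qed

lemma central_multiple:
  assumes "centrally_essential R" "a \<in> carrier R" "a \<noteq> \<zero>"
  shows "\<exists>x\<in>ring_center R. a \<otimes> x \<in> ring_center R \<and> a \<otimes> x \<noteq> \<zero>"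
  using assms by (simp add: centrally_essential_iff)

lemma divides_finsum:
  assumes "finite F" "i \<in> carrier R" "\<And>k. k \<in> F \<Longrightarrow> f k \<in> carrier R" "\<And>k. k \<in> F \<Longrightarrow> i divides (f k)"
  shows "i divides finsum R f F"
  using assms
proof (induction F rule: finite_induct)
  case (insert x F)
  have "finsum R f (insert x F) = f x \<oplus> finsum R f F"
    using insert by (intro finsum_insert) auto
  then show ?case using insert by (auto intro: divides_add)
qed simp

end

section \<open>Right invariant rings\<close>

definition nilpotents :: "('a, 'm) ring_scheme \<Rightarrow> 'a set" where
  "nilpotents R = {a \<in> carrier R. \<exists>n::nat. a [^]\<^bsub>R\<^esub> n = \<zero>\<^bsub>R\<^esub>}"

definition completely_prime :: "'a set \<Rightarrow> ('a, 'm) ring_scheme \<Rightarrow> bool" where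
  "completely_prime Q R \<longleftrightarrow> right_ideal Q R \<and> \<one>\<^bsub>R\<^esub> \<notin> Q \<and>
     (\<forall>a\<in>carrier R. \<forall>b\<in>carrier R. a \<otimes>\<^bsub>R\<^esub> b \<in> Q \<longrightarrow> a \<in> Q \<or> b \<in> Q)"

text \<open>The assumption is A a \<subseteq> a A for all a, that is, right invariance in
  elementwise form. Despite the name, a A \<subseteq> A a is not part of it.\<close>

locale duo_ring = ring +
  assumes duo: "a \<in> carrier R \<Longrightarrow> b \<in> carrier R \<Longrightarrow> a divides b \<otimes> a"
begin

lemma duoE:
  assumes "a \<in> carrier R" "b \<in> carrier R"
  obtains c where "c \<in> carrier R" "b \<otimes> a = a \<otimes> c"
  using duo[OF assms] by (elim dividesE)

lemma right_ideal_mult_left: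
  assumes "right_ideal I R" "a \<in> I" "r \<in> carrier R" shows "r \<otimes> a \<in> I"
  using right_ideal_divides[OF assms(1,2) duo] assms right_idealD(1) by blast

lemma right_ideal_imp_ideal: "right_ideal I R \<Longrightarrow> ideal I R"
  unfolding ideal_iff_right_left
  using right_ideal_mult_left by (auto simp: right_ideal_def left_ideal_def)

text \<open>A right inverse is two-sided: if a b = 1, write a b = b c; then a = a (b c) = (a b) c =
  c, so b a = b c = 1.\<close>

lemma Units_iff_divides_one: "a \<in> Units R \<longleftrightarrow> a \<in> carrier R \<and> a divides \<one>"
proof
  assume "a \<in> Units R"
  then show "a \<in> carrier R \<and> a divides \<one>"
    using Units_r_inv[of a] by (auto intro!: dividesI[of "inv a"])
next
  assume "a \<in> carrier R \<and> a divides \<one>"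
  then obtain b where a: "a \<in> carrier R" and b: "b \<in> carrier R" "\<one> = a \<otimes> b" by (auto elim: dividesE)
  from duoE[OF b(1) a] obtain c where c: "c \<in> carrier R" "a \<otimes> b = b \<otimes> c" .
  have "a = a \<otimes> (b \<otimes> c)" using a b c by (metis r_one)
  also have "\<dots> = c" using a b c by (metis l_one m_assoc)
  finally have "b \<otimes> a = \<one>" using b c by simp
  then show "a \<in> Units R" using a b unfolding Units_def by auto
qed

section \<open>Comaximality, units and idempotents\<close>

definition comaximal :: "'a \<Rightarrow> 'a set \<Rightarrow> bool" where
  "comaximal a J \<longleftrightarrow> (\<exists>x\<in>carrier R. \<exists>j\<in>J. a \<otimes> x \<oplus> j = \<one>)"

text \<open>Let a x + i = 1 and b y + j = 1. Inserting b y + j between a and x gives a b y x + (a j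
  x + i) = 1, and the bracket lies in J because right ideals absorb left factors here.\<close>

lemma comaximal_mult:
  assumes J: "right_ideal J R" and a: "a \<in> carrier R" and b: "b \<in> carrier R"
    and "comaximal a J" "comaximal b J"
  shows "comaximal (a \<otimes> b) J"
proof -
  from assms obtain x i y j where x: "x \<in> carrier R" "i \<in> J" "a \<otimes> x \<oplus> i = \<one>"
    and y: "y \<in> carrier R" "j \<in> J" "b \<otimes> y \<oplus> j = \<one>" unfolding comaximal_def by blast
  have ij: "i \<in> carrier R" "j \<in> carrier R" using right_idealD(1)[OF J] x y by auto
  have "a \<otimes> b \<otimes> (y \<otimes> x) \<oplus> (a \<otimes> j \<otimes> x \<oplus> i) = a \<otimes> ((b \<otimes> y \<oplus> j) \<otimes> x) \<oplus> i"
    using a b x(1) y(1) ij by algebra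
  also have "\<dots> = \<one>" using x y by simp
  finally have "a \<otimes> b \<otimes> (y \<otimes> x) \<oplus> (a \<otimes> j \<otimes> x \<oplus> i) = \<one>" .
  moreover have "a \<otimes> j \<otimes> x \<oplus> i \<in> J"
    using x y a right_idealD(3,4)[OF J] right_ideal_mult_left[OF J] by simp
  ultimately show ?thesis unfolding comaximal_def using x(1) y(1) m_closed by blast
qed

lemma comaximal_pow:
  assumes J: "right_ideal J R" and a: "a \<in> carrier R" and "comaximal a J"
  shows "comaximal (a [^] (n::nat)) J"
proof (induction n)
  case 0
  show ?case using right_idealD(2)[OF J] unfolding comaximal_def
    by (intro bexI[of _ \<one>] bexI[of _ \<zero>]) auto
next
  case (Suc n)
  then show ?case using comaximal_mult[OF J _ a Suc assms(3)] a by simp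
qed

lemma comaximal_zero:
  assumes "right_ideal J R" "comaximal \<zero> J" shows "\<one> \<in> J"
  using assms right_idealD(1)[OF assms(1)] unfolding comaximal_def by auto

text \<open>The element a is comaximal with (1 - a) A, hence so is each power of a; for a power
  equal to 0 this says that 1 lies in (1 - a) A.\<close>

lemma one_minus_nilpotent_unit:
  assumes a: "a \<in> nilpotents R"
  shows "\<one> \<ominus> a \<in> Units R"
proof -
  have ac: "a \<in> carrier R" using a by (simp add: nilpotents_def)
  let ?J = "{r \<in> carrier R. (\<one> \<ominus> a) divides r}"
  have J: "right_ideal ?J R" using ac by (intro right_ideal_principal) auto
  have "comaximal a ?J" unfolding comaximal_def
  proof (intro bexI)
    show "a \<otimes> \<one> \<oplus> (\<one> \<ominus> a) = \<one>"
      using ac by (simp add: minus_eq a_comm[of a] a_assoc l_neg)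
  qed (use ac in auto)
  moreover obtain n :: nat where "a [^] n = \<zero>" using a by (auto simp: nilpotents_def)
  ultimately have "comaximal \<zero> ?J" using comaximal_pow[OF J ac, of n] by simp
  from comaximal_zero[OF J this] show ?thesis using ac by (simp add: Units_iff_divides_one)
qed

text \<open>If g f = 0 then g A f \<subseteq> g f A = 0. Taking e and 1 - e in both orders for g and
  f gives e a = e a e = a e.\<close>

lemma idempotent_central:
  assumes e: "e \<in> carrier R" "e \<otimes> e = e"
  shows "e \<in> ring_center R"
proof -
  have annih: "g \<otimes> (a \<otimes> f) = \<zero>"
    if "g \<in> carrier R" "f \<in> carrier R" "g \<otimes> f = \<zero>" "a \<in> carrier R" for g f a
  proof -
    from duoE[OF that(2,4)] obtain c where c: "c \<in> carrier R" "a \<otimes> f = f \<otimes> c" .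
    show ?thesis unfolding c using that c by (simp add: m_assoc[symmetric])
  qed
  have "e \<otimes> a = a \<otimes> e" if a: "a \<in> carrier R" for a
  proof -
    have f: "\<one> \<ominus> e \<in> carrier R" "e \<otimes> (\<one> \<ominus> e) = \<zero>" "(\<one> \<ominus> e) \<otimes> e = \<zero>"
      using e by (simp_all add: l_distr r_distr minus_eq l_minus r_minus r_neg)
    have "e \<otimes> (a \<otimes> (\<one> \<ominus> e)) = e \<otimes> a \<ominus> e \<otimes> (a \<otimes> e)"
      using a e(1) by (simp add: r_distr minus_eq r_minus)
    then have "e \<otimes> a = e \<otimes> (a \<otimes> e)" using annih[OF e(1) f(1,2) a] a e(1)
      by (metis m_closed minus_eq_zero_iff)
    moreover have "(\<one> \<ominus> e) \<otimes> (a \<otimes> e) = a \<otimes> e \<ominus> e \<otimes> (a \<otimes> e)"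
      using a e(1) by (simp add: l_distr minus_eq l_minus)
    then have "a \<otimes> e = e \<otimes> (a \<otimes> e)" using annih[OF f(1) e(1) f(3) a] a e(1)
      by (metis m_closed minus_eq_zero_iff)
    ultimately show ?thesis by (rule trans[OF _ sym])
  qed
  then show ?thesis using e(1) unfolding ring_center_def by blast
qed

section \<open>Completely prime ideals and the prime radical\<close>

lemma right_ideal_add_principal:
  assumes Q: "right_ideal Q R" and x: "x \<in> carrier R"
  shows "right_ideal {q \<oplus> x \<otimes> r | q r. q \<in> Q \<and> r \<in> carrier R} R" (is "right_ideal ?S R")
proof (rule right_idealI)
  note Qc = subsetD[OF right_idealD(1)[OF Q]]
  show "?S \<subseteq> carrier R" using Qc x by auto
  show "\<zero> \<in> ?S" using right_idealD(2)[OF Q] x by (force intro: exI[of _ \<zero>])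
  show "a \<oplus> b \<in> ?S" if ab: "a \<in> ?S" "b \<in> ?S" for a b
  proof -
    from ab obtain p r q s where p: "p \<in> Q" "r \<in> carrier R" "a = p \<oplus> x \<otimes> r"
      and q: "q \<in> Q" "s \<in> carrier R" "b = q \<oplus> x \<otimes> s" by auto
    have "a \<oplus> b = (p \<oplus> q) \<oplus> x \<otimes> (r \<oplus> s)"
      unfolding p(3) q(3) using Qc[OF p(1)] Qc[OF q(1)] p(2) q(2) x by algebra
    then show ?thesis using right_idealD(3)[OF Q p(1) q(1)] p(2) q(2) by blast
  qed
  show "a \<otimes> t \<in> ?S" if at: "a \<in> ?S" "t \<in> carrier R" for a t
  proof -
    from at obtain p r where p: "p \<in> Q" "r \<in> carrier R" "a = p \<oplus> x \<otimes> r" by auto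
    have "a \<otimes> t = p \<otimes> t \<oplus> x \<otimes> (r \<otimes> t)"
      unfolding p(3) using Qc[OF p(1)] p(2) at(2) x by algebra
    then show ?thesis using right_idealD(4)[OF Q p(1) at(2)] p(2) at(2) by blast
  qed
qed

lemma completely_prime_pow:
  assumes "completely_prime Q R" "a \<in> carrier R" "a [^] (n::nat) \<in> Q"
  shows "a \<in> Q"
  using assms(3)
proof (induction n)
  case 0
  then show ?case using assms(1) by (simp add: completely_prime_def)
next
  case (Suc n)
  then show ?case using assms(1,2) by (auto simp: completely_prime_def)
qed

text \<open>Zorn's lemma yields a right ideal Q maximal among those that contain no power of a. If x
  and y lie outside Q, some powers of a lie in Q + x A and in Q + y A, and their product lies in Q +
  x y A; so x y is not in Q.\<close>

lemma exists_completely_prime: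
  assumes a: "a \<in> carrier R" "a \<notin> nilpotents R"
  shows "\<exists>Q. completely_prime Q R \<and> a \<notin> Q"
proof -
  define \<A> where "\<A> = {I. right_ideal I R \<and> (\<forall>n::nat. a [^] n \<notin> I)}"
  have "\<exists>M\<in>\<A>. \<forall>X\<in>\<A>. M \<subseteq> X \<longrightarrow> X = M"
  proof (rule subset_Zorn_nonempty)
    have "right_ideal {\<zero>} R" by (rule right_idealI) auto
    then have "{\<zero>} \<in> \<A>" using a by (auto simp: \<A>_def nilpotents_def)
    then show "\<A> \<noteq> {}" by auto
    fix C assume C: "C \<noteq> {}" "subset.chain \<A> C"
    then have CA: "\<And>I. I \<in> C \<Longrightarrow> right_ideal I R \<and> (\<forall>n::nat. a [^] n \<notin> I)"
      by (auto simp: subset.chain_def \<A>_def)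
    have "right_ideal (\<Union>C) R"
    proof (rule right_idealI)
      show "\<Union>C \<subseteq> carrier R" using CA right_idealD(1) by blast
      show "\<zero> \<in> \<Union>C" using CA C(1) right_idealD(2) by blast
      show "x \<otimes> r \<in> \<Union>C" if "x \<in> \<Union>C" "r \<in> carrier R" for x r
        using CA that right_idealD(4) by blast
      show "x \<oplus> y \<in> \<Union>C" if "x \<in> \<Union>C" "y \<in> \<Union>C" for x y
      proof -
        from that obtain I J where IJ: "I \<in> C" "J \<in> C" "x \<in> I" "y \<in> J" by auto
        then have "I \<subseteq> J \<or> J \<subseteq> I" using C(2) unfolding subset_chain_def by blast
        then show ?thesis using IJ CA right_idealD(3) by blast
      qed
    qed
    then show "\<Union>C \<in> \<A>" using CA by (auto simp: \<A>_def)
  qed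
  then obtain Q where QA: "Q \<in> \<A>" and QX: "\<And>X. X \<in> \<A> \<Longrightarrow> Q \<subseteq> X \<Longrightarrow> X = Q" by blast
  have Q: "right_ideal Q R" "\<And>n::nat. a [^] n \<notin> Q" using QA by (auto simp: \<A>_def)
  have max: "\<exists>n::nat. a [^] n \<in> X" if "right_ideal X R" "Q \<subseteq> X" "X \<noteq> Q" for X
    using that QX[of X] by (auto simp: \<A>_def)
  note Qc = subsetD[OF right_idealD(1)[OF Q(1)]]
  have pow: "\<exists>n::nat. \<exists>q\<in>Q. \<exists>r\<in>carrier R. a [^] n = q \<oplus> x \<otimes> r"
    if x: "x \<in> carrier R" "x \<notin> Q" for x
  proof -
    let ?S = "{q \<oplus> x \<otimes> r | q r. q \<in> Q \<and> r \<in> carrier R}"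
    have "Q \<subseteq> ?S"
    proof
      fix q assume "q \<in> Q"
      moreover then have "q = q \<oplus> x \<otimes> \<zero>" using Qc x by simp
      ultimately show "q \<in> ?S" using zero_closed by blast
    qed
    moreover have "x = \<zero> \<oplus> x \<otimes> \<one>" using x by simp
    then have "x \<in> ?S" using right_idealD(2)[OF Q(1)] one_closed by blast
    ultimately have "\<exists>n::nat. a [^] n \<in> ?S"
      using max[OF right_ideal_add_principal[OF Q(1) x(1)]] x(2) by blast
    then show ?thesis by blast
  qed
  have "x \<in> Q \<or> y \<in> Q" if xy: "x \<in> carrier R" "y \<in> carrier R" "x \<otimes> y \<in> Q" for x y
  proof (rule ccontr)
    assume "\<not> (x \<in> Q \<or> y \<in> Q)"
    with pow[OF xy(1)] pow[OF xy(2)] obtain m n :: nat and q r p s where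
      q: "q \<in> Q" "r \<in> carrier R" "a [^] m = q \<oplus> x \<otimes> r" and
      p: "p \<in> Q" "s \<in> carrier R" "a [^] n = p \<oplus> y \<otimes> s" by blast
    \<comment> \<open>The coefficient r stands between x and y; it is moved behind y so that x y
      appears as a factor.\<close>
    from duoE[OF xy(2) q(2)] obtain r' where r': "r' \<in> carrier R" "r \<otimes> y = y \<otimes> r'" .
    have "a [^] (m + n) = (q \<oplus> x \<otimes> r) \<otimes> (p \<oplus> y \<otimes> s)"
      using q p a(1) by (simp add: nat_pow_mult[symmetric])
    also have "\<dots> = q \<otimes> (p \<oplus> y \<otimes> s) \<oplus> ((x \<otimes> r) \<otimes> p \<oplus> x \<otimes> (r \<otimes> y) \<otimes> s)"
      using Qc[OF q(1)] Qc[OF p(1)] q(2) p(2) xy(1,2) by algebra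
    also have "x \<otimes> (r \<otimes> y) \<otimes> s = (x \<otimes> y) \<otimes> (r' \<otimes> s)"
      unfolding r'(2) using xy r'(1) p(2) by (simp add: m_assoc)
    also have "q \<otimes> (p \<oplus> y \<otimes> s) \<oplus> ((x \<otimes> r) \<otimes> p \<oplus> (x \<otimes> y) \<otimes> (r' \<otimes> s)) \<in> Q"
      using right_idealD(3,4)[OF Q(1)] right_ideal_mult_left[OF Q(1)] Qc[OF p(1)] xy q(1,2) p(1,2) r'(1)
      by simp
    finally show False using Q(2) by blast
  qed
  \<comment> \<open>The exponent 0 is among those avoided by Q, so Q is proper.\<close>
  moreover have "\<one> \<notin> Q" using Q(2)[of 0] by simp
  moreover have "a \<notin> Q" using Q(2)[of 1] a(1) by simp
  ultimately show ?thesis unfolding completely_prime_def using Q(1) by blast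
qed

text \<open>The product of a A and b A is contained in a b A, since a r b s = a b r' s. Primeness
  applied to these two ideals is therefore primeness for the elements a and b.\<close>

lemma prime_ideal_imp_completely_prime:
  assumes "prime_ideal Q R" shows "completely_prime Q R"
proof -
  have Q: "ideal Q R" "Q \<noteq> carrier R"
    and prime: "\<And>I J. ideal I R \<Longrightarrow> ideal J R \<Longrightarrow> I \<cdot>\<^bsub>R\<^esub> J \<subseteq> Q \<Longrightarrow> I \<subseteq> Q \<or> J \<subseteq> Q"
    using assms unfolding prime_ideal_def by auto
  have rQ: "right_ideal Q R" using Q(1) ideal_iff_right_left by blast
  have "\<one> \<notin> Q" using Q ideal.one_imp_carrier by blast
  moreover have "a \<in> Q \<or> b \<in> Q" if ab: "a \<in> carrier R" "b \<in> carrier R" "a \<otimes> b \<in> Q" for a b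
  proof -
    let ?P = "\<lambda>a. {r \<in> carrier R. a divides r}"
    have "z \<in> Q" if "z \<in> ?P a \<cdot>\<^bsub>R\<^esub> ?P b" for z
      using that
    proof (induction rule: ideal_prod.induct)
      case (prod i j)
      then obtain r s where r: "r \<in> carrier R" "i = a \<otimes> r" and s: "s \<in> carrier R" "j = b \<otimes> s"
        by (auto elim!: dividesE)
      from duoE[OF ab(2) r(1)] obtain r' where r': "r' \<in> carrier R" "r \<otimes> b = b \<otimes> r'" .
      have "i \<otimes> j = a \<otimes> (r \<otimes> b) \<otimes> s" unfolding r s using ab r(1) s(1) by (simp add: m_assoc)
      also have "\<dots> = (a \<otimes> b) \<otimes> (r' \<otimes> s)" unfolding r'(2) using ab r'(1) s(1) by (simp add: m_assoc)
      finally show ?case using right_idealD(4)[OF rQ ab(3)] r'(1) s(1) by simp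
    next
      case (sum s1 s2)
      then show ?case using right_idealD(3)[OF rQ] by blast
    qed
    then have "?P a \<subseteq> Q \<or> ?P b \<subseteq> Q"
      using ab by (intro prime right_ideal_imp_ideal right_ideal_principal) auto
    moreover have "a \<in> ?P a" "b \<in> ?P b" using ab by auto
    ultimately show ?thesis by blast
  qed
  ultimately show ?thesis using rQ unfolding completely_prime_def by blast
qed

lemma completely_prime_imp_prime_ideal:
  assumes "completely_prime Q R" shows "prime_ideal Q R"
proof -
  have Q: "right_ideal Q R" "\<one> \<notin> Q"
    and prime: "\<And>a b. a \<in> carrier R \<Longrightarrow> b \<in> carrier R \<Longrightarrow> a \<otimes> b \<in> Q \<Longrightarrow> a \<in> Q \<or> b \<in> Q"
    using assms unfolding completely_prime_def by auto
  have "I \<subseteq> Q \<or> J \<subseteq> Q" if IJ: "ideal I R" "ideal J R" "I \<cdot>\<^bsub>R\<^esub> J \<subseteq> Q" for I J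
  proof (rule ccontr)
    assume "\<not> (I \<subseteq> Q \<or> J \<subseteq> Q)"
    then obtain a b where ab: "a \<in> I" "a \<notin> Q" "b \<in> J" "b \<notin> Q" by auto
    then have "a \<otimes> b \<in> Q" using IJ(3) ideal_prod.prod[of a I b J R] by blast
    then show False using prime ab IJ ideal.Icarr by metis
  qed
  then show ?thesis unfolding prime_ideal_def using right_ideal_imp_ideal Q by auto
qed

lemma nilpotents_iff:
  "a \<in> nilpotents R \<longleftrightarrow> a \<in> carrier R \<and> (\<forall>Q. completely_prime Q R \<longrightarrow> a \<in> Q)"
proof (intro iffI conjI allI impI)
  fix Q assume a: "a \<in> nilpotents R" and Q: "completely_prime Q R"
  from a obtain n :: nat where "a \<in> carrier R" "a [^] n = \<zero>" by (auto simp: nilpotents_def)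
  moreover have "\<zero> \<in> Q" using Q right_idealD(2) by (auto simp: completely_prime_def)
  ultimately show "a \<in> Q" using completely_prime_pow[OF Q] by metis
qed (use exists_completely_prime in \<open>auto simp: nilpotents_def\<close>)

lemma prime_radical_eq_nilpotents: "prime_radical R = nilpotents R"
  unfolding prime_radical_def set_eq_iff nilpotents_iff
  using prime_ideal_imp_completely_prime completely_prime_imp_prime_ideal by blast

lemma right_ideal_nilpotents: "right_ideal (nilpotents R) R"
proof (rule right_idealI)
  show "nilpotents R \<subseteq> carrier R" by (auto simp: nilpotents_def)
qed (auto simp: nilpotents_iff completely_prime_def right_idealD)

lemma nilpotents_closed: "a \<in> nilpotents R \<Longrightarrow> a \<in> carrier R"
  by (simp add: nilpotents_def)

lemma nilpotents_square:
  assumes "a \<in> carrier R" "a \<otimes> a \<in> nilpotents R" shows "a \<in> nilpotents R"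
  using assms unfolding nilpotents_iff completely_prime_def by blast

text \<open>Each completely prime ideal contains a or b, so membership of x in P may be checked
  under either alternative. In this way factors can be swapped and separated modulo P although A is
  not commutative.\<close>

lemma nilpotent_if_factors_imp:
  assumes ab: "a \<in> carrier R" "b \<in> carrier R" "a \<otimes> b \<in> nilpotents R" and x: "x \<in> carrier R"
    and imp: "\<And>Q. right_ideal Q R \<Longrightarrow> a \<in> Q \<or> b \<in> Q \<Longrightarrow> x \<in> Q"
  shows "x \<in> nilpotents R"
  unfolding nilpotents_iff
proof (intro conjI allI impI x)
  fix Q assume Q: "completely_prime Q R"
  then have "a \<in> Q \<or> b \<in> Q" using ab unfolding nilpotents_iff completely_prime_def by blast
  then show "x \<in> Q" using Q by (intro imp) (auto simp: completely_prime_def)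
qed

lemma nilpotents_insert:
  assumes "a \<in> carrier R" "b \<in> carrier R" "r \<in> carrier R" "a \<otimes> b \<in> nilpotents R"
  shows "a \<otimes> r \<otimes> b \<in> nilpotents R"
  by (rule nilpotent_if_factors_imp[OF assms(1,2,4)])
    (use assms right_idealD(4) right_ideal_mult_left in auto)

lemma nilpotents_swap:
  assumes "a \<in> carrier R" "b \<in> carrier R" "a \<otimes> b \<in> nilpotents R"
  shows "b \<otimes> a \<in> nilpotents R"
  by (rule nilpotent_if_factors_imp[OF assms])
    (use assms right_idealD(4) right_ideal_mult_left in auto)

end

section \<open>Orthogonal elements and idempotents\<close>

text \<open>The elementwise source of an infinite direct sum in A/P: the terms are nonzero and
  mutually orthogonal modulo P.\<close>

definition has_orthogonal_sequence :: "('a, 'm) ring_scheme \<Rightarrow> bool" where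
  "has_orthogonal_sequence R \<longleftrightarrow>
     (\<exists>a :: nat \<Rightarrow> 'a. (\<forall>n. a n \<in> carrier R - nilpotents R) \<and>
        (\<forall>i j. i \<noteq> j \<longrightarrow> a i \<otimes>\<^bsub>R\<^esub> a j \<in> nilpotents R))"

context duo_ring
begin

text \<open>Modulo a completely prime ideal one of s and x vanishes, so s + x vanishes there only if
  both do; otherwise c vanishes. A sum of orthogonal elements thus remembers what annihilates each
  summand.\<close>

lemma orthogonal_sum_annihilated:
  assumes c: "s \<in> carrier R" "x \<in> carrier R" "c \<in> carrier R"
    and sx: "s \<otimes> x \<in> nilpotents R" and sc: "(s \<oplus> x) \<otimes> c \<in> nilpotents R"
  shows "s \<otimes> c \<in> nilpotents R" "x \<otimes> c \<in> nilpotents R"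
proof -
  have "s \<otimes> c \<in> Q \<and> x \<otimes> c \<in> Q" if Q: "completely_prime Q R" for Q
  proof -
    have rQ: "right_ideal Q R" and pQ: "\<And>a b. a \<in> carrier R \<Longrightarrow> b \<in> carrier R \<Longrightarrow> a \<otimes> b \<in> Q \<Longrightarrow> a \<in> Q \<or> b \<in> Q"
      using Q by (auto simp: completely_prime_def)
    have "s \<in> Q \<or> x \<in> Q" "s \<oplus> x \<in> Q \<or> c \<in> Q"
      using pQ c sx sc Q by (auto simp: nilpotents_iff)
    moreover have "x \<in> Q" if "s \<in> Q" "s \<oplus> x \<in> Q"
    proof -
      have "x = (s \<oplus> x) \<oplus> s \<otimes> (\<ominus> \<one>)" using c
        by (simp add: r_minus a_comm[of s x] a_assoc r_neg)
      then show ?thesis using that right_idealD(3,4)[OF rQ] by (metis a_inv_closed one_closed)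
    qed
    moreover have "s \<in> Q" if "x \<in> Q" "s \<oplus> x \<in> Q"
    proof -
      have "s = (s \<oplus> x) \<oplus> x \<otimes> (\<ominus> \<one>)" using c by (simp add: r_minus a_assoc r_neg)
      then show ?thesis using that right_idealD(3,4)[OF rQ] by (metis a_inv_closed one_closed)
    qed
    ultimately show ?thesis
      using right_idealD(4)[OF rQ] right_ideal_mult_left[OF rQ] c by blast
  qed
  then show "s \<otimes> c \<in> nilpotents R" "x \<otimes> c \<in> nilpotents R"
    using c by (auto simp: nilpotents_iff)
qed

text \<open>Otherwise every orthogonal pair s, x admits some c outside P with s c and x c in P, and
  then s + x, c is again such a pair. In the iteration s carries the sum of all earlier terms and x
  is the newest one, so a new term has to be orthogonal to two elements only.\<close>

lemma exists_maximal_orthogonal_pair: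
  assumes no: "\<not> has_orthogonal_sequence R"
    and ab: "a \<in> carrier R - nilpotents R" "b \<in> carrier R - nilpotents R" "a \<otimes> b \<in> nilpotents R"
  shows "\<exists>a\<in>carrier R - nilpotents R. \<exists>b\<in>carrier R - nilpotents R. a \<otimes> b \<in> nilpotents R \<and>
    (\<forall>c\<in>carrier R. a \<otimes> c \<in> nilpotents R \<and> b \<otimes> c \<in> nilpotents R \<longrightarrow> c \<in> nilpotents R)"
proof (rule ccontr)
  let ?N = "nilpotents R"
  assume "\<not> ?thesis"
  then have ex: "\<exists>c\<in>carrier R - ?N. a \<otimes> c \<in> ?N \<and> b \<otimes> c \<in> ?N"
    if "a \<in> carrier R - ?N" "b \<in> carrier R - ?N" "a \<otimes> b \<in> ?N" for a b
    using that by blast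
  define good where
    "good = (\<lambda>(n::nat) (s, x). s \<in> carrier R - ?N \<and> x \<in> carrier R - ?N \<and> s \<otimes> x \<in> ?N)"
  define step where
    "step = (\<lambda>(n::nat) (s, x) (s', x'). s' = s \<oplus> x \<and> s \<otimes> x' \<in> ?N \<and> x \<otimes> x' \<in> ?N)"
  have "\<exists>f. \<forall>n. good n (f n) \<and> step n (f n) (f (Suc n))"
  proof (rule dependent_nat_choice)
    show "\<exists>u. good 0 u" using ab by (auto simp: good_def)
    fix u n assume g: "good n u"
    obtain s x where u: "u = (s, x)" by (cases u)
    from g u have sx: "s \<in> carrier R - ?N" "x \<in> carrier R - ?N" "s \<otimes> x \<in> ?N"
      by (auto simp: good_def)
    from ex[OF this] obtain c where c: "c \<in> carrier R - ?N" "s \<otimes> c \<in> ?N" "x \<otimes> c \<in> ?N" by auto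
    \<comment> \<open>If s + x were in P, then taking 1 for the third element of
      \<open>orthogonal_sum_annihilated\<close> would put s into P.\<close>
    have "s \<oplus> x \<notin> ?N"
    proof
      assume "s \<oplus> x \<in> ?N"
      then have "(s \<oplus> x) \<otimes> \<one> \<in> ?N" using sx by simp
      from orthogonal_sum_annihilated(1)[OF _ _ _ sx(3) this] sx show False by simp
    qed
    moreover have "(s \<oplus> x) \<otimes> c \<in> ?N"
      using c sx right_idealD(3)[OF right_ideal_nilpotents] by (simp add: l_distr)
    ultimately have "good (Suc n) (s \<oplus> x, c) \<and> step n u (s \<oplus> x, c)"
      using sx c by (auto simp: good_def step_def u)
    then show "\<exists>v. good (Suc n) v \<and> step n u v" by blast
  qed
  then obtain f where f: "\<And>n. good n (f n)" "\<And>n. step n (f n) (f (Suc n))" by auto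
  define s x where "s n = fst (f n)" and "x n = snd (f n)" for n
  have sx: "s n \<in> carrier R - ?N" "x n \<in> carrier R - ?N" "s n \<otimes> x n \<in> ?N"
    "s (Suc n) = s n \<oplus> x n" for n
    using f[of n] by (auto simp: good_def step_def s_def x_def split: prod.splits)
  \<comment> \<open>Going down from j, annihilation by s_j is unpacked into annihilation by each
    summand x_i with i < j.\<close>
  have ann: "x i \<otimes> c \<in> ?N" if "i < j" "c \<in> carrier R" "s j \<otimes> c \<in> ?N" for i j c
    using that
  proof (induction j)
    case 0
    then show ?case by simp
  next
    case (Suc j)
    have "s j \<otimes> c \<in> ?N" "x j \<otimes> c \<in> ?N"
      using orthogonal_sum_annihilated[of "s j" "x j" c] sx[of j] Suc.prems by auto
    then show ?case using Suc by (cases "i = j") auto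
  qed
  have lt: "x i \<otimes> x j \<in> ?N" if "i < j" for i j
    using ann[OF that] sx[of j] by auto
  have "x i \<otimes> x j \<in> ?N" if "i \<noteq> j" for i j
    using that lt[of i j] lt[of j i] nilpotents_swap[of "x j" "x i"] sx(2)
    by (cases i j rule: linorder_cases) auto
  with sx(2) have "has_orthogonal_sequence R" unfolding has_orthogonal_sequence_def by blast
  with no show False ..
qed

end

section \<open>Splitting orthogonal pairs and lifting idempotents\<close>

locale distributive_duo_ring = duo_ring +
  assumes dist: "a \<in> carrier R \<Longrightarrow> b \<in> carrier R \<Longrightarrow>
    \<exists>t\<in>carrier R. b divides a \<otimes> t \<and> a divides b \<otimes> (\<one> \<ominus> t)"
begin

text \<open>From a t = b y one gets (a t)(a t) = b y a t, which lies in P because b a does; hence a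
  t lies in P. The same works for b (1 - t).\<close>

lemma orthogonal_split:
  assumes a: "a \<in> carrier R" and b: "b \<in> carrier R" and ab: "a \<otimes> b \<in> nilpotents R"
  shows "\<exists>t\<in>carrier R. a \<otimes> t \<in> nilpotents R \<and> b \<otimes> (\<one> \<ominus> t) \<in> nilpotents R"
proof -
  note N = right_ideal_nilpotents
  from dist[OF a b] obtain t y z where t: "t \<in> carrier R"
    and y: "y \<in> carrier R" "a \<otimes> t = b \<otimes> y" and z: "z \<in> carrier R" "b \<otimes> (\<one> \<ominus> t) = a \<otimes> z"
    by (auto elim!: dividesE)
  have t': "\<one> \<ominus> t \<in> carrier R" using t by simp
  have "b \<otimes> y \<otimes> a \<otimes> t \<in> nilpotents R"
    using right_idealD(4)[OF N nilpotents_insert[OF b a y(1) nilpotents_swap[OF a b ab]] t] .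
  then have "(a \<otimes> t) \<otimes> (a \<otimes> t) \<in> nilpotents R" using y a b t by (simp add: m_assoc)
  moreover have "a \<otimes> z \<otimes> b \<otimes> (\<one> \<ominus> t) \<in> nilpotents R"
    using right_idealD(4)[OF N nilpotents_insert[OF a b z(1) ab] t'] .
  then have "(b \<otimes> (\<one> \<ominus> t)) \<otimes> (b \<otimes> (\<one> \<ominus> t)) \<in> nilpotents R"
    using z a b t' by (simp add: m_assoc)
  ultimately show ?thesis using nilpotents_square a b t t' by (meson m_closed)
qed

text \<open>For s = 1 - t both a and b annihilate t s modulo P, so t s is nilpotent by maximality
  and t^n s^n = 0 for some n. Since t + s = 1, the powers t^n and s^n are still comaximal, and e =
  t^n x from t^n x + s^n y = 1 is idempotent. If e were 0 or 1, then t or s would be nilpotent,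
  forcing b or a into P.\<close>

lemma maximal_orthogonal_pair_idempotent:
  assumes a: "a \<in> carrier R" "a \<notin> nilpotents R" and b: "b \<in> carrier R" "b \<notin> nilpotents R"
    and ab: "a \<otimes> b \<in> nilpotents R"
    and max: "\<And>c. c \<in> carrier R \<Longrightarrow> a \<otimes> c \<in> nilpotents R \<Longrightarrow> b \<otimes> c \<in> nilpotents R \<Longrightarrow> c \<in> nilpotents R"
  shows "\<exists>e\<in>carrier R. e \<otimes> e = e \<and> e \<noteq> \<zero> \<and> e \<noteq> \<one>"
proof -
  let ?N = "nilpotents R"
  note N = right_idealD[OF right_ideal_nilpotents]
  from orthogonal_split[OF a(1) b(1) ab] obtain t where
    t: "t \<in> carrier R" "a \<otimes> t \<in> ?N" "b \<otimes> (\<one> \<ominus> t) \<in> ?N" by blast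
  define s where "s = \<one> \<ominus> t"
  have s: "s \<in> carrier R" "b \<otimes> s \<in> ?N" "t \<oplus> s = \<one>"
    using t by (auto simp: s_def minus_eq a_comm[of t] a_assoc l_neg)
  have ts: "t \<otimes> s = s \<otimes> t" using t by (simp add: s_def l_distr r_distr minus_eq l_minus r_minus)
  have "t \<otimes> s \<in> ?N"
  proof (rule max)
    show "a \<otimes> (t \<otimes> s) \<in> ?N" using N(4)[OF t(2) s(1)] a t s by (simp add: m_assoc)
    show "b \<otimes> (t \<otimes> s) \<in> ?N" unfolding ts using N(4)[OF s(2) t(1)] b t s by (simp add: m_assoc)
  qed (use t s in auto)
  then obtain n :: nat where "(t \<otimes> s) [^] n = \<zero>" by (auto simp: nilpotents_def)
  then have tsn: "t [^] n \<otimes> s [^] n = \<zero>" using pow_mult_distrib[OF ts t(1) s(1)] by simp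
  have "(s \<otimes> t) [^] n = \<zero>" using \<open>(t \<otimes> s) [^] n = \<zero>\<close> ts by simp
  then have stn: "s [^] n \<otimes> t [^] n = \<zero>" using pow_mult_distrib[OF ts[symmetric] s(1) t(1)] by simp
  have sn: "s [^] n \<in> carrier R" and tn: "t [^] n \<in> carrier R" using s t by auto
  let ?P = "\<lambda>a. {r \<in> carrier R. a divides r}"
  \<comment> \<open>Comaximality is raised in two rounds: s^n against t A, then t^n against s^n
    A.\<close>
  have "comaximal s (?P t)" unfolding comaximal_def
    by (intro bexI[of _ \<one>] bexI[of _ t]) (use s t in \<open>auto simp: a_comm\<close>)
  from comaximal_pow[OF right_ideal_principal[OF t(1)] s(1) this]
  have "comaximal (s [^] n) (?P t)" .
  then obtain u v where u: "u \<in> carrier R" and v: "v \<in> carrier R" and uv: "s [^] n \<otimes> u \<oplus> t \<otimes> v = \<one>"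
    unfolding comaximal_def by (auto elim!: dividesE)
  have "comaximal t (?P (s [^] n))" unfolding comaximal_def
    by (intro bexI[of _ v] bexI[of _ "s [^] n \<otimes> u"])
      (use u v uv sn t in \<open>auto simp: a_comm intro: dividesI\<close>)
  from comaximal_pow[OF right_ideal_principal[OF sn] t(1) this]
  have "comaximal (t [^] n) (?P (s [^] n))" .
  then obtain x y where x: "x \<in> carrier R" and y: "y \<in> carrier R"
    and xy: "t [^] n \<otimes> x \<oplus> s [^] n \<otimes> y = \<one>"
    unfolding comaximal_def by (auto elim!: dividesE)
  define e where "e = t [^] n \<otimes> x"
  define f where "f = s [^] n \<otimes> y"
  have ef: "e \<in> carrier R" "f \<in> carrier R" "e \<oplus> f = \<one>" using x y xy sn tn by (auto simp: e_def f_def)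
  from duoE[OF sn x] obtain x' where x': "x' \<in> carrier R" "x \<otimes> s [^] n = s [^] n \<otimes> x'" .
  have "e \<otimes> f = t [^] n \<otimes> (x \<otimes> s [^] n) \<otimes> y" using x y sn tn by (simp add: e_def f_def m_assoc)
  also have "\<dots> = (t [^] n \<otimes> s [^] n) \<otimes> (x' \<otimes> y)" unfolding x' using x' y sn tn by (simp add: m_assoc)
  also have "\<dots> = \<zero>" using tsn x' y by simp
  finally have ef0: "e \<otimes> f = \<zero>" .
  have "e = e \<otimes> (e \<oplus> f)" using ef by simp
  also have "\<dots> = e \<otimes> e" using ef(1,2) ef0 by (simp add: r_distr)
  finally have "e \<otimes> e = e" by (rule sym)
  moreover have "e \<noteq> \<zero>"
  proof
    assume "e = \<zero>"
    then have "s [^] n \<otimes> y = \<one>" using ef by (simp add: f_def)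
    then have "t [^] n = (t [^] n \<otimes> s [^] n) \<otimes> y" using tn sn y by (simp add: m_assoc)
    also have "\<dots> = \<zero>" using tsn y by simp
    finally have "t [^] n = \<zero>" .
    then have "t \<in> ?N" using t by (auto simp: nilpotents_def)
    then have "b \<otimes> t \<in> ?N" using right_ideal_mult_left[OF right_ideal_nilpotents] b by blast
    then have "b \<otimes> (t \<oplus> s) \<in> ?N" using N(3) s(1,2) b t(1) by (simp add: r_distr)
    then show False using s b by simp
  qed
  moreover have "e \<noteq> \<one>"
  proof
    assume "e = \<one>"
    then have "t [^] n \<otimes> x = \<one>" by (simp add: e_def)
    then have "s [^] n = (s [^] n \<otimes> t [^] n) \<otimes> x" using tn sn x by (simp add: m_assoc)
    also have "\<dots> = \<zero>" using stn x by simp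
    finally have "s [^] n = \<zero>" .
    then have "s \<in> ?N" using s by (auto simp: nilpotents_def)
    then have "a \<otimes> s \<in> ?N" using right_ideal_mult_left[OF right_ideal_nilpotents] a by blast
    then have "a \<otimes> (t \<oplus> s) \<in> ?N" using N(3) s(1) a t(1,2) by (simp add: r_distr)
    then show False using s a by simp
  qed
  ultimately show ?thesis using ef by blast
qed

lemma nilpotents_prime_if_indecomposable:
  assumes "\<not> has_orthogonal_sequence R"
    and indec: "\<And>e. e \<in> carrier R \<Longrightarrow> e \<otimes> e = e \<Longrightarrow> e = \<zero> \<or> e = \<one>"
    and ab: "a \<in> carrier R" "b \<in> carrier R" "a \<otimes> b \<in> nilpotents R"
  shows "a \<in> nilpotents R \<or> b \<in> nilpotents R"
proof (rule ccontr)
  assume "\<not> ?thesis"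
  then have "a \<in> carrier R - nilpotents R" "b \<in> carrier R - nilpotents R" using ab by auto
  from exists_maximal_orthogonal_pair[OF assms(1) this ab(3)]
  obtain a b where pair: "a \<in> carrier R - nilpotents R" "b \<in> carrier R - nilpotents R"
    "a \<otimes> b \<in> nilpotents R"
    and max: "\<forall>c\<in>carrier R. a \<otimes> c \<in> nilpotents R \<and> b \<otimes> c \<in> nilpotents R \<longrightarrow> c \<in> nilpotents R"
    by (elim bexE conjE)
  have "\<exists>e\<in>carrier R. e \<otimes> e = e \<and> e \<noteq> \<zero> \<and> e \<noteq> \<one>"
  proof (rule maximal_orthogonal_pair_idempotent)
    show "c \<in> nilpotents R"
      if "c \<in> carrier R" "a \<otimes> c \<in> nilpotents R" "b \<otimes> c \<in> nilpotents R" for c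
      using bspec[OF max that(1)] that(2,3) by (rule mp[OF _ conjI])
    show "a \<in> carrier R" "a \<notin> nilpotents R" using pair(1) by auto
    show "b \<in> carrier R" "b \<notin> nilpotents R" using pair(2) by auto
  qed (rule pair(3))
  then show False using indec by blast
qed

end

section \<open>Rings whose nilpotent elements form a completely prime ideal\<close>

text \<open>If l x = 0 then x already works for l; otherwise a central multiplier z of l x replaces
  x by x z. Nonvanishing is asked for some element of S rather than of F, so that it holds for x = 1
  in the base case and is restored by l after each replacement.\<close>

lemma (in ring) common_central_multiplier:
  assumes ce: "centrally_essential R"
    and S: "S \<subseteq> carrier R" "k \<in> S" "k \<noteq> \<zero>" and F: "finite F" "F \<subseteq> S"
  shows "\<exists>x\<in>ring_center R. (\<forall>j\<in>F. j \<otimes> x \<in> ring_center R) \<and> (\<exists>j\<in>S. j \<otimes> x \<noteq> \<zero>)"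
  using F
proof (induction F rule: finite_induct)
  case empty
  have "k \<otimes> \<one> \<noteq> \<zero>" using S by auto
  then show ?case using S(2) one_in_center by blast
next
  case (insert l F)
  then obtain x where x: "x \<in> ring_center R" "\<And>j. j \<in> F \<Longrightarrow> j \<otimes> x \<in> ring_center R"
    "\<exists>j\<in>S. j \<otimes> x \<noteq> \<zero>" by blast
  have l: "l \<in> carrier R" "l \<in> S" using insert.prems S by auto
  note xc = ring_center_closed[OF x(1)]
  show ?case
  proof (cases "l \<otimes> x = \<zero>")
    case True
    moreover have "\<zero> \<in> ring_center R" by (simp add: ring_center_def)
    ultimately show ?thesis using x by (intro bexI[of _ x]) auto
  next
    case False
    from central_multiple[OF ce _ False] l xc obtain z where
      z: "z \<in> ring_center R" "l \<otimes> x \<otimes> z \<in> ring_center R" "l \<otimes> x \<otimes> z \<noteq> \<zero>" by auto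
    note zc = ring_center_closed[OF z(1)]
    have "j \<otimes> (x \<otimes> z) \<in> ring_center R" if "j \<in> F" for j
    proof -
      have "j \<in> carrier R" using that insert.prems S by auto
      then have "j \<otimes> (x \<otimes> z) = (j \<otimes> x) \<otimes> z" using xc zc by (simp add: m_assoc)
      then show ?thesis using ring_center_mult[OF x(2)[OF that] z(1)] by simp
    qed
    moreover have "l \<otimes> (x \<otimes> z) = l \<otimes> x \<otimes> z" using l xc zc by (simp add: m_assoc)
    moreover from this have "\<exists>j\<in>S. j \<otimes> (x \<otimes> z) \<noteq> \<zero>" using z(3) l(2) by metis
    ultimately show ?thesis using z(2) ring_center_mult[OF x(1) z(1)]
      by (intro bexI[of _ "x \<otimes> z"]) auto
  qed
qed

text \<open>Meant for its contrapositive: if J is proper and the t_i sum to 1, some t_i^2 lies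
  outside J. The induction enlarges J by t_i A; once 1 lies in J + t_i A, the element t_i is
  comaximal with J, hence so is t_i^2, which already lies in J.\<close>

lemma (in duo_ring) one_mem_if_squares_mem:
  assumes "finite F" "right_ideal J R" "\<And>i. i \<in> F \<Longrightarrow> t i \<in> carrier R \<and> t i \<otimes> t i \<in> J"
    and "v \<in> J" "finsum R t F \<oplus> v = \<one>"
  shows "\<one> \<in> J"
  using assms
proof (induction F arbitrary: J v rule: finite_induct)
  case empty
  then show ?case using right_idealD(1)[OF empty(1)] by auto
next
  case (insert i F)
  have ti: "t i \<in> carrier R" using insert by auto
  let ?J = "{q \<oplus> t i \<otimes> r | q r. q \<in> J \<and> r \<in> carrier R}"
  note J = right_idealD[OF insert.prems(1)]
  have J': "right_ideal ?J R" using insert.prems(1) ti by (rule right_ideal_add_principal)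
  have sub: "q \<in> ?J" if "q \<in> J" for q
  proof -
    have "q = q \<oplus> t i \<otimes> \<zero>" using that J(1) ti by auto
    then show ?thesis using that zero_closed by blast
  qed
  have v: "v \<in> carrier R" using insert.prems J by auto
  have Ft: "t \<in> F \<rightarrow> carrier R" "finsum R t F \<in> carrier R" using insert.prems by auto
  have "v \<oplus> t i \<otimes> \<one> \<in> ?J" using insert.prems(3) one_closed by blast
  moreover have "finsum R t F \<oplus> (v \<oplus> t i \<otimes> \<one>) = finsum R t (insert i F) \<oplus> v"
    using insert.hyps Ft ti v by (simp add: a_ac)
  then have "finsum R t F \<oplus> (v \<oplus> t i \<otimes> \<one>) = \<one>" using insert.prems by simp
  ultimately have "\<one> \<in> ?J"
    using insert.prems(2) sub by (intro insert.IH[OF J']) auto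
  then obtain q r where q: "q \<in> J" "r \<in> carrier R" "q \<oplus> t i \<otimes> r = \<one>" by auto
  have "t i \<otimes> r \<oplus> q = \<one>" using q J(1) ti by (metis a_comm m_closed subsetD)
  then have "comaximal (t i) J" unfolding comaximal_def using q by blast
  then have "comaximal (t i \<otimes> t i) J" using comaximal_mult[OF insert.prems(1) ti ti] by blast
  then obtain x j where x: "x \<in> carrier R" "j \<in> J" "t i \<otimes> t i \<otimes> x \<oplus> j = \<one>"
    unfolding comaximal_def by blast
  have "t i \<otimes> t i \<in> J" using insert.prems by auto
  then have "t i \<otimes> t i \<otimes> x \<oplus> j \<in> J" using J(3,4) x by blast
  then show ?case using x by simp
qed

section \<open>Partitions of unity and generators of P\<close>

context distributive_duo_ring
begin

text \<open>By right invariance, the right ideal I generated by S then satisfies I t_i \<subseteq> i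
  A: on the part of 1 weighted by t_i, the single generator i suffices. When b is added, each t_i is
  split by the element s_i that compares i with b: the parts t_i s_i are collected into the
  coefficient of b, the parts t_i (1 - s_i) stay with i.\<close>

lemma partition_of_unity:
  assumes "finite S" "S \<noteq> {}" "S \<subseteq> carrier R"
  shows "\<exists>t. (\<forall>i\<in>S. t i \<in> carrier R) \<and> finsum R t S = \<one> \<and> (\<forall>i\<in>S. \<forall>j\<in>S. i divides j \<otimes> t i)"
  using assms
proof (induction S rule: finite_ne_induct)
  case (singleton x)
  then show ?case by (intro exI[of _ "\<lambda>_. \<one>"]) (auto simp: finsum_insert[of "{}", simplified])
next
  case (insert b F)
  then have "F \<subseteq> carrier R" by simp
  from insert.IH[OF this] obtain t where t: "\<And>i. i \<in> F \<Longrightarrow> t i \<in> carrier R" "finsum R t F = \<one>"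
    "\<And>i j. i \<in> F \<Longrightarrow> j \<in> F \<Longrightarrow> i divides j \<otimes> t i" by blast
  have b: "b \<in> carrier R" and F: "\<And>i. i \<in> F \<Longrightarrow> i \<in> carrier R" using insert by auto
  have "\<forall>i\<in>F. \<exists>s. s \<in> carrier R \<and> b divides i \<otimes> s \<and> i divides b \<otimes> (\<one> \<ominus> s)"
    using dist F b by blast
  then obtain s where s: "\<And>i. i \<in> F \<Longrightarrow> s i \<in> carrier R" "\<And>i. i \<in> F \<Longrightarrow> b divides i \<otimes> s i"
    "\<And>i. i \<in> F \<Longrightarrow> i divides b \<otimes> (\<one> \<ominus> s i)" by metis
  define u where "u i = t i \<otimes> s i" for i
  define v where "v i = t i \<otimes> (\<one> \<ominus> s i)" for i
  have u: "u i \<in> carrier R" and v: "v i \<in> carrier R" if "i \<in> F" for i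
    using that t s by (auto simp: u_def v_def)
  define t' where "t' i = (if i = b then finsum R u F else v i)" for i
  have uF: "finsum R u F \<in> carrier R" and vF: "finsum R v F \<in> carrier R"
    using u v by (auto intro!: finsum_closed)
  have t'F: "t' i = v i" if "i \<in> F" for i using that insert(3) by (auto simp: t'_def)
  have "finsum R t' (insert b F) = t' b \<oplus> finsum R t' F"
    using insert(1,3) uF v by (intro finsum_insert) (auto simp: t'_def)
  also have "finsum R t' F = finsum R v F"
    using v t'F by (intro finsum_cong') auto
  also have "t' b \<oplus> finsum R v F = finsum R (\<lambda>i. u i \<oplus> v i) F"
    using u v by (subst finsum_addf) (auto simp: t'_def)
  also have "\<dots> = finsum R t F"
  proof (intro finsum_cong')
    fix i assume i: "i \<in> F"
    have "u i \<oplus> v i = t i \<otimes> (s i \<oplus> (\<one> \<ominus> s i))"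
      unfolding u_def v_def using t(1)[OF i] s(1)[OF i] by (simp add: r_distr)
    also have "s i \<oplus> (\<one> \<ominus> s i) = \<one>"
      using s(1)[OF i] by (simp add: minus_eq a_comm[of "s i"] a_assoc l_neg)
    finally show "u i \<oplus> v i = t i" using t(1)[OF i] by simp
  qed (use t in auto)
  finally have sum1: "finsum R t' (insert b F) = \<one>" using t by simp
  have bj: "b divides j \<otimes> u i" if "i \<in> F" "j \<in> carrier R" "i divides j \<otimes> t i" for i j
  proof -
    from that(3) obtain r where r: "r \<in> carrier R" "j \<otimes> t i = i \<otimes> r" by (elim dividesE)
    from duoE[OF s(1)[OF that(1)] r(1)] obtain r' where r': "r' \<in> carrier R" "r \<otimes> s i = s i \<otimes> r'" .
    have "j \<otimes> u i = i \<otimes> (r \<otimes> s i)"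
      unfolding u_def using r that t(1) s(1) F by (simp add: m_assoc[symmetric])
    also have "\<dots> = (i \<otimes> s i) \<otimes> r'" unfolding r' using r' s(1) F that by (simp add: m_assoc)
    finally show ?thesis using divides_mult_right[OF s(2)[OF that(1)] b r'(1)] by simp
  qed
  have "i divides j \<otimes> t' i" if ij: "i \<in> insert b F" "j \<in> insert b F" for i j
  proof (cases "i = b")
    case True
    show ?thesis
    proof (cases "j = b")
      case True
      have "b divides b \<otimes> finsum R u F" using uF by (rule dividesI) simp
      then show ?thesis using True \<open>i = b\<close> by (simp add: t'_def)
    next
      case False
      then have j: "j \<in> F" "j \<in> carrier R" using ij F by auto
      have "j \<otimes> finsum R u F = finsum R (\<lambda>i. j \<otimes> u i) F"
        using j u insert(1) by (intro finsum_rdistr) auto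
      moreover have "b divides finsum R (\<lambda>i. j \<otimes> u i) F"
        using bj j t(3) b u insert(1) by (intro divides_finsum) auto
      ultimately show ?thesis using True by (simp add: t'_def)
    qed
  next
    case False
    then have i: "i \<in> F" "i \<in> carrier R" using ij F by auto
    show ?thesis
    proof (cases "j = b")
      case True
      \<comment> \<open>Right invariance brings 1 - s_i in front of t_i, next to b, where b (1 -
        s_i) is a multiple of i.\<close>
      from duoE[of "\<one> \<ominus> s i" "t i"] obtain c where
        c: "c \<in> carrier R" "t i \<otimes> (\<one> \<ominus> s i) = (\<one> \<ominus> s i) \<otimes> c" using t(1) s(1) i by blast
      have "b \<otimes> v i = b \<otimes> (\<one> \<ominus> s i) \<otimes> c"
        unfolding v_def c(2) using b s(1)[OF i(1)] c(1) by (simp add: m_assoc)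
      then show ?thesis
        using divides_mult_right[OF s(3)[OF i(1)] i(2) c(1)] True t'F[OF i(1)] by simp
    next
      case False
      then have j: "j \<in> F" "j \<in> carrier R" using ij F by auto
      have "j \<otimes> v i = j \<otimes> t i \<otimes> (\<one> \<ominus> s i)"
        unfolding v_def using j t(1) s(1) i by (simp add: m_assoc)
      then show ?thesis
        using divides_mult_right[OF t(3)[OF i(1) j(1)] i(2), of "\<one> \<ominus> s i"] s(1) i(1) t'F[OF i(1)]
        by simp
    qed
  qed
  moreover have "\<forall>i\<in>insert b F. t' i \<in> carrier R" using uF v by (auto simp: t'_def)
  ultimately show ?case using sum1 by (intro exI[of _ t']) auto
qed

text \<open>Since a t is a multiple of q it lies in P, hence t does, and 1 - t is a unit; so q
  itself is a multiple of a. Primeness puts the cofactor into P.\<close>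

lemma divides_nilpotent:
  assumes prime: "\<And>a b. a \<in> carrier R \<Longrightarrow> b \<in> carrier R \<Longrightarrow> a \<otimes> b \<in> nilpotents R \<Longrightarrow>
      a \<in> nilpotents R \<or> b \<in> nilpotents R"
    and a: "a \<in> carrier R" "a \<notin> nilpotents R" and q: "q \<in> nilpotents R"
  shows "\<exists>x\<in>nilpotents R. q = a \<otimes> x"
proof -
  let ?N = "nilpotents R"
  note N = right_idealD[OF right_ideal_nilpotents]
  have qc: "q \<in> carrier R" using q nilpotents_closed by auto
  from dist[OF a(1) qc] obtain t where t: "t \<in> carrier R" "q divides a \<otimes> t" "a divides q \<otimes> (\<one> \<ominus> t)"
    by blast
  have "a \<otimes> t \<in> ?N" using right_ideal_divides[OF right_ideal_nilpotents q t(2)] .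
  then have "t \<in> ?N" using prime a t by blast
  then have u: "\<one> \<ominus> t \<in> Units R" by (rule one_minus_nilpotent_unit)
  have "a divides q \<otimes> (\<one> \<ominus> t) \<otimes> inv (\<one> \<ominus> t)"
    using t(3) a(1) Units_inv_closed[OF u] by (rule divides_mult_right)
  also have "q \<otimes> (\<one> \<ominus> t) \<otimes> inv (\<one> \<ominus> t) = q"
    using u qc Units_inv_closed[OF u] Units_closed[OF u] by (simp add: m_assoc Units_r_inv)
  finally obtain x where x: "x \<in> carrier R" "q = a \<otimes> x" by (elim dividesE)
  then have "x \<in> ?N" using prime[of a x] a q by blast
  then show ?thesis using x by blast
qed

text \<open>A single pair p = p_i, s = t_i carries everything, chosen such that c = p x is central
  and c s \<noteq> 0. For a outside P, \<open>key\<close> gives c s = c a w, and as the annihilator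
  of c lies in P \<subseteq> a A, dropping c costs only a multiple of a: s lies in a A. Taking a =
  s^2 makes s a unit; then every a outside P is a unit, and P s \<subseteq> p A becomes P = p
  A.\<close>

lemma local_if_nilpotents_prime:
  assumes prime: "\<And>a b. a \<in> carrier R \<Longrightarrow> b \<in> carrier R \<Longrightarrow> a \<otimes> b \<in> nilpotents R \<Longrightarrow>
      a \<in> nilpotents R \<or> b \<in> nilpotents R"
    and ce: "centrally_essential R"
    and fg: "fin_gen_right_ideal R (nilpotents R)"
    and nz: "nilpotents R \<noteq> {\<zero>}"
  shows "(\<forall>a\<in>carrier R - nilpotents R. a \<in> Units R) \<and>
    (\<exists>p\<in>nilpotents R. \<forall>q\<in>nilpotents R. p divides q)"
proof -
  let ?N = "nilpotents R"
  note N = right_idealD[OF right_ideal_nilpotents]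
  note Nc = nilpotents_closed
  from fg obtain S where S: "finite S" "S \<subseteq> carrier R" "?N = \<Inter>{J. right_ideal J R \<and> S \<subseteq> J}"
    unfolding fin_gen_right_ideal_def by blast
  have SN: "S \<subseteq> ?N" unfolding S(3) by blast
  have gen: "q \<in> J" if "right_ideal J R" "S \<subseteq> J" "q \<in> ?N" for J q
    using that unfolding S(3) by blast
  have "right_ideal {\<zero>} R" by (rule right_idealI) auto
  then have "\<not> S \<subseteq> {\<zero>}" using gen N(2) nz by blast
  then obtain k where k: "k \<in> S" "k \<noteq> \<zero>" by auto
  then have "S \<noteq> {}" by auto
  from partition_of_unity[OF S(1) this S(2)] obtain t where
    t: "\<And>i. i \<in> S \<Longrightarrow> t i \<in> carrier R" "finsum R t S = \<one>"
    and tS: "\<And>i j. i \<in> S \<Longrightarrow> j \<in> S \<Longrightarrow> i divides j \<otimes> t i" by blast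
  have tN: "i divides q \<otimes> t i" if i: "i \<in> S" and q: "q \<in> ?N" for i q
  proof -
    have ic: "i \<in> carrier R" "t i \<in> carrier R" using i S t by auto
    have "right_ideal {q \<in> carrier R. i divides q \<otimes> t i} R"
    proof (rule right_idealI)
      fix a r assume a: "a \<in> {q \<in> carrier R. i divides q \<otimes> t i}" and r: "r \<in> carrier R"
      from duoE[OF ic(2) r] obtain r' where r': "r' \<in> carrier R" "r \<otimes> t i = t i \<otimes> r'" .
      have "a \<otimes> r \<otimes> t i = a \<otimes> t i \<otimes> r'" using a r r' ic by (simp add: m_assoc)
      moreover have "i divides a \<otimes> t i" using a by simp
      then have "i divides a \<otimes> t i \<otimes> r'" using ic(1) r'(1) by (rule divides_mult_right)
      ultimately show "a \<otimes> r \<in> {q \<in> carrier R. i divides q \<otimes> t i}" using a r by simp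
    qed (use ic in \<open>auto simp: l_distr intro: divides_add\<close>)
    then show ?thesis using gen[of "{q \<in> carrier R. i divides q \<otimes> t i}" q] q tS i S(2) by blast
  qed
  \<comment> \<open>All generators are made central at once, because the index i is fixed only later
    and depends on x.\<close>
  from common_central_multiplier[OF ce S(2) k S(1) subset_refl] obtain x j0 where
    x: "x \<in> ring_center R" "\<And>j. j \<in> S \<Longrightarrow> j \<otimes> x \<in> ring_center R" and j0: "j0 \<in> S" "j0 \<otimes> x \<noteq> \<zero>"
    by blast
  note xc = ring_center_closed[OF x(1)]
  define y where "y = j0 \<otimes> x"
  have y: "y \<in> ring_center R" "y \<noteq> \<zero>" "y \<in> carrier R"
    using x(2)[OF j0(1)] j0(2) ring_center_closed by (auto simp: y_def)
  \<comment> \<open>The right ideal \<open>P + ann y\<close>; it is proper because \<open>1 + P\<close> consists of units.\<close>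
  let ?J = "{r \<in> carrier R. \<exists>q\<in>?N. y \<otimes> r = y \<otimes> q}"
  have J: "right_ideal ?J R"
  proof (rule right_idealI)
    show "\<zero> \<in> ?J" using N(2) by auto
    show "a \<oplus> b \<in> ?J" if ab: "a \<in> ?J" "b \<in> ?J" for a b
    proof -
      from ab obtain p q where "p \<in> ?N" "q \<in> ?N" "y \<otimes> a = y \<otimes> p" "y \<otimes> b = y \<otimes> q" by auto
      then have "y \<otimes> (a \<oplus> b) = y \<otimes> (p \<oplus> q)" "p \<oplus> q \<in> ?N" using ab y(3) Nc N(3) by (auto simp: r_distr)
      then show ?thesis using ab by blast
    qed
    show "a \<otimes> r \<in> ?J" if ar: "a \<in> ?J" "r \<in> carrier R" for a r
    proof -
      from ar obtain q where q: "q \<in> ?N" "y \<otimes> a = y \<otimes> q" by auto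
      then have "y \<otimes> (a \<otimes> r) = y \<otimes> (q \<otimes> r)" "q \<otimes> r \<in> ?N"
        using ar y(3) Nc[OF q(1)] N(4) by (auto simp: m_assoc[symmetric])
      then show ?thesis using ar by blast
    qed
  qed auto
  have "\<one> \<notin> ?J"
  proof
    assume "\<one> \<in> ?J"
    then obtain q where q: "q \<in> ?N" "y = y \<otimes> q" using y(3) by auto
    note u = one_minus_nilpotent_unit[OF q(1)]
    have "y \<otimes> (\<one> \<ominus> q) = y \<ominus> y \<otimes> q" using y(3) Nc[OF q(1)] by (simp add: r_distr r_minus minus_eq)
    also have "\<dots> = y \<ominus> y" using q(2) by simp
    finally have "y \<otimes> (\<one> \<ominus> q) = \<zero>" using y(3) by (simp add: minus_eq r_neg)
    then have "y \<otimes> (\<one> \<ominus> q) \<otimes> inv (\<one> \<ominus> q) = \<zero>" using u by simp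
    then show False using y u by (simp add: m_assoc Units_closed Units_r_inv)
  qed
  moreover have "finsum R t S \<oplus> \<zero> = \<one>" using t by simp
  ultimately obtain i where i: "i \<in> S" "t i \<otimes> t i \<notin> ?J"
    using one_mem_if_squares_mem[OF S(1) J, of t \<zero>] t N(2) right_idealD(2)[OF J] by blast
  define p where "p = i"
  define s where "s = t i"
  have p: "p \<in> ?N" "p \<in> carrier R" using i SN Nc by (auto simp: p_def)
  have s: "s \<in> carrier R" using t i by (simp add: s_def)
  have sJ: "s \<otimes> s \<notin> ?J" using i by (simp add: s_def)
  have pN: "\<And>q. q \<in> ?N \<Longrightarrow> p divides q \<otimes> s" using tN i by (simp add: p_def s_def)
  have sN: "s \<notin> ?N"
    using sJ N(4)[of s s] s by blast
  define c where "c = p \<otimes> x"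
  have c: "c \<in> ring_center R" "c \<in> carrier R"
    using x(2)[OF i(1)] ring_center_closed by (auto simp: c_def p_def)
  \<comment> \<open>Suppose c s = 0. One factor s turns j0 s into p r, so y s = c r; a second one
    gives y s^2 = c r s = c s r' = 0, contradicting the choice of s^2 outside P + ann y.\<close>
  have cs: "c \<otimes> s \<noteq> \<zero>"
  proof
    assume 0: "c \<otimes> s = \<zero>"
    have j0N: "j0 \<in> ?N" "j0 \<in> carrier R" using j0 SN Nc by auto
    from pN[OF j0N(1)] obtain r where r: "r \<in> carrier R" "j0 \<otimes> s = p \<otimes> r" by (elim dividesE)
    from duoE[OF s r(1)] obtain r' where r': "r' \<in> carrier R" "r \<otimes> s = s \<otimes> r'" .
    have "y \<otimes> s = j0 \<otimes> s \<otimes> x"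
      using ring_centerD[OF x(1) s] j0N s xc by (simp add: y_def m_assoc)
    also have "\<dots> = p \<otimes> x \<otimes> r"
      unfolding r(2) using ring_centerD[OF x(1) r(1)] p r(1) xc by (simp add: m_assoc)
    finally have "y \<otimes> (s \<otimes> s) = c \<otimes> (r \<otimes> s)"
      using y(3) s c(2) r(1) by (simp add: c_def[symmetric] m_assoc[symmetric])
    also have "\<dots> = c \<otimes> s \<otimes> r'" unfolding r'(2) using c(2) s r'(1) by (simp add: m_assoc)
    also have "\<dots> = y \<otimes> \<zero>" using 0 r'(1) y(3) by simp
    finally show False using sJ N(2) s by blast
  qed
  \<comment> \<open>Write p = a q with q in P; then q s = p w brings p back, and centrality of x and
    of c = p x lets c pass in front of a.\<close>
  have key: "\<exists>w\<in>carrier R. c \<otimes> s = c \<otimes> (a \<otimes> w)" if a: "a \<in> carrier R" "a \<notin> ?N" for a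
  proof -
    from divides_nilpotent[OF prime a p(1)] obtain q where q: "q \<in> ?N" "p = a \<otimes> q" by blast
    from pN[OF q(1)] obtain w where w: "w \<in> carrier R" "q \<otimes> s = p \<otimes> w" by (elim dividesE)
    have qc: "q \<in> carrier R" using q Nc by auto
    have "c \<otimes> s = p \<otimes> s \<otimes> x"
      using ring_centerD[OF x(1) s] p(2) s xc by (simp add: c_def m_assoc)
    also have "p \<otimes> s = a \<otimes> (q \<otimes> s)" unfolding q(2) using a(1) qc s by (simp add: m_assoc)
    also have "\<dots> \<otimes> x = a \<otimes> (p \<otimes> x) \<otimes> w"
      unfolding w(2) using ring_centerD[OF x(1) w(1)] a(1) p(2) w(1) xc by (simp add: m_assoc)
    also have "\<dots> = c \<otimes> (a \<otimes> w)"
      unfolding c_def[symmetric] using ring_centerD[OF c(1) a(1)] a(1) c(2) w(1)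
      by (simp add: m_assoc[symmetric])
    finally show ?thesis using w(1) by blast
  qed
  \<comment> \<open>For d outside P with c d = 0, \<open>key\<close> would give c s = c d w =
    0.\<close>
  have annN: "d \<in> ?N" if d: "d \<in> carrier R" "c \<otimes> d = \<zero>" for d
  proof (rule ccontr)
    assume "d \<notin> ?N"
    from key[OF d(1) this] obtain w where "w \<in> carrier R" "c \<otimes> s = c \<otimes> d \<otimes> w"
      using c(2) d(1) by (auto simp: m_assoc)
    then show False using cs d(2) by simp
  qed
  have div_s: "a divides s" if a: "a \<in> carrier R" "a \<notin> ?N" for a
  proof -
    from key[OF a] obtain w where w: "w \<in> carrier R" "c \<otimes> s = c \<otimes> (a \<otimes> w)" by blast
    have "c \<otimes> (s \<ominus> a \<otimes> w) = c \<otimes> s \<ominus> c \<otimes> (a \<otimes> w)"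
      using c(2) s a(1) w(1) by (simp add: r_distr r_minus minus_eq)
    also have "\<dots> = \<zero>" unfolding w(2) using c(2) a(1) w(1) by (simp add: minus_eq r_neg)
    finally have "s \<ominus> a \<otimes> w \<in> ?N" using annN s a(1) w(1) by simp
    from divides_nilpotent[OF prime a this] have "a divides (s \<ominus> a \<otimes> w)"
      using Nc by (auto intro: dividesI)
    moreover have "a divides a \<otimes> w" using w(1) by (rule dividesI) simp
    ultimately have "a divides ((s \<ominus> a \<otimes> w) \<oplus> a \<otimes> w)" using a(1) by (intro divides_add)
    also have "(s \<ominus> a \<otimes> w) \<oplus> a \<otimes> w = s" using s a(1) w(1) by (simp add: minus_eq a_assoc l_neg)
    finally show ?thesis .
  qed
  have "s \<otimes> s \<notin> ?N" using prime[OF s s] sN by blast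
  from div_s[OF _ this] s obtain r where r: "r \<in> carrier R" "s = s \<otimes> s \<otimes> r" by (auto elim: dividesE)
  have "s \<otimes> (\<one> \<ominus> s \<otimes> r) = s \<ominus> s \<otimes> s \<otimes> r" using s r(1) by (simp add: r_distr r_minus minus_eq m_assoc)
  also have "\<dots> = s \<ominus> s" using r(2) by simp
  also have "\<dots> = \<zero>" using s by (simp add: minus_eq r_neg)
  finally have "s \<otimes> (\<one> \<ominus> s \<otimes> r) \<in> ?N" using N(2) by simp
  then have "\<one> \<ominus> s \<otimes> r \<in> ?N" using prime[OF s, of "\<one> \<ominus> s \<otimes> r"] sN s r(1) by blast
  from one_minus_nilpotent_unit[OF this] have "s \<otimes> r \<in> Units R"
    using s r(1) by (simp add: one_minus_minus)
  then have "s \<otimes> r divides \<one>" by (simp add: Units_iff_divides_one)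
  then have s1: "s divides \<one>" using s r(1) by (elim dividesE) (metis dividesI m_assoc m_closed)
  then have sU: "s \<in> Units R" using s by (simp add: Units_iff_divides_one)
  have "a \<in> Units R" if a: "a \<in> carrier R" "a \<notin> ?N" for a
    unfolding Units_iff_divides_one using a(1) divides_trans[OF div_s[OF a] s1 a(1)] by blast
  moreover have "p divides q" if q: "q \<in> ?N" for q
  proof -
    have "p divides q \<otimes> s \<otimes> inv s" using pN[OF q] p(2) Units_inv_closed[OF sU] by (rule divides_mult_right)
    also have "q \<otimes> s \<otimes> inv s = q"
      using sU Nc[OF q] s Units_inv_closed[OF sU] by (simp add: m_assoc Units_r_inv)
    finally show ?thesis .
  qed
  ultimately show ?thesis using p(1) by blast
qed

end

text \<open>A member of the family is determined by the exponents k \<le> n with q k in it. These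
  sets of exponents are closed upwards in {0..n}, hence form a finite chain. The family is left
  abstract so that it can consist of right ideals or of left ideals.\<close>

lemma chain_condition_from_powers:
  fixes q :: "nat \<Rightarrow> 'a" and \<I> :: "'a set set"
  assumes rep: "\<And>I x. I \<in> \<I> \<Longrightarrow> x \<in> I \<Longrightarrow> \<exists>k\<le>n. q k \<in> I \<and> (\<forall>J\<in>\<I>. q k \<in> J \<longrightarrow> x \<in> J)"
    and up: "\<And>I k. I \<in> \<I> \<Longrightarrow> q k \<in> I \<Longrightarrow> q (Suc k) \<in> I"
  shows "\<And>I J. I \<in> \<I> \<Longrightarrow> J \<in> \<I> \<Longrightarrow> I \<subseteq> J \<or> J \<subseteq> I"
    and "\<not> (\<exists>I :: nat \<Rightarrow> 'a set. \<forall>m. I m \<in> \<I> \<and> I (Suc m) \<subset> I m)"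
proof -
  define e where "e I = {k. k \<le> n \<and> q k \<in> I}" for I
  have sub: "I \<subseteq> J" if "I \<in> \<I>" "J \<in> \<I>" "e I \<subseteq> e J" for I J
  proof
    fix x assume "x \<in> I"
    from rep[OF that(1) this] obtain k where "k \<le> n" "q k \<in> I" "\<forall>J\<in>\<I>. q k \<in> J \<longrightarrow> x \<in> J" by blast
    then show "x \<in> J" using that by (auto simp: e_def)
  qed
  have up': "q l \<in> I" if "I \<in> \<I>" "q k \<in> I" "k \<le> l" for I k l
    using that(3,2) by (induction l rule: dec_induct) (auto intro: up[OF that(1)])
  {
    fix I J assume "I \<in> \<I>" "J \<in> \<I>"
    then have "e I \<subseteq> e J \<or> e J \<subseteq> e I" using up' unfolding e_def by (auto; meson nle_le)
    then show "I \<subseteq> J \<or> J \<subseteq> I" using sub \<open>I \<in> \<I>\<close> \<open>J \<in> \<I>\<close> by blast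
  }
  show "\<not> (\<exists>I :: nat \<Rightarrow> 'a set. \<forall>m. I m \<in> \<I> \<and> I (Suc m) \<subset> I m)"
  proof
    assume "\<exists>I :: nat \<Rightarrow> 'a set. \<forall>m. I m \<in> \<I> \<and> I (Suc m) \<subset> I m"
    then obtain I :: "nat \<Rightarrow> 'a set" where I: "\<And>m. I m \<in> \<I>" "\<And>m. I (Suc m) \<subset> I m" by blast
    have "e (I (Suc m)) \<subset> e (I m)" for m
    proof -
      have "e (I (Suc m)) \<subseteq> e (I m)" using I(2)[of m] by (auto simp: e_def)
      moreover have "\<not> e (I m) \<subseteq> e (I (Suc m))" using sub[OF I(1) I(1)] I(2)[of m] by blast
      ultimately show ?thesis by blast
    qed
    moreover have "finite (e J)" for J by (simp add: e_def)
    ultimately have "card (e (I (Suc m))) < card (e (I m))" for m by (simp add: psubset_card_mono)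
    then have "card (e (I m)) + m \<le> card (e (I 0))" for m
    proof (induction m)
      case (Suc m)
      from Suc.prems[of m] Suc.IH[OF Suc.prems] show ?case by simp
    qed simp
    from this[of "Suc (card (e (I 0)))"] show False by simp
  qed
qed

text \<open>Every nonzero element is p^k u with u a unit; the work lies in p A \<subseteq> A p. Let
  c = p^k u be central with k = l + 1. Then p^k b = b' p^k, and moving b' across p^l only gives p^l
  (p b - a p) = 0, which places p b - a p in p^2 A. Iteration replaces p^2 by any higher power of p,
  and p is nilpotent.\<close>

lemma (in duo_ring) artinian_uniserial_if_local:
  assumes local: "\<And>a. a \<in> carrier R \<Longrightarrow> a \<notin> nilpotents R \<Longrightarrow> a \<in> Units R"
    and p: "p \<in> nilpotents R" "p \<noteq> \<zero>" and pN: "\<And>q. q \<in> nilpotents R \<Longrightarrow> p divides q"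
    and ce: "centrally_essential R"
  shows "artinian R" "uniserial R"
proof -
  let ?N = "nilpotents R"
  note N = right_idealD[OF right_ideal_nilpotents]
  have pc: "p \<in> carrier R" using p nilpotents_closed by auto
  note pw [simp] = nat_pow_closed[OF pc]
  have one_N: "\<one> \<notin> ?N" using p(2) pc by (auto simp: nilpotents_def) (metis l_null l_one)
  have unit_N: "u \<notin> ?N" if "u \<in> Units R" for u
    using N(4)[of u "inv u"] that one_N by auto
  define n :: nat where "n = (LEAST n. p [^] n = \<zero>)"
  obtain m :: nat where "p [^] m = \<zero>" using p(1) by (auto simp: nilpotents_def)
  then have pn: "p [^] n = \<zero>" unfolding n_def by (rule LeastI)
  have n_le: "n \<le> k" if "p [^] k = \<zero>" for k :: nat unfolding n_def using that by (rule Least_le)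
  have pow_add: "p [^] (j + k) = p [^] j \<otimes> p [^] k" for j k :: nat
    using nat_pow_mult[OF pc, of j k] by simp
  \<comment> \<open>The largest k for which p^k divides a is taken; a non-unit cofactor would lie in
    P = p A and raise it.\<close>
  have rep: "\<exists>k::nat. \<exists>u\<in>Units R. a = p [^] k \<otimes> u" if a: "a \<in> carrier R" "a \<noteq> \<zero>" for a
  proof -
    define K where "K = {k::nat. p [^] k divides a}"
    have KI: "j \<in> K" if "p [^] j divides a" for j using that by (simp add: K_def)
    have KD: "p [^] j divides a" if "j \<in> K" for j using that by (simp add: K_def)
    have "k < n" if "k \<in> K" for k
    proof (rule ccontr)
      assume "\<not> k < n"
      then have "p [^] k = p [^] n \<otimes> p [^] (k - n)" using pow_add[of n "k - n"] by simp
      then have "p [^] k = \<zero>" using pn by simp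
      then have "a = \<zero>" using KD[OF that] by (auto elim: dividesE)
      with a show False by simp
    qed
    then have finK: "finite K" by (meson bounded_nat_set_is_finite)
    have "0 \<in> K" using a by (auto simp: K_def intro!: dividesI[of a])
    then have "Max K \<in> K" using finK by (auto intro: Max_in)
    then obtain u where u: "u \<in> carrier R" "a = p [^] Max K \<otimes> u" using KD by (meson dividesE)
    have "u \<in> Units R"
    proof (rule ccontr)
      assume "u \<notin> Units R"
      then have "u \<in> ?N" using local u by blast
      from pN[OF this] obtain v where v: "v \<in> carrier R" "u = p \<otimes> v" by (elim dividesE)
      have "p [^] Max K \<otimes> u = p [^] Suc (Max K) \<otimes> v"
        unfolding v(2) using v(1) pc by (simp add: m_assoc)
      with u(2) have "a = p [^] Suc (Max K) \<otimes> v" by (rule trans)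
      then have "p [^] Suc (Max K) divides a" by (rule dividesI[OF v(1)])
      then have "Suc (Max K) \<in> K" by (rule KI)
      then show False using Max_ge[OF finK, of "Suc (Max K)"] by simp
    qed
    then show ?thesis using u by blast
  qed
  have cancel: "z \<in> ?N" if "p [^] k \<otimes> z = \<zero>" "p [^] k \<noteq> \<zero>" "z \<in> carrier R" for k :: nat and z
  proof (rule ccontr)
    assume "z \<notin> ?N"
    then have z: "z \<in> Units R" using local that by blast
    have "p [^] k = p [^] k \<otimes> z \<otimes> inv z" using z that(3) by (simp add: m_assoc Units_r_inv)
    then show False using that z by simp
  qed
  from central_multiple[OF ce pc p(2)] obtain x where x: "x \<in> ring_center R" "p \<otimes> x \<in> ring_center R" "p \<otimes> x \<noteq> \<zero>"
    by blast
  have xc: "x \<in> carrier R" using x(1) by (rule ring_center_closed)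
  define c where "c = p \<otimes> x"
  have c: "c \<in> ring_center R" "c \<in> carrier R" "c \<noteq> \<zero>" "c \<in> ?N"
    using x pc xc N(4)[OF p(1) xc] by (auto simp: c_def)
  from rep[OF c(2,3)] obtain k u where u: "u \<in> Units R" and cu: "c = p [^] (k::nat) \<otimes> u" by blast
  have uc: "u \<in> carrier R" "inv u \<in> carrier R" using u by auto
  have "k \<noteq> 0" using cu c(4) unit_N[OF u] uc by (auto intro: ccontr)
  then obtain l where k: "k = Suc l" using not0_implies_Suc by blast
  have kn: "k < n"
  proof (rule ccontr)
    assume "\<not> k < n"
    then have "p [^] k = \<zero>" using pow_add[of n "k - n"] pn by simp
    then show False using cu c(3) uc by simp
  qed
  \<comment> \<open>Here n is the index of nilpotency of p, and l + 1 = k < n because c \<noteq> 0.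
    An element p^j v killed by p^l has l + j \<ge> n, hence j \<ge> 2.\<close>
  have sq: "p \<otimes> p divides z" if z: "z \<in> carrier R" "p [^] l \<otimes> z = \<zero>" for z
  proof (cases "z = \<zero>")
    case False
    from rep[OF z(1) False] obtain j v where v: "v \<in> Units R" and zv: "z = p [^] (j::nat) \<otimes> v" by blast
    have vc: "v \<in> carrier R" using v by auto
    have "p [^] (l + j) \<otimes> v = \<zero>" using z(2) vc unfolding zv pow_add by (simp add: m_assoc)
    then have "p [^] (l + j) = \<zero>" using cancel[of "l + j" v] unit_N[OF v] vc by blast
    then have "n \<le> l + j" by (rule n_le)
    then have "2 \<le> j" using kn k by linarith
    then obtain i where j: "j = 2 + i" using le_Suc_ex by blast
    have "p [^] j = p [^] (2::nat) \<otimes> p [^] i" unfolding j by (rule pow_add)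
    also have "p [^] (2::nat) = p \<otimes> p" using pc by (simp add: numeral_2_eq_2)
    finally have "z = (p \<otimes> p) \<otimes> (p [^] i \<otimes> v)" unfolding zv using pc vc by (simp add: m_assoc)
    then show ?thesis using vc by (intro dividesI[of "p [^] i \<otimes> v"]) auto
  qed (use pc in auto)
  \<comment> \<open>Since \<open>c = p\<^sup>k u\<close> is central, conjugating by \<open>u\<close> moves coefficients across \<open>p\<^sup>k\<close>.\<close>
  have L1: "\<exists>a\<in>carrier R. \<exists>d\<in>carrier R. p \<otimes> b = a \<otimes> p \<oplus> p \<otimes> p \<otimes> d" if b: "b \<in> carrier R" for b
  proof -
    define b' where "b' = inv u \<otimes> b \<otimes> u"
    have b': "b' \<in> carrier R" using b uc by (simp add: b'_def)
    have "b = (u \<otimes> inv u) \<otimes> b \<otimes> (u \<otimes> inv u)" using u b by (simp add: Units_r_inv)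
    also have "\<dots> = u \<otimes> b' \<otimes> inv u" unfolding b'_def using uc b by (simp add: m_assoc)
    finally have "p [^] k \<otimes> b = p [^] k \<otimes> (u \<otimes> b' \<otimes> inv u)" by (rule arg_cong)
    also have "\<dots> = c \<otimes> b' \<otimes> inv u" unfolding cu using uc b' by (simp add: m_assoc)
    also have "c \<otimes> b' = b' \<otimes> c" using ring_centerD[OF c(1) b'] .
    also have "b' \<otimes> c \<otimes> inv u = b' \<otimes> p [^] k"
      unfolding cu using uc b' u by (simp add: m_assoc Units_r_inv)
    finally have 1: "p [^] k \<otimes> b = b' \<otimes> p [^] k" .
    from duoE[OF pw[of l] b'] obtain a where a: "a \<in> carrier R" "b' \<otimes> p [^] l = p [^] l \<otimes> a" .
    have "p [^] l \<otimes> (p \<otimes> b) = p [^] k \<otimes> b" unfolding k using pc b by (simp add: m_assoc)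
    also have "\<dots> = (b' \<otimes> p [^] l) \<otimes> p" unfolding 1 unfolding k using pc b' by (simp add: m_assoc)
    also have "\<dots> = p [^] l \<otimes> (a \<otimes> p)" unfolding a(2) using pc a(1) by (simp add: m_assoc)
    finally have "p [^] l \<otimes> (p \<otimes> b \<ominus> a \<otimes> p) = \<zero>"
      using pc a(1) b by (simp add: r_distr r_minus minus_eq r_neg)
    from sq[OF _ this] obtain d where d: "d \<in> carrier R" "p \<otimes> b \<ominus> a \<otimes> p = p \<otimes> p \<otimes> d"
      using pc a(1) b by (auto elim: dividesE)
    have "p \<otimes> b = a \<otimes> p \<oplus> (p \<otimes> b \<ominus> a \<otimes> p)" using pc a(1) b
      by (simp add: minus_eq a_comm[of "p \<otimes> b"] a_assoc[symmetric] r_neg)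
    then show ?thesis using a(1) d by auto
  qed
  \<comment> \<open>The error is rewritten as p^m (p d) and \<open>L1\<close> is applied to d: one
    part gets p as its last factor, and the new error carries one more power of p.\<close>
  have L3: "\<exists>a\<in>carrier R. \<exists>d\<in>carrier R. p \<otimes> b = a \<otimes> p \<oplus> p [^] Suc m \<otimes> d" if b: "b \<in> carrier R" for b m
  proof (induction m)
    case 0
    show ?case using pc b by (intro bexI[of _ \<zero>] bexI[of _ b]) auto
  next
    case (Suc m)
    then obtain a d where a: "a \<in> carrier R" and d: "d \<in> carrier R" and
      eq: "p \<otimes> b = a \<otimes> p \<oplus> p [^] Suc m \<otimes> d" by blast
    from L1[OF d] obtain a' d' where a': "a' \<in> carrier R" and d': "d' \<in> carrier R"
      and eq': "p \<otimes> d = a' \<otimes> p \<oplus> p \<otimes> p \<otimes> d'" by blast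
    have "p [^] Suc m \<otimes> d = p [^] m \<otimes> (p \<otimes> d)" using pc d by (simp add: m_assoc)
    also have "\<dots> = (p [^] m \<otimes> a') \<otimes> p \<oplus> p [^] Suc (Suc m) \<otimes> d'"
      unfolding eq' using pc a' d' by (simp add: r_distr m_assoc)
    finally have "p \<otimes> b = (a \<oplus> p [^] m \<otimes> a') \<otimes> p \<oplus> p [^] Suc (Suc m) \<otimes> d'"
      unfolding eq using pc a a' d' pw[of "Suc (Suc m)"] by (simp add: l_distr a_assoc del: nat_pow_Suc)
    moreover have "a \<oplus> p [^] m \<otimes> a' \<in> carrier R" using a a' by simp
    ultimately show ?case using d' by blast
  qed
  have L4: "\<exists>a\<in>carrier R. p \<otimes> b = a \<otimes> p" if b: "b \<in> carrier R" for b
  proof -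
    from L3[OF b, of n] obtain a d where "a \<in> carrier R" "d \<in> carrier R"
      "p \<otimes> b = a \<otimes> p \<oplus> p [^] Suc n \<otimes> d" by blast
    then show ?thesis using pn pc by auto
  qed
  have L5: "\<exists>a\<in>carrier R. p [^] k \<otimes> b = a \<otimes> p [^] k" if b: "b \<in> carrier R" for b and k :: nat
    using b
  proof (induction k arbitrary: b)
    case 0
    then show ?case by auto
  next
    case (Suc k)
    from L4[OF Suc.prems] obtain a where a: "a \<in> carrier R" "p \<otimes> b = a \<otimes> p" by blast
    from Suc.IH[OF a(1)] obtain a' where a': "a' \<in> carrier R" "p [^] k \<otimes> a = a' \<otimes> p [^] k" by blast
    have "p [^] Suc k \<otimes> b = p [^] k \<otimes> (p \<otimes> b)" using pc Suc.prems by (simp add: m_assoc)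
    also have "\<dots> = (p [^] k \<otimes> a) \<otimes> p" unfolding a(2) using pc a(1) by (simp add: m_assoc)
    also have "\<dots> = a' \<otimes> p [^] Suc k" unfolding a'(2) using pc a'(1) by (simp add: m_assoc)
    finally show ?case using a'(1) by blast
  qed
  \<comment> \<open>The exponent n represents a = 0, so that zero fits into the same
    pattern.\<close>
  have lrep: "\<exists>k::nat. k \<le> n \<and> (\<exists>u\<in>Units R. \<exists>v\<in>Units R. a = p [^] k \<otimes> u \<and> a = v \<otimes> p [^] k)"
    if a: "a \<in> carrier R" for a
  proof (cases "a = \<zero>")
    case True
    then have "a = p [^] n \<otimes> \<one>" "a = \<one> \<otimes> p [^] n" using pn by simp_all
    then show ?thesis using Units_one_closed by blast
  next
    case False
    from rep[OF a False] obtain k u where u: "u \<in> Units R" and au: "a = p [^] (k::nat) \<otimes> u" by blast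
    have uc: "u \<in> carrier R" using u by auto
    from L5[OF uc] obtain v where v: "v \<in> carrier R" "p [^] k \<otimes> u = v \<otimes> p [^] k" by blast
    \<comment> \<open>If v were p w, then p^k u = p^k p w', and \<open>cancel\<close> would give u -
      p w' in P, hence u in P.\<close>
    have "v \<notin> ?N"
    proof
      assume "v \<in> ?N"
      from pN[OF this] obtain w where w: "w \<in> carrier R" "v = p \<otimes> w" by (elim dividesE)
      from duoE[OF pw w(1)] obtain w' where w': "w' \<in> carrier R" "w \<otimes> p [^] k = p [^] k \<otimes> w'" .
      have "p \<otimes> p [^] k = p [^] k \<otimes> p" using nat_pow_Suc2[OF pc] nat_pow_Suc by metis
      then have "p [^] k \<otimes> u = p [^] k \<otimes> (p \<otimes> w')"
        unfolding v(2) w(2) using pc w(1) w' by (simp add: m_assoc) (simp add: m_assoc[symmetric])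
      then have "p [^] k \<otimes> (u \<ominus> p \<otimes> w') = \<zero>"
        using pc uc w'(1) by (simp add: r_distr r_minus minus_eq r_neg)
      moreover have "p [^] k \<noteq> \<zero>" using au False uc by auto
      ultimately have "u \<ominus> p \<otimes> w' \<in> ?N" using cancel pc uc w'(1) by simp
      then have "(u \<ominus> p \<otimes> w') \<oplus> p \<otimes> w' \<in> ?N" using N(3,4) p(1) w'(1) by blast
      then have "u \<in> ?N" using pc uc w'(1) by (simp add: minus_eq a_assoc l_neg)
      then show False using unit_N[OF u] by blast
    qed
    then have vU: "v \<in> Units R" using local v(1) by blast
    have "k \<le> n"
    proof (rule ccontr)
      assume "\<not> k \<le> n"
      then have "p [^] k = \<zero>" using pow_add[of n "k - n"] pn by simp
      then show False using au False uc by simp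
    qed
    then show ?thesis using au v(2) vU u by blast
  qed
  let ?\<R> = "{I. right_ideal I R}" and ?\<L> = "{I. left_ideal I R}"
  have R1: "\<exists>k\<le>n. p [^] k \<in> I \<and> (\<forall>J\<in>?\<R>. p [^] k \<in> J \<longrightarrow> x \<in> J)" if I: "I \<in> ?\<R>" and x: "x \<in> I" for I x
  proof -
    have rI: "right_ideal I R" using I by simp
    from lrep[of x] obtain k u where k: "k \<le> n" "u \<in> Units R" "x = p [^] k \<otimes> u"
      using right_idealD(1)[OF rI] x by blast
    have "p [^] k = x \<otimes> inv u" using k by (simp add: m_assoc Units_r_inv Units_closed)
    then have "p [^] k \<in> I" using right_idealD(4)[OF rI x] k(2) by simp
    moreover have "x \<in> J" if "right_ideal J R" "p [^] k \<in> J" for J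
      using right_idealD(4)[OF that] k by auto
    ultimately show ?thesis using k(1) by blast
  qed
  have R2: "p [^] Suc k \<in> I" if "I \<in> ?\<R>" "p [^] k \<in> I" for I and k :: nat
    using that right_idealD(4) pc by simp
  have L1: "\<exists>k\<le>n. p [^] k \<in> I \<and> (\<forall>J\<in>?\<L>. p [^] k \<in> J \<longrightarrow> x \<in> J)" if I: "I \<in> ?\<L>" and x: "x \<in> I" for I x
  proof -
    have lI: "left_ideal I R" using I by simp
    from lrep[of x] obtain k v where k: "k \<le> n" "v \<in> Units R" "x = v \<otimes> p [^] k"
      using left_idealD(1)[OF lI] x by blast
    have "p [^] k = inv v \<otimes> x" using k by (simp add: m_assoc[symmetric] Units_l_inv Units_closed)
    then have "p [^] k \<in> I" using left_idealD(4)[OF lI x] k(2) by simp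
    moreover have "x \<in> J" if "left_ideal J R" "p [^] k \<in> J" for J
      using left_idealD(4)[OF that] k by auto
    ultimately show ?thesis using k(1) by blast
  qed
  have L2: "p [^] Suc k \<in> I" if "I \<in> ?\<L>" "p [^] k \<in> I" for I and k :: nat
    unfolding nat_pow_Suc2[OF pc] using that left_idealD(4) pc by simp
  note Rc = chain_condition_from_powers[of ?\<R> n "\<lambda>k. p [^] k", OF R1 R2]
  note Lc = chain_condition_from_powers[of ?\<L> n "\<lambda>k. p [^] k", OF L1 L2]
  show "artinian R" unfolding artinian_def using Rc(2) Lc(2) by simp
  show "uniserial R" unfolding uniserial_def using Rc(1) Lc(1) by simp
qed

section \<open>Pruefer domains\<close>

lemma free_module_simps [simp]:
  "carrier (free_module R B) = {f. (\<forall>i\<in>B. f i \<in> carrier R) \<and> (\<forall>i. i \<notin> B \<longrightarrow> f i = \<zero>\<^bsub>R\<^esub>) \<and>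
     finite {i \<in> B. f i \<noteq> \<zero>\<^bsub>R\<^esub>}}"
  "zero (free_module R B) = (\<lambda>i. \<zero>\<^bsub>R\<^esub>)"
  "add (free_module R B) = (\<lambda>f g i. f i \<oplus>\<^bsub>R\<^esub> g i)"
  "smult (free_module R B) = (\<lambda>r f i. r \<otimes>\<^bsub>R\<^esub> f i)"
  by (simp_all add: free_module_def)

lemma ideal_module_simps [simp]:
  "carrier (ideal_module R I) = I" "zero (ideal_module R I) = zero R"
  "add (ideal_module R I) = add R" "smult (ideal_module R I) = monoid.mult R"
  by (simp_all add: ideal_module_def)

context cring
begin

lemma module_free_module: "module R (free_module R B)"
proof (rule moduleI)
  let ?F = "free_module R B"
  show "cring R" by (rule cring_axioms)
  have fin: "finite {i \<in> B. f i \<oplus> g i \<noteq> \<zero>}"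
    if "finite {i \<in> B. f i \<noteq> \<zero>}" "finite {i \<in> B. g i \<noteq> \<zero>}" for f g :: "'c \<Rightarrow> 'a"
    using finite_UnI[OF that] by (rule rev_finite_subset) auto
  show "abelian_group ?F"
  proof (rule abelian_groupI)
    fix f assume f: "f \<in> carrier ?F"
    have "finite {i \<in> B. \<ominus> f i \<noteq> \<zero>}"
    proof (rule finite_subset)
      show "finite {i \<in> B. f i \<noteq> \<zero>}" using f by simp
    qed (use f in auto)
    then show "\<exists>g\<in>carrier ?F.
        g \<oplus>\<^bsub>?F\<^esub> f = \<zero>\<^bsub>?F\<^esub>"
      using f by (intro bexI[of _ "\<lambda>i. \<ominus> f i"]) (auto simp: fun_eq_iff, metis l_neg l_zero zero_closed)
    show "\<zero>\<^bsub>?F\<^esub> \<oplus>\<^bsub>?F\<^esub> f = f"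
      using f by (auto simp: fun_eq_iff, metis l_zero zero_closed)
    fix g assume g: "g \<in> carrier ?F"
    have c: "f i \<in> carrier R" "g i \<in> carrier R" for i using f g by (cases "i \<in> B"; auto)+
    show "f \<oplus>\<^bsub>?F\<^esub> g \<in> carrier ?F"
      using f g fin by auto
    show "f \<oplus>\<^bsub>?F\<^esub> g = g \<oplus>\<^bsub>?F\<^esub> f"
      using c by (simp add: a_comm)
    fix h assume h: "h \<in> carrier ?F"
    have "h i \<in> carrier R" for i using h by (cases "i \<in> B"; auto)
    then show "f \<oplus>\<^bsub>?F\<^esub> g \<oplus>\<^bsub>?F\<^esub> h
        = f \<oplus>\<^bsub>?F\<^esub> (g \<oplus>\<^bsub>?F\<^esub> h)"
      using c by (simp add: a_assoc)
  qed auto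
  fix a x assume a: "a \<in> carrier R" and x: "x \<in> carrier ?F"
  have xc: "x i \<in> carrier R" for i using x by (cases "i \<in> B"; auto)
  have "finite {i \<in> B. a \<otimes> x i \<noteq> \<zero>}"
  proof (rule finite_subset)
    show "finite {i \<in> B. x i \<noteq> \<zero>}" using x by simp
  qed (use a in auto)
  then show "a \<odot>\<^bsub>?F\<^esub> x \<in> carrier ?F" using a x by auto
  fix b assume b: "b \<in> carrier R"
  show "(a \<oplus> b) \<odot>\<^bsub>?F\<^esub> x
      = a \<odot>\<^bsub>?F\<^esub> x \<oplus>\<^bsub>?F\<^esub> b \<odot>\<^bsub>?F\<^esub> x"
    using a b xc by (simp add: l_distr)
  show "(a \<otimes> b) \<odot>\<^bsub>?F\<^esub> x = a \<odot>\<^bsub>?F\<^esub> (b \<odot>\<^bsub>?F\<^esub> x)"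
    using a b xc by (simp add: m_assoc)
next
  let ?F = "free_module R B"
  fix x assume x: "x \<in> carrier ?F"
  have "x i \<in> carrier R" for i using x by (cases "i \<in> B"; auto)
  then show "\<one> \<odot>\<^bsub>?F\<^esub> x = x" by simp
next
  let ?F = "free_module R B"
  fix a x y assume a: "a \<in> carrier R"
    and x: "x \<in> carrier ?F" and y: "y \<in> carrier ?F"
  have "x i \<in> carrier R" "y i \<in> carrier R" for i using x y by (cases "i \<in> B"; auto)+
  then show "a \<odot>\<^bsub>?F\<^esub> (x \<oplus>\<^bsub>?F\<^esub> y)
      = a \<odot>\<^bsub>?F\<^esub> x \<oplus>\<^bsub>?F\<^esub> a \<odot>\<^bsub>?F\<^esub> y"
    using a by (simp add: r_distr)
qed

lemma module_ideal_module:
  assumes "ideal I R" shows "module R (ideal_module R I)"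
proof (rule moduleI)
  interpret I: ideal I R by fact
  show "cring R" by (rule cring_axioms)
  show "abelian_group (ideal_module R I)"
  proof (rule abelian_groupI)
    fix x assume "x \<in> carrier (ideal_module R I)"
    then show "\<exists>y\<in>carrier (ideal_module R I). y \<oplus>\<^bsub>ideal_module R I\<^esub> x = \<zero>\<^bsub>ideal_module R I\<^esub>"
      using I.Icarr by (intro bexI[of _ "\<ominus> x"]) (auto simp: l_neg)
  qed (use I.Icarr in \<open>auto simp: a_ac\<close>)
qed (use ideal.Icarr[OF assms] ideal.I_l_closed[OF assms] in \<open>auto simp: l_distr r_distr m_assoc\<close>)

lemma submodule_closedI:
  assumes "module R M" "H \<subseteq> carrier M" "\<zero>\<^bsub>M\<^esub> \<in> H"
    "\<And>x y. x \<in> H \<Longrightarrow> y \<in> H \<Longrightarrow> x \<oplus>\<^bsub>M\<^esub> y \<in> H"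
    "\<And>a x. a \<in> carrier R \<Longrightarrow> x \<in> H \<Longrightarrow> a \<odot>\<^bsub>M\<^esub> x \<in> H"
  shows "submodule H R M"
proof -
  interpret M: module R M by fact
  show ?thesis
  proof (rule M.submoduleI)
    fix x assume x: "x \<in> H"
    have "\<ominus>\<^bsub>M\<^esub> x = (\<ominus> \<one>) \<odot>\<^bsub>M\<^esub> x" using x assms(2) by (auto simp: M.smult_l_minus)
    then show "\<ominus>\<^bsub>M\<^esub> x \<in> H" using assms(5)[OF _ x] by simp
  qed (use assms in auto)
qed

end

text \<open>The dual basis argument. The quotients of x t_i by i are well defined by cancellation;
  together they embed I into the free module on T, and f \<mapsto> \<Sum> f_i i retracts this
  embedding because the t_i sum to 1. So I is a direct summand, with the kernel of the retraction as
  complement.\<close>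

lemma (in "domain") projective_fin_gen_ideal:
  assumes part: "\<And>S. finite S \<Longrightarrow> S \<noteq> {} \<Longrightarrow> S \<subseteq> carrier R \<Longrightarrow>
      \<exists>t. (\<forall>i\<in>S. t i \<in> carrier R) \<and> finsum R t S = \<one> \<and> (\<forall>i\<in>S. \<forall>j\<in>S. i divides j \<otimes> t i)"
    and S: "finite S" "S \<subseteq> carrier R"
  shows "projective_module R (ideal_module R (Idl S))"
proof -
  define I where "I = Idl S"
  \<comment> \<open>Zero is dropped because the coordinate functions divide by the generators. If T
    is empty, the ideal is zero and so is the free module.\<close>
  define T where "T = S - {\<zero>}"
  have idI: "ideal I R" unfolding I_def using S by (intro genideal_ideal)
  interpret I: ideal I R by (rule idI)
  have T: "finite T" "T \<subseteq> carrier R" "\<And>i. i \<in> T \<Longrightarrow> i \<noteq> \<zero>" using S by (auto simp: T_def)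
  have TI: "T \<subseteq> I" unfolding I_def T_def using genideal_self[OF S(2)] by auto
  have I_min: "x \<in> J" if "ideal J R" "T \<subseteq> J" "x \<in> I" for J x
  proof -
    have "S \<subseteq> J" using that(2) additive_subgroup.zero_closed[OF ideal.axioms(1)[OF that(1)]]
      by (auto simp: T_def)
    then show ?thesis using genideal_minimal[OF that(1)] that(3) by (auto simp: I_def)
  qed
  have "\<exists>t. (\<forall>i\<in>T. t i \<in> carrier R) \<and> (\<forall>x\<in>I. finsum R (\<lambda>i. x \<otimes> t i) T = x) \<and>
      (\<forall>i\<in>T. \<forall>j\<in>T. i divides j \<otimes> t i)"
  proof (cases "T = {}")
    case True
    have "x = \<zero>" if "x \<in> I" for x using I_min[OF zeroideal _ that] True by simp
    then show ?thesis using True by simp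
  next
    case False
    from part[OF T(1) False T(2)] obtain t where t: "\<And>i. i \<in> T \<Longrightarrow> t i \<in> carrier R"
      "finsum R t T = \<one>" "\<forall>i\<in>T. \<forall>j\<in>T. i divides j \<otimes> t i" by blast
    have "finsum R (\<lambda>i. x \<otimes> t i) T = x" if "x \<in> I" for x
      using finsum_rdistr[OF T(1), of x t] t(1,2) I.Icarr[OF that] by auto
    then show ?thesis using t by blast
  qed
  then obtain t where t: "\<And>i. i \<in> T \<Longrightarrow> t i \<in> carrier R" "\<And>x. x \<in> I \<Longrightarrow> finsum R (\<lambda>i. x \<otimes> t i) T = x"
    and tT: "\<And>i j. i \<in> T \<Longrightarrow> j \<in> T \<Longrightarrow> i divides j \<otimes> t i" by blast
  have tI: "\<exists>y. y \<in> carrier R \<and> x \<otimes> t i = i \<otimes> y" if i: "i \<in> T" and x: "x \<in> I" for i x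
  proof -
    have ic: "i \<in> carrier R" "t i \<in> carrier R" using i T t by auto
    have "ideal {x \<in> carrier R. i divides x \<otimes> t i} R"
      unfolding ideal_iff_right_left
    proof
      show right: "right_ideal {x \<in> carrier R. i divides x \<otimes> t i} R"
      proof (rule right_idealI)
        fix a r assume a: "a \<in> {x \<in> carrier R. i divides x \<otimes> t i}" and r: "r \<in> carrier R"
        have "a \<otimes> r \<otimes> t i = a \<otimes> t i \<otimes> r" using a r ic by (simp add: m_ac)
        moreover have "i divides a \<otimes> t i" using a by simp
        then have "i divides a \<otimes> t i \<otimes> r" using ic(1) r by (rule divides_mult_right)
        ultimately show "a \<otimes> r \<in> {x \<in> carrier R. i divides x \<otimes> t i}" using a r by simp
      qed (use ic in \<open>auto simp: l_distr intro: divides_add\<close>)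
      show "left_ideal {x \<in> carrier R. i divides x \<otimes> t i} R"
        using right_idealD[OF right] by (intro left_idealI) (auto simp: m_comm)
    qed
    moreover have "T \<subseteq> {x \<in> carrier R. i divides x \<otimes> t i}" using tT i T(2) by auto
    ultimately have "x \<in> {x \<in> carrier R. i divides x \<otimes> t i}" using x by (rule I_min)
    then show ?thesis by (auto elim: dividesE)
  qed
  define \<phi> where "\<phi> i x = (SOME y. y \<in> carrier R \<and> x \<otimes> t i = i \<otimes> y)" for i x
  have \<phi>: "\<phi> i x \<in> carrier R" "x \<otimes> t i = i \<otimes> \<phi> i x" if "i \<in> T" "x \<in> I" for i x
    using someI_ex[OF tI[OF that]] by (auto simp: \<phi>_def)
  have \<phi>_eq: "\<phi> i x = y" if "i \<in> T" "x \<in> I" "y \<in> carrier R" "x \<otimes> t i = i \<otimes> y" for i x y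
  proof -
    have "i \<otimes> \<phi> i x = i \<otimes> y" using \<phi>(2)[OF that(1,2)] that(4) by simp
    then show ?thesis using m_lcancel[OF T(3)[OF that(1)]] T(2) \<phi>(1) that by blast
  qed
  define h where "h x = (\<lambda>i. if i \<in> T then \<phi> i x else \<zero>)" for x
  define s where "s f = finsum R (\<lambda>i. f i \<otimes> i) T" for f
  have sh: "s (h x) = x" if x: "x \<in> I" for x
  proof -
    have "s (h x) = finsum R (\<lambda>i. x \<otimes> t i) T"
      unfolding s_def using \<phi> x T(2) t(1) I.Icarr[OF x]
      by (intro finsum_cong') (auto simp: h_def m_comm)
    then show ?thesis using t(2)[OF x] by simp
  qed
  have hadd: "h (x \<oplus> y) = (\<lambda>i. h x i \<oplus> h y i)" if xy: "x \<in> I" "y \<in> I" for x y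
  proof
    fix i
    show "h (x \<oplus> y) i = h x i \<oplus> h y i"
    proof (cases "i \<in> T")
      case True
      have "\<phi> i (x \<oplus> y) = \<phi> i x \<oplus> \<phi> i y"
      proof (rule \<phi>_eq[OF True])
        show "(x \<oplus> y) \<otimes> t i = i \<otimes> (\<phi> i x \<oplus> \<phi> i y)"
          using \<phi>[OF True xy(1)] \<phi>[OF True xy(2)] T(2) True t(1) I.Icarr xy by (auto simp: l_distr r_distr subsetD)
      qed (use \<phi>[OF True] xy in auto)
      then show ?thesis using True by (simp add: h_def)
    qed (simp add: h_def)
  qed
  have hmult: "h (r \<otimes> x) = (\<lambda>i. r \<otimes> h x i)" if r: "r \<in> carrier R" and x: "x \<in> I" for r x
  proof
    fix i
    show "h (r \<otimes> x) i = r \<otimes> h x i"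
    proof (cases "i \<in> T")
      case True
      have ic: "i \<in> carrier R" "t i \<in> carrier R" using True T(2) t(1) by auto
      have "\<phi> i (r \<otimes> x) = r \<otimes> \<phi> i x"
      proof (rule \<phi>_eq[OF True])
        have "r \<otimes> x \<otimes> t i = r \<otimes> (i \<otimes> \<phi> i x)"
          using \<phi>(2)[OF True x] r ic I.Icarr[OF x] by (simp add: m_assoc)
        then show "r \<otimes> x \<otimes> t i = i \<otimes> (r \<otimes> \<phi> i x)"
          using \<phi>(1)[OF True x] r ic by (simp add: m_lcomm)
      qed (use \<phi>[OF True x] r x I.I_l_closed in auto)
      then show ?thesis using True by (simp add: h_def)
    qed (simp add: h_def r)
  qed
  let ?F = "free_module R T"
  have F: "module R ?F" by (rule module_free_module)
  interpret F: module R ?F by (rule F)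
  have carF: "f \<in> carrier ?F \<longleftrightarrow> (\<forall>i\<in>T. f i \<in> carrier R) \<and> (\<forall>i. i \<notin> T \<longrightarrow> f i = \<zero>)" for f
    using T(1) by simp
  have hF: "h x \<in> carrier ?F" if "x \<in> I" for x unfolding carF using \<phi>(1)[OF _ that] by (simp add: h_def)
  have h0: "h \<zero> = (\<lambda>i. \<zero>)" using hmult[OF zero_closed I.zero_closed] by (simp add: h_def fun_eq_iff \<phi>)
  have sc: "s f \<in> I" if "f \<in> carrier ?F" for f
  proof -
    have "finsum R (\<lambda>i. f i \<otimes> i) U \<in> I" if "finite U" "U \<subseteq> T" for U
      using that
    proof (induction U rule: finite_induct)
      case (insert i U)
      have "f j \<otimes> j \<in> carrier R" if "j \<in> T" for j using that T(2) \<open>f \<in> carrier ?F\<close> unfolding carF by auto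
      then have "finsum R (\<lambda>i. f i \<otimes> i) (insert i U) = f i \<otimes> i \<oplus> finsum R (\<lambda>i. f i \<otimes> i) U"
        using insert by (intro finsum_insert) auto
      moreover have "f i \<otimes> i \<in> I" using insert TI \<open>f \<in> carrier ?F\<close> unfolding carF by (auto intro: I.I_l_closed)
      ultimately show ?case using insert by auto
    qed simp
    then show ?thesis unfolding s_def using T(1) by blast
  qed
  have cs: "\<And>i. i \<in> T \<Longrightarrow> f i \<otimes> i \<in> carrier R" if "f \<in> carrier ?F" for f
    using that T(2) unfolding carF by auto
  have sadd: "s (\<lambda>i. f i \<oplus> g i) = s f \<oplus> s g" if "f \<in> carrier ?F" "g \<in> carrier ?F" for f g
  proof -
    have "s (\<lambda>i. f i \<oplus> g i) = finsum R (\<lambda>i. f i \<otimes> i \<oplus> g i \<otimes> i) T"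
      unfolding s_def using that T(2) cs[OF that(1)] cs[OF that(2)] unfolding carF
      by (intro finsum_cong') (auto simp: l_distr subsetD)
    then show ?thesis unfolding s_def using cs[OF that(1)] cs[OF that(2)] by (simp add: finsum_addf)
  qed
  have smult: "s (\<lambda>i. r \<otimes> f i) = r \<otimes> s f" if "r \<in> carrier R" "f \<in> carrier ?F" for r f
  proof -
    have "s (\<lambda>i. r \<otimes> f i) = finsum R (\<lambda>i. r \<otimes> (f i \<otimes> i)) T"
      unfolding s_def using that T(2) cs[OF that(2)] unfolding carF
      by (intro finsum_cong') (auto simp: m_assoc subsetD)
    then show ?thesis unfolding s_def using finsum_rdistr[OF T(1) that(1), of "\<lambda>i. f i \<otimes> i"] cs[OF that(2)] by auto
  qed
  let ?H = "h ` I" and ?K = "{f \<in> carrier ?F. s f = \<zero>}"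
  have H: "submodule ?H R ?F"
  proof (rule submodule_closedI[OF F])
    show "?H \<subseteq> carrier ?F" using hF by blast
    have "h \<zero> \<in> ?H" using I.zero_closed by (rule imageI)
    then show "\<zero>\<^bsub>?F\<^esub> \<in> ?H" unfolding h0 free_module_simps .
    show "x \<oplus>\<^bsub>?F\<^esub> y \<in> ?H" if xy: "x \<in> ?H" "y \<in> ?H" for x y
    proof -
      from xy obtain a b where "a \<in> I" "b \<in> I" "x = h a" "y = h b" by blast
      then have "x \<oplus>\<^bsub>?F\<^esub> y = h (a \<oplus> b)" "a \<oplus> b \<in> I" using hadd I.a_closed by auto
      then show ?thesis by (rule image_eqI)
    qed
    show "a \<odot>\<^bsub>?F\<^esub> x \<in> ?H" if ax: "a \<in> carrier R" "x \<in> ?H" for a x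
    proof -
      from ax obtain b where "b \<in> I" "x = h b" by blast
      then have "a \<odot>\<^bsub>?F\<^esub> x = h (a \<otimes> b)" "a \<otimes> b \<in> I" using hmult ax(1) I.I_l_closed by auto
      then show ?thesis by (rule image_eqI)
    qed
  qed
  have K: "submodule ?K R ?F"
  proof (rule submodule_closedI[OF F])
    show "\<zero>\<^bsub>?F\<^esub> \<in> ?K" using h0 sh[OF I.zero_closed] by simp
    show "x \<oplus>\<^bsub>?F\<^esub> y \<in> ?K" if "x \<in> ?K" "y \<in> ?K" for x y
    proof -
      have "s (x \<oplus>\<^bsub>?F\<^esub> y) = \<zero>" using that sadd[of x y] by simp
      then show ?thesis using that F.a_closed[of x y] by blast
    qed
    show "a \<odot>\<^bsub>?F\<^esub> x \<in> ?K" if "a \<in> carrier R" "x \<in> ?K" for a x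
    proof -
      have "s (a \<odot>\<^bsub>?F\<^esub> x) = \<zero>" using that smult[of a x] by simp
      then show ?thesis using that F.smult_closed[of a x] by blast
    qed
  qed auto
  have HK: "?H \<inter> ?K = {\<zero>\<^bsub>?F\<^esub>}"
  proof
    show "?H \<inter> ?K \<subseteq> {\<zero>\<^bsub>?F\<^esub>}" using sh h0 by auto
    show "{\<zero>\<^bsub>?F\<^esub>} \<subseteq> ?H \<inter> ?K"
      using subgroup.one_closed[OF submodule.axioms(1)[OF H]]
        subgroup.one_closed[OF submodule.axioms(1)[OF K]] by simp
  qed
  have sum: "?H <+>\<^bsub>?F\<^esub> ?K = carrier ?F"
  proof
    show "?H <+>\<^bsub>?F\<^esub> ?K \<subseteq> carrier ?F"
      unfolding set_add_def' using hF F.a_closed by blast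
    show "carrier ?F \<subseteq> ?H <+>\<^bsub>?F\<^esub> ?K"
    proof
      fix f assume f: "f \<in> carrier ?F"
      have hs: "h (s f) \<in> carrier ?F" "h (s f) \<in> ?H" using sc[OF f] hF by auto
      \<comment> \<open>The kernel component f - h (s f) of f, written with the scalar -1 because
        scalar multiplication in the free module is explicitly pointwise.\<close>
      define k where "k = (\<lambda>i. f i \<oplus> (\<ominus> \<one>) \<otimes> h (s f) i)"
      have mh: "(\<lambda>i. (\<ominus> \<one>) \<otimes> h (s f) i) \<in> carrier ?F"
        using F.smult_closed[of "\<ominus> \<one>", OF _ hs(1)] by simp
      have kF: "k \<in> carrier ?F" using F.a_closed[OF f mh] by (simp add: k_def)
      have "s k = s f \<oplus> (\<ominus> \<one>) \<otimes> s f"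
        unfolding k_def using sadd[OF f mh] smult[of "\<ominus> \<one>", OF _ hs(1)] sh[OF sc[OF f]] by simp
      also have "\<dots> = \<zero>" using I.Icarr[OF sc[OF f]] by (simp add: l_minus r_neg)
      finally have kK: "k \<in> ?K" using kF by simp
      have "f = h (s f) \<oplus>\<^bsub>?F\<^esub> k"
      proof
        fix i
        have "f i \<in> carrier R" "h (s f) i \<in> carrier R"
          using f hs(1) unfolding carF by (cases "i \<in> T"; auto)+
        then show "f i = (h (s f) \<oplus>\<^bsub>?F\<^esub> k) i"
          by (simp add: k_def l_minus a_lcomm[of "h (s f) i"] r_neg)
      qed
      then show "f \<in> ?H <+>\<^bsub>?F\<^esub> ?K" unfolding set_add_def' using hs(2) kK by blast
    qed
  qed
  have "direct_summand ?H R ?F"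
    unfolding direct_summand_def using H K HK sum by blast
  moreover have "h \<in> module_iso R (ideal_module R I) (?F\<lparr>carrier := ?H\<rparr>)"
  proof -
    have "inj_on h I" using sh by (metis inj_onI)
    then have "bij_betw h I ?H" by (simp add: bij_betw_def)
    then show ?thesis unfolding module_iso_def using hadd hmult by simp
  qed
  ultimately show ?thesis
    unfolding projective_module_def I_def[symmetric] using module_ideal_module[OF idI] by blast
qed

lemma (in distributive_duo_ring) pruefer_domain_if_reduced:
  assumes one: "\<one> \<noteq> \<zero>"
    and prime: "\<And>a b. a \<in> carrier R \<Longrightarrow> b \<in> carrier R \<Longrightarrow> a \<otimes> b \<in> nilpotents R \<Longrightarrow>
      a \<in> nilpotents R \<or> b \<in> nilpotents R"
    and N: "nilpotents R = {\<zero>}"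
    and ce: "centrally_essential R"
  shows "pruefer_domain R"
proof -
  have integral: "a = \<zero> \<or> b = \<zero>" if "a \<otimes> b = \<zero>" "a \<in> carrier R" "b \<in> carrier R" for a b
    using prime[OF that(2,3)] that(1) N by simp
  have comm: "a \<otimes> b = b \<otimes> a" if ab: "a \<in> carrier R" "b \<in> carrier R" for a b
  proof (cases "a = \<zero>")
    case False
    from central_multiple[OF ce ab(1) False] obtain x where x: "x \<in> ring_center R" "a \<otimes> x \<in> ring_center R" "a \<otimes> x \<noteq> \<zero>"
      by blast
    have xc: "x \<in> carrier R" using x(1) by (rule ring_center_closed)
    have "a \<otimes> b \<otimes> x = (a \<otimes> x) \<otimes> b" using ring_centerD[OF x(1) ab(2)] ab xc by (simp add: m_assoc)
    also have "\<dots> = b \<otimes> a \<otimes> x" using ring_centerD[OF x(2) ab(2)] ab xc by (simp add: m_assoc)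
    finally have "(a \<otimes> b \<ominus> b \<otimes> a) \<otimes> x = \<zero>" using ab xc by (simp add: l_distr l_minus minus_eq r_neg)
    then have "a \<otimes> b \<ominus> b \<otimes> a = \<zero>" using integral[of "a \<otimes> b \<ominus> b \<otimes> a" x] ab xc x(3) by auto
    then show ?thesis using ab by (simp add: minus_eq_zero_iff)
  qed (use ab in simp)
  have "cring R"
    by (intro cring.intro ring_axioms comm_monoid.intro monoid_axioms comm_monoid_axioms.intro comm)
  then interpret D: "domain" R
    by (intro domain.intro domain_axioms.intro one integral)
  show ?thesis unfolding pruefer_domain_def
    using D.domain_axioms D.projective_fin_gen_ideal[OF partition_of_unity] by blast
qed

text \<open>Projectivity of I = (a, b) supplies coordinates g with a = \<Sum> g(a)_j X_j, where X_j
  = a u_j + b v_j lies in I. As g(a)_j b = g(b)_j a, this becomes a = a (s + p) for s = \<Sum>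
  g(a)_j u_j and p = \<Sum> g(b)_j v_j, so s + p = 1. The same exchange yields a p = b \<Sum> g(a)_j
  v_j and b s = a \<Sum> g(b)_j u_j, so t = p works.\<close>

lemma pruefer_domain_distributive:
  fixes R (structure)
  assumes pr: "pruefer_domain R" and a: "a \<in> carrier R" and b: "b \<in> carrier R"
  shows "\<exists>t\<in>carrier R. b divides a \<otimes> t \<and> a divides b \<otimes> (\<one> \<ominus> t)"
proof (cases "a = \<zero>")
  case True
  interpret "domain" R using pr by (simp add: pruefer_domain_def)
  show ?thesis using True b by (intro bexI[of _ \<one>]) (auto simp: minus_eq r_neg)
next
  case False
  interpret "domain" R using pr by (simp add: pruefer_domain_def)
  define I where "I = Idl {a, b}"
  have idI: "ideal I R" unfolding I_def using a b by (intro genideal_ideal) auto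
  interpret I: ideal I R by (rule idI)
  have abI: "a \<in> I" "b \<in> I" unfolding I_def using genideal_self[of "{a, b}"] a b by auto
  have I_rep: "\<exists>u\<in>carrier R. \<exists>v\<in>carrier R. x = a \<otimes> u \<oplus> b \<otimes> v" if "x \<in> I" for x
  proof -
    \<comment> \<open>This is a R + b R; the commutative ring is viewed as right invariant to reuse
      the construction of such sums.\<close>
    let ?J = "{q \<oplus> b \<otimes> r | q r. q \<in> {x \<in> carrier R. a divides x} \<and> r \<in> carrier R}"
    have duo: "duo_ring R"
      using ring_axioms by (intro duo_ring.intro duo_ring_axioms.intro) (auto simp: m_comm intro: dividesI)
    have rJ: "right_ideal ?J R"
      using duo_ring.right_ideal_add_principal[OF duo right_ideal_principal[OF a] b] .
    have "ideal ?J R" using duo_ring.right_ideal_imp_ideal[OF duo rJ] .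
    moreover have "a \<in> ?J" using a b by (intro CollectI exI[of _ a] exI[of _ \<zero>]) simp
    moreover have "b \<in> ?J" using a b by (intro CollectI exI[of _ \<zero>] exI[of _ \<one>]) simp
    ultimately have "I \<subseteq> ?J" unfolding I_def by (intro genideal_minimal) auto
    then obtain q r where "a divides q" and r: "r \<in> carrier R" and x: "x = q \<oplus> b \<otimes> r"
      using \<open>x \<in> I\<close> by blast
    then obtain u where "u \<in> carrier R" "q = a \<otimes> u" by (elim dividesE)
    then show ?thesis using r x by blast
  qed
  have "projective_module R (ideal_module R I)"
    using pr a b unfolding pruefer_domain_def I_def by auto
  then obtain B :: "'a set" and H g where
    ds: "direct_summand H R (free_module R B)"
    and g: "g \<in> module_iso R (ideal_module R I) (free_module R B\<lparr>carrier := H\<rparr>)"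
    unfolding projective_module_def by blast
  let ?F = "free_module R B"
  interpret F: module R ?F by (rule module_free_module)
  from ds obtain K where H: "submodule H R ?F" and K: "submodule K R ?F"
    and HK: "H \<inter> K = {\<zero>\<^bsub>?F\<^esub>}" "H <+>\<^bsub>?F\<^esub> K = carrier ?F"
    unfolding direct_summand_def by blast
  note Hd = F.submoduleE[OF H] and Kd = F.submoduleE[OF K]
  have g_bij: "bij_betw g I H"
    and g_add: "\<And>x y. x \<in> I \<Longrightarrow> y \<in> I \<Longrightarrow> g (x \<oplus> y) = g x \<oplus>\<^bsub>?F\<^esub> g y"
    and g_mult: "\<And>r x. r \<in> carrier R \<Longrightarrow> x \<in> I \<Longrightarrow> g (r \<otimes> x) = r \<odot>\<^bsub>?F\<^esub> g x"
    using g unfolding module_iso_def by auto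
  have gH: "g x \<in> H" if "x \<in> I" for x using g_bij that by (auto simp: bij_betw_def)
  have gF: "g x \<in> carrier ?F" if "x \<in> I" for x using gH[OF that] Hd(1) by blast
  have Fc: "f i \<in> carrier R" if "f \<in> carrier ?F" for f i using that by (cases "i \<in> B") auto
  \<comment> \<open>\<open>proj f x\<close> says that x is the I-component of f when the free module
    is decomposed into H = g(I) and K. It is a relation; existence and uniqueness of x are shown
    next.\<close>
  define proj where "proj f x \<longleftrightarrow> f \<in> carrier ?F \<and> x \<in> I \<and> (\<exists>k\<in>K. f = (\<lambda>i. g x i \<oplus> k i))" for f x
  have projI: "proj f x"
    if "f \<in> carrier ?F" "x \<in> I" "k \<in> K" "f = (\<lambda>i. g x i \<oplus> k i)" for f x k
    unfolding proj_def using that(1,2) bexI[of "\<lambda>k. f = (\<lambda>i. g x i \<oplus> k i)", OF that(4,3)]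
    by (intro conjI)
  have proj_ex: "\<exists>x. proj f x" if f: "f \<in> carrier ?F" for f
  proof -
    from f HK(2) obtain h k where "h \<in> H" "k \<in> K" "f = h \<oplus>\<^bsub>?F\<^esub> k"
      unfolding set_add_def' by blast
    moreover from this obtain x where "x \<in> I" "h = g x" using g_bij by (auto simp: bij_betw_def)
    ultimately have "proj f x" using f unfolding proj_def by auto
    then show ?thesis by blast
  qed
  have proj_unique: "x = y" if x: "proj f x" and y: "proj f y" for f x y
  proof -
    from x y obtain k l where k: "k \<in> K" "f = (\<lambda>i. g x i \<oplus> k i)" and l: "l \<in> K" "f = (\<lambda>i. g y i \<oplus> l i)"
      and xy: "x \<in> I" "y \<in> I" unfolding proj_def by blast
    have klF: "k \<in> carrier ?F" "l \<in> carrier ?F" using k(1) l(1) Kd(1) by blast+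
    have dI: "(\<ominus> \<one>) \<otimes> y \<in> I" "x \<oplus> (\<ominus> \<one>) \<otimes> y \<in> I" using xy by (auto intro: I.I_l_closed)
    have gd: "g (x \<oplus> (\<ominus> \<one>) \<otimes> y) = (\<lambda>i. l i \<oplus> (\<ominus> \<one>) \<otimes> k i)"
    proof
      fix i
      have eq: "g x i \<oplus> k i = g y i \<oplus> l i" using k(2) l(2) by (simp add: fun_eq_iff)
      have c: "g x i \<in> carrier R" "k i \<in> carrier R" "g y i \<in> carrier R" "l i \<in> carrier R"
        using Fc gF xy klF by auto
      have "g (x \<oplus> (\<ominus> \<one>) \<otimes> y) i = g x i \<oplus> (\<ominus> \<one>) \<otimes> g y i"
        using g_add[OF xy(1) dI(1)] g_mult[OF _ xy(2), of "\<ominus> \<one>"] by simp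
      also have "\<dots> = (g x i \<oplus> k i) \<oplus> (\<ominus> (k i) \<oplus> \<ominus> (g y i))" using c by (simp add: l_minus) algebra
      also have "\<dots> = (g y i \<oplus> l i) \<oplus> (\<ominus> (k i) \<oplus> \<ominus> (g y i))" unfolding eq ..
      also have "\<dots> = l i \<oplus> (\<ominus> \<one>) \<otimes> k i" using c by (simp add: l_minus) algebra
      finally show "g (x \<oplus> (\<ominus> \<one>) \<otimes> y) i = l i \<oplus> (\<ominus> \<one>) \<otimes> k i" .
    qed
    have "l \<oplus>\<^bsub>?F\<^esub> ((\<ominus> \<one>) \<odot>\<^bsub>?F\<^esub> k) \<in> K" using k(1) l(1) Kd(4,5) by blast
    then have "g (x \<oplus> (\<ominus> \<one>) \<otimes> y) \<in> K" unfolding gd by simp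
    then have "g (x \<oplus> (\<ominus> \<one>) \<otimes> y) = (\<lambda>i. \<zero>)" using gH[OF dI(2)] HK(1) by auto
    also have "\<dots> = g \<zero>"
      using g_mult[OF zero_closed abI(1)] a Fc[OF gF[OF abI(1)]] by simp
    finally have "x \<oplus> (\<ominus> \<one>) \<otimes> y = \<zero>"
      using g_bij dI(2) I.zero_closed unfolding bij_betw_def by (meson inj_onD)
    then show ?thesis using I.Icarr xy minus_eq_zero_iff[of x y] by (simp add: l_minus minus_eq)
  qed
  have proj_zero: "proj (\<lambda>i. \<zero>) \<zero>"
  proof -
    have "g \<zero> = (\<lambda>i. \<zero>)" using g_mult[OF zero_closed abI(1)] a Fc[OF gF[OF abI(1)]] by simp
    moreover have "(\<lambda>i. \<zero>) \<in> K" using HK(1) by auto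
    moreover have "(\<lambda>i. \<zero>) \<in> carrier ?F" by simp
    ultimately show ?thesis using I.zero_closed by (intro projI[of _ _ "\<lambda>i. \<zero>"]) simp_all
  qed
  have proj_g: "proj (g x) x" if x: "x \<in> I" for x
  proof (rule projI)
    show "(\<lambda>i. \<zero>) \<in> K" using HK(1) by auto
    show "g x = (\<lambda>i. g x i \<oplus> \<zero>)" using Fc[OF gF[OF x]] by simp
  qed (use x gF in \<open>simp_all del: free_module_simps\<close>)
  have proj_add: "proj (\<lambda>i. f i \<oplus> f' i) (x \<oplus> x')" if "proj f x" "proj f' x'" for f f' x x'
  proof -
    from that obtain k k' where k: "k \<in> K" "f = (\<lambda>i. g x i \<oplus> k i)" "k' \<in> K" "f' = (\<lambda>i. g x' i \<oplus> k' i)"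
      and F: "f \<in> carrier ?F" "f' \<in> carrier ?F" and x: "x \<in> I" "x' \<in> I" unfolding proj_def by blast
    have "k \<in> carrier ?F" "k' \<in> carrier ?F" using k Kd(1) by blast+
    note c = this[THEN Fc] gF[OF x(1), THEN Fc] gF[OF x(2), THEN Fc]
    have "(\<lambda>i. f i \<oplus> f' i) = (\<lambda>i. g (x \<oplus> x') i \<oplus> (k i \<oplus> k' i))"
      unfolding k(2,4) g_add[OF x] using c by (simp add: a_ac)
    moreover have "(\<lambda>i. k i \<oplus> k' i) \<in> K" using Kd(5)[OF k(1,3)] by simp
    moreover have "(\<lambda>i. f i \<oplus> f' i) \<in> carrier ?F" using F.a_closed[OF F] by simp
    ultimately show ?thesis using I.a_closed[OF x] by (intro projI)
  qed
  have proj_mult: "proj (\<lambda>i. r \<otimes> f i) (r \<otimes> x)" if r: "r \<in> carrier R" and "proj f x" for r f x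
  proof -
    from that obtain k where k: "k \<in> K" "f = (\<lambda>i. g x i \<oplus> k i)" and F: "f \<in> carrier ?F" and x: "x \<in> I"
      unfolding proj_def by blast
    have "k \<in> carrier ?F" using k Kd(1) by blast
    note c = this[THEN Fc] gF[OF x, THEN Fc]
    have "(\<lambda>i. r \<otimes> f i) = (\<lambda>i. g (r \<otimes> x) i \<oplus> r \<otimes> k i)"
      unfolding k(2) g_mult[OF r x] using c r by (simp add: r_distr)
    moreover have "(\<lambda>i. r \<otimes> k i) \<in> K" using Kd(4)[OF r k(1)] by simp
    moreover have "(\<lambda>i. r \<otimes> f i) \<in> carrier ?F" using F.smult_closed[OF r F] by simp
    ultimately show ?thesis using I.I_l_closed[OF x r] by (intro projI)
  qed
  \<comment> \<open>X_j is the I-component of the j-th unit vector.\<close>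
  have "\<exists>x. proj (\<lambda>i. if i = j then \<one> else \<zero>) x" if "j \<in> B" for j
    using that by (intro proj_ex) (auto intro: rev_finite_subset[of "{j}"])
  then obtain X where X: "\<And>j. j \<in> B \<Longrightarrow> proj (\<lambda>i. if i = j then \<one> else \<zero>) (X j)" by metis
  have XI: "X j \<in> I" if "j \<in> B" for j using X[OF that] by (simp add: proj_def)
  have proj_sum: "proj (\<lambda>i. if i \<in> U then f i else \<zero>) (finsum R (\<lambda>j. f j \<otimes> X j) U)"
    if "finite U" "U \<subseteq> B" "\<And>i. f i \<in> carrier R" for U f
    using that
  proof (induction U rule: finite_induct)
    case empty
    then show ?case using proj_zero by simp
  next
    case (insert j U)
    have j: "j \<in> B" using insert by auto
    have "finsum R (\<lambda>j. f j \<otimes> X j) (insert j U) = f j \<otimes> X j \<oplus> finsum R (\<lambda>j. f j \<otimes> X j) U"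
      using insert XI I.Icarr by (intro finsum_insert) (auto simp: subset_iff)
    moreover have "(\<lambda>i. if i \<in> insert j U then f i else \<zero>) =
        (\<lambda>i. f j \<otimes> (if i = j then \<one> else \<zero>) \<oplus> (if i \<in> U then f i else \<zero>))"
      using insert by (auto simp: fun_eq_iff)
    ultimately show ?case
      using proj_add[OF proj_mult[OF insert.prems(2) X[OF j]] insert.IH] insert.prems by simp
  qed
  \<comment> \<open>One finite set containing the supports of both g a and g b, so that the sums can
    be compared term by term.\<close>
  define U where "U = {i \<in> B. g a i \<noteq> \<zero>} \<union> {i \<in> B. g b i \<noteq> \<zero>}"
  have U: "finite U" "U \<subseteq> B" using gF[OF abI(1)] gF[OF abI(2)] by (auto simp: U_def)
  have ga: "g a i \<in> carrier R" and gb: "g b i \<in> carrier R" for i using Fc gF abI by auto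
  have "(\<lambda>i. if i \<in> U then g a i else \<zero>) = g a"
    using gF[OF abI(1)] by (auto simp: fun_eq_iff U_def)
  then have "proj (g a) (finsum R (\<lambda>j. g a j \<otimes> X j) U)" using proj_sum[OF U, of "g a"] ga by simp
  then have a_sum: "a = finsum R (\<lambda>j. g a j \<otimes> X j) U"
    using proj_unique proj_g[OF abI(1)] by blast
  \<comment> \<open>Both sides are the j-th coordinate of g (a b).\<close>
  have gab: "g a j \<otimes> b = g b j \<otimes> a" for j
  proof -
    have "b \<otimes> g a j = a \<otimes> g b j"
      using g_mult[OF b abI(1)] g_mult[OF a abI(2)] m_comm[OF a b] by (simp add: fun_eq_iff)
    then show ?thesis using a b ga gb by (simp add: m_comm)
  qed
  have "\<forall>j\<in>B. \<exists>u. \<exists>v. u \<in> carrier R \<and> v \<in> carrier R \<and> X j = a \<otimes> u \<oplus> b \<otimes> v"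
    using I_rep XI by blast
  then obtain u v where uv: "\<And>j. j \<in> B \<Longrightarrow> u j \<in> carrier R" "\<And>j. j \<in> B \<Longrightarrow> v j \<in> carrier R"
    "\<And>j. j \<in> B \<Longrightarrow> X j = a \<otimes> u j \<oplus> b \<otimes> v j" by metis
  have uU: "u j \<in> carrier R" and vU: "v j \<in> carrier R" if "j \<in> U" for j using uv U that by auto
  define s where "s = finsum R (\<lambda>j. g a j \<otimes> u j) U"
  define p where "p = finsum R (\<lambda>j. g b j \<otimes> v j) U"
  have sp: "s \<in> carrier R" "p \<in> carrier R" unfolding s_def p_def using ga gb uU vU by (auto intro!: finsum_closed)
  have swap: "a \<otimes> (g b j \<otimes> w) = b \<otimes> (g a j \<otimes> w)" if "w \<in> carrier R" for w j
  proof -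
    have "a \<otimes> (g b j \<otimes> w) = (g b j \<otimes> a) \<otimes> w" using a gb that by (simp add: m_ac)
    also have "\<dots> = b \<otimes> (g a j \<otimes> w)" unfolding gab[symmetric] using b ga that by (simp add: m_ac)
    finally show ?thesis .
  qed
  have as: "a \<otimes> s = finsum R (\<lambda>j. a \<otimes> (g a j \<otimes> u j)) U"
    unfolding s_def using a ga uU U(1) by (intro finsum_rdistr) auto
  have bs: "b \<otimes> s = finsum R (\<lambda>j. b \<otimes> (g a j \<otimes> u j)) U"
    unfolding s_def using b ga uU U(1) by (intro finsum_rdistr) auto
  have ap: "a \<otimes> p = finsum R (\<lambda>j. a \<otimes> (g b j \<otimes> v j)) U"
    unfolding p_def using a gb vU U(1) by (intro finsum_rdistr) auto
  have ap': "a \<otimes> p = b \<otimes> finsum R (\<lambda>j. g a j \<otimes> v j) U"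
  proof -
    have "a \<otimes> p = finsum R (\<lambda>j. b \<otimes> (g a j \<otimes> v j)) U"
      unfolding ap using b ga vU by (intro finsum_cong') (auto simp: swap)
    also have "\<dots> = b \<otimes> finsum R (\<lambda>j. g a j \<otimes> v j) U"
      using b ga vU U(1) by (intro finsum_rdistr[symmetric]) auto
    finally show ?thesis .
  qed
  have bs': "b \<otimes> s = a \<otimes> finsum R (\<lambda>j. g b j \<otimes> u j) U"
  proof -
    have "b \<otimes> s = finsum R (\<lambda>j. a \<otimes> (g b j \<otimes> u j)) U"
      unfolding bs using a gb uU by (intro finsum_cong') (auto simp: swap)
    also have "\<dots> = a \<otimes> finsum R (\<lambda>j. g b j \<otimes> u j) U"
      using a gb uU U(1) by (intro finsum_rdistr[symmetric]) auto
    finally show ?thesis .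
  qed
  have "a = finsum R (\<lambda>j. a \<otimes> (g a j \<otimes> u j) \<oplus> a \<otimes> (g b j \<otimes> v j)) U"
  proof (subst a_sum, intro finsum_cong')
    fix j assume j: "j \<in> U"
    then have "X j = a \<otimes> u j \<oplus> b \<otimes> v j" using uv(3) U(2) by blast
    then have "g a j \<otimes> X j = a \<otimes> (g a j \<otimes> u j) \<oplus> b \<otimes> (g a j \<otimes> v j)"
      using a b ga uU[OF j] vU[OF j] by (simp add: r_distr m_ac)
    then show "g a j \<otimes> X j = a \<otimes> (g a j \<otimes> u j) \<oplus> a \<otimes> (g b j \<otimes> v j)"
      using swap vU[OF j] by simp
  qed (use a ga gb uU vU in auto)
  also have "\<dots> = a \<otimes> s \<oplus> a \<otimes> p"
    unfolding as ap using a ga gb uU vU by (intro finsum_addf) auto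
  finally have "a \<otimes> \<one> = a \<otimes> (s \<oplus> p)" using a sp by (simp add: r_distr)
  then have "\<one> = s \<oplus> p" using m_lcancel[OF False a one_closed, of "s \<oplus> p"] sp by simp
  then have s_eq: "\<one> \<ominus> p = s" using sp by (simp add: minus_eq a_assoc r_neg)
  show ?thesis
  proof (intro bexI conjI)
    show "b divides a \<otimes> p" unfolding ap' using ga vU by (intro dividesI[OF _ refl] finsum_closed) auto
    show "a divides b \<otimes> (\<one> \<ominus> p)" unfolding s_eq bs' using gb uU by (intro dividesI[OF _ refl] finsum_closed) auto
  qed (rule sp)
qed

section \<open>Artinian uniserial rings\<close>

lemma (in ring) left_ideal_principal:
  assumes a: "a \<in> carrier R" shows "left_ideal {r. \<exists>c\<in>carrier R. r = c \<otimes> a} R"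
proof (rule left_idealI)
  show "\<zero> \<in> {r. \<exists>c\<in>carrier R. r = c \<otimes> a}" using a by (auto intro!: bexI[of _ \<zero>])
  show "x \<oplus> y \<in> {r. \<exists>c\<in>carrier R. r = c \<otimes> a}"
    if xy: "x \<in> {r. \<exists>c\<in>carrier R. r = c \<otimes> a}" "y \<in> {r. \<exists>c\<in>carrier R. r = c \<otimes> a}" for x y
  proof -
    from xy obtain c d where "c \<in> carrier R" "d \<in> carrier R" "x = c \<otimes> a" "y = d \<otimes> a" by blast
    then show ?thesis using a by (auto intro!: bexI[of _ "c \<oplus> d"] simp: l_distr)
  qed
  show "r \<otimes> x \<in> {r. \<exists>c\<in>carrier R. r = c \<otimes> a}"
    if xr: "x \<in> {r. \<exists>c\<in>carrier R. r = c \<otimes> a}" "r \<in> carrier R" for x r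
  proof -
    from xr obtain c where "c \<in> carrier R" "x = c \<otimes> a" by blast
    then show ?thesis using a xr by (auto intro!: bexI[of _ "r \<otimes> c"] simp: m_assoc)
  qed
qed (use a in auto)

locale artinian_uniserial_ring = ring +
  assumes art: "artinian R" and uni: "uniserial R" and one_neq_zero: "\<one> \<noteq> \<zero>"
begin

lemma divides_total:
  assumes "a \<in> carrier R" "b \<in> carrier R" shows "a divides b \<or> b divides a"
proof -
  have total: "I \<subseteq> J \<or> J \<subseteq> I" if "right_ideal I R" "right_ideal J R" for I J
    using uni that by (simp add: uniserial_def)
  have "{r \<in> carrier R. a divides r} \<subseteq> {r \<in> carrier R. b divides r} \<or>
    {r \<in> carrier R. b divides r} \<subseteq> {r \<in> carrier R. a divides r}"
    by (intro total right_ideal_principal assms)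
  moreover have "a \<in> {r \<in> carrier R. a divides r}" "b \<in> {r \<in> carrier R. b divides r}"
    using assms by auto
  ultimately show ?thesis by blast
qed

lemma right_descending:
  assumes f: "\<And>k::nat. f k \<in> carrier R" "\<And>k. f k divides f (Suc k)"
  shows "\<exists>k. f (Suc k) divides f k"
proof (rule ccontr)
  assume no: "\<nexists>k. f (Suc k) divides f k"
  let ?I = "\<lambda>k. {r \<in> carrier R. f k divides r}"
  have "?I (Suc k) \<subset> ?I k" for k
  proof -
    have "?I (Suc k) \<subseteq> ?I k" using f divides_trans by blast
    moreover have "f k \<in> ?I k" "f k \<notin> ?I (Suc k)" using f no by auto
    ultimately show ?thesis by blast
  qed
  moreover have "right_ideal (?I k) R" for k using f(1) by (rule right_ideal_principal)
  ultimately have "\<forall>n. right_ideal (?I n) R \<and> ?I (Suc n) \<subset> ?I n" by (intro allI conjI)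
  then have "\<exists>I :: nat \<Rightarrow> 'a set. \<forall>n. right_ideal (I n) R \<and> I (Suc n) \<subset> I n" by (intro exI[of _ ?I])
  moreover have "\<not> (\<exists>I :: nat \<Rightarrow> 'a set. \<forall>n. right_ideal (I n) R \<and> I (Suc n) \<subset> I n)"
    using art by (simp add: artinian_def)
  ultimately show False by (rule notE[rotated])
qed

lemma left_descending:
  assumes f: "\<And>k::nat. f k \<in> carrier R" "\<And>k. \<exists>c\<in>carrier R. f (Suc k) = c \<otimes> f k"
  shows "\<exists>k. \<exists>c\<in>carrier R. f k = c \<otimes> f (Suc k)"
proof (rule ccontr)
  assume no: "\<nexists>k. \<exists>c\<in>carrier R. f k = c \<otimes> f (Suc k)"
  let ?I = "\<lambda>k. {r. \<exists>c\<in>carrier R. r = c \<otimes> f k}"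
  have "?I (Suc k) \<subset> ?I k" for k
  proof -
    from f(2)[of k] obtain c where c: "c \<in> carrier R" "f (Suc k) = c \<otimes> f k" by blast
    have "?I (Suc k) \<subseteq> ?I k"
    proof
      fix r assume "r \<in> ?I (Suc k)"
      then obtain d where d: "d \<in> carrier R" "r = d \<otimes> f (Suc k)" by blast
      then have "r = (d \<otimes> c) \<otimes> f k" unfolding c(2) using c(1) f(1) by (simp add: m_assoc)
      then show "r \<in> ?I k" using c(1) d(1) by blast
    qed
    moreover have "f k = \<one> \<otimes> f k" using f(1) by simp
    then have "f k \<in> ?I k" using one_closed by blast
    moreover have "f k \<notin> ?I (Suc k)" using no by blast
    ultimately show ?thesis by blast
  qed
  moreover have "left_ideal (?I k) R" for k using f(1) by (rule left_ideal_principal)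
  ultimately have "\<forall>n. left_ideal (?I n) R \<and> ?I (Suc n) \<subset> ?I n" by (intro allI conjI)
  then have "\<exists>I :: nat \<Rightarrow> 'a set. \<forall>n. left_ideal (I n) R \<and> I (Suc n) \<subset> I n" by (intro exI[of _ ?I])
  moreover have "\<not> (\<exists>I :: nat \<Rightarrow> 'a set. \<forall>n. left_ideal (I n) R \<and> I (Suc n) \<subset> I n)"
    using art by (simp add: artinian_def)
  ultimately show False by (rule notE[rotated])
qed

text \<open>One of x and 1 - x divides the other. If x divided 1 - x, it would divide their sum 1;
  so 1 - x divides x and hence 1.\<close>

lemma one_minus_divides_one:
  assumes x: "x \<in> carrier R" "\<not> x divides \<one>" shows "(\<one> \<ominus> x) divides \<one>"
proof -
  have sum: "x \<oplus> (\<one> \<ominus> x) = \<one>" using x by (simp add: minus_eq a_comm[of x] a_assoc l_neg)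
  have "\<not> x divides (\<one> \<ominus> x)" using divides_add[of x x "\<one> \<ominus> x"] x unfolding sum by auto
  then have "(\<one> \<ominus> x) divides x" using divides_total[of x "\<one> \<ominus> x"] x by auto
  then show ?thesis using divides_add[of "\<one> \<ominus> x" x "\<one> \<ominus> x"] x unfolding sum by simp
qed

text \<open>The right ideals generated by the powers of a stabilize: a^k = a^(k+1) r, so a^k (1 - a
  r) = 0. Since a r does not divide 1 either, 1 - a r has a right inverse. One-sided inverses must
  do here, as right invariance is established only afterwards.\<close>

lemma nilpotent_if_not_divides_one:
  assumes a: "a \<in> carrier R" "\<not> a divides \<one>" shows "a \<in> nilpotents R"
proof -
  have "\<exists>k::nat. a [^] Suc k divides a [^] k"
    using a by (intro right_descending) (auto intro: dividesI)
  then obtain k :: nat and r where r: "r \<in> carrier R" "a [^] k = a [^] Suc k \<otimes> r" by (auto elim: dividesE)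
  have "\<not> a \<otimes> r divides \<one>" using a r(1) by (metis dividesI divides_trans)
  then obtain c where c: "c \<in> carrier R" "(\<one> \<ominus> a \<otimes> r) \<otimes> c = \<one>"
    using one_minus_divides_one[of "a \<otimes> r"] a r(1) by (auto elim!: dividesE)
  have "a [^] k \<otimes> (\<one> \<ominus> a \<otimes> r) = a [^] k \<ominus> a [^] Suc k \<otimes> r"
    using a r(1) by (simp add: r_distr r_minus minus_eq m_assoc)
  also have "\<dots> = a [^] k \<ominus> a [^] k" using r(2) by simp
  also have "\<dots> = \<zero>" using a by (simp add: minus_eq r_neg)
  finally have "a [^] k \<otimes> (\<one> \<ominus> a \<otimes> r) \<otimes> c = \<zero>" using c(1) by simp
  then have "a [^] k = \<zero>" using a r(1) c by (simp add: m_assoc)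
  then show ?thesis using a by (auto simp: nilpotents_def)
qed

lemma mult_power_sandwich:
  assumes "a \<in> carrier R" "b \<in> carrier R" "r \<in> carrier R" "a = b \<otimes> a \<otimes> r" "r \<in> nilpotents R"
  shows "a = \<zero>"
proof -
  have "a = b [^] k \<otimes> a \<otimes> r [^] k" for k :: nat
  proof (induction k)
    case (Suc k)
    have "b [^] Suc k \<otimes> a \<otimes> r [^] Suc k = b [^] k \<otimes> (b \<otimes> a \<otimes> r) \<otimes> r [^] k"
      unfolding nat_pow_Suc2[OF assms(3)] using assms(1-3) by (simp add: m_assoc)
    then show ?case using assms(4) Suc by simp
  qed (use assms in simp)
  moreover obtain k :: nat where "r [^] k = \<zero>" using assms(5) by (auto simp: nilpotents_def)
  ultimately show ?thesis using assms(1,2) by (metis m_closed nat_pow_closed r_null)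
qed

text \<open>Otherwise comparability gives a = b a r. A right invertible r would put b a into a A, so
  r is nilpotent, and a = b^k a r^k = 0.\<close>

lemma divides_left_multiple:
  assumes a: "a \<in> carrier R" and b: "b \<in> carrier R" shows "a divides b \<otimes> a"
proof (rule ccontr)
  assume no: "\<not> a divides b \<otimes> a"
  then have "b \<otimes> a divides a" using divides_total a b by blast
  then obtain r where r: "r \<in> carrier R" "a = b \<otimes> a \<otimes> r" by (elim dividesE)
  have "\<not> r divides \<one>"
  proof
    assume "r divides \<one>"
    then obtain c where c: "c \<in> carrier R" "\<one> = r \<otimes> c" by (elim dividesE)
    have "b \<otimes> a = b \<otimes> a \<otimes> r \<otimes> c" using c(1) c(2)[symmetric] a b r(1) by (simp add: m_assoc)
    also have "\<dots> = a \<otimes> c" using r(2) by simp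
    finally show False using no c(1) dividesI by blast
  qed
  then have "a = \<zero>" using mult_power_sandwich[OF a b r] nilpotent_if_not_divides_one r(1) by blast
  then show False using no b by simp
qed

sublocale duo_ring
  by unfold_locales (rule divides_left_multiple)

lemma unit_or_nilpotent: "a \<in> carrier R \<Longrightarrow> a \<notin> Units R \<Longrightarrow> a \<in> nilpotents R"
  using nilpotent_if_not_divides_one Units_iff_divides_one by blast

lemma nilpotents_prime:
  assumes "a \<in> carrier R" "b \<in> carrier R" "a \<otimes> b \<in> nilpotents R"
  shows "a \<in> nilpotents R \<or> b \<in> nilpotents R"
proof (rule ccontr)
  assume "\<not> ?thesis"
  then have "a \<otimes> b \<in> Units R" using unit_or_nilpotent assms by blast
  then have "\<one> \<in> nilpotents R"
    using right_idealD(4)[OF right_ideal_nilpotents assms(3), of "inv (a \<otimes> b)"] by simp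
  then show False using one_neq_zero by (auto simp: nilpotents_def)
qed

text \<open>If no element generates P, there is a strictly ascending chain of principal right
  ideals, about which a descending chain condition says nothing directly. Its cofactors produce a
  descending chain of left ideals, so this is where the left Artinian condition enters.\<close>

lemma nilpotents_principal:
  "\<exists>p\<in>carrier R. \<forall>a\<in>carrier R. a \<in> nilpotents R \<longleftrightarrow> p divides a"
proof -
  let ?N = "nilpotents R"
  note Nc = nilpotents_closed
  have "\<exists>p\<in>?N. \<forall>q\<in>?N. p divides q"
  proof (rule ccontr)
    assume "\<not> ?thesis"
    then have ex: "\<exists>q\<in>?N. \<not> p divides q" if "p \<in> ?N" for p using that by blast
    \<comment> \<open>Writing \<open>p\<^sub>n = p\<^sub>n\<^sub>+\<^sub>1 r\<^sub>n\<close> forever, the left ideals generated by \<open>r\<^sub>n \<cdots> r\<^sub>0\<close> descend strictly.\<close>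
    have step: "\<exists>q\<in>?N. \<exists>r\<in>?N. p = q \<otimes> r" if p: "p \<in> ?N" for p
    proof -
      from ex[OF p] obtain q where q: "q \<in> ?N" "\<not> p divides q" by blast
      then have "q divides p" using divides_total Nc p by blast
      then obtain r where r: "r \<in> carrier R" "p = q \<otimes> r" by (elim dividesE)
      have "r \<notin> Units R"
      proof
        assume u: "r \<in> Units R"
        have "q = p \<otimes> inv r" unfolding r(2) using u Nc[OF q(1)] r(1) by (simp add: m_assoc Units_r_inv)
        then show False using q(2) u by (metis Units_inv_closed dividesI)
      qed
      then show ?thesis using r q(1) unit_or_nilpotent by blast
    qed
    have "\<zero> [^] (1::nat) = \<zero>" by simp
    then have "\<zero> \<in> ?N" unfolding nilpotents_def by blast
    \<comment> \<open>The chain starts at a nonzero element, because the contradiction will be f_0 =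
      f_k s_k = 0.\<close>
    from ex[OF this] obtain p0 where p0: "p0 \<in> ?N" "p0 \<noteq> \<zero>" by auto
    have "\<exists>f. \<forall>n::nat. (f n \<in> ?N \<and> (n = 0 \<longrightarrow> f n \<noteq> \<zero>)) \<and> (\<exists>r\<in>?N. f n = f (Suc n) \<otimes> r)"
      using step p0 by (intro dependent_nat_choice) blast+
    then obtain f where f: "\<And>n::nat. f n \<in> ?N" "f 0 \<noteq> \<zero>" "\<And>n. \<exists>r\<in>?N. f n = f (Suc n) \<otimes> r" by blast
    then obtain r where r: "\<And>n. r n \<in> ?N" "\<And>n. f n = f (Suc n) \<otimes> r n" by metis
    define s where "s n = rec_nat \<one> (\<lambda>n x. r n \<otimes> x) n" for n
    have s: "s 0 = \<one>" "s (Suc n) = r n \<otimes> s n" for n by (simp_all add: s_def)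
    have sc: "s n \<in> carrier R" for n by (induction n) (auto simp: s Nc r)
    have fs: "f 0 = f n \<otimes> s n" for n
    proof (induction n)
      case (Suc n)
      then show ?case using r(2)[of n] Nc[OF f(1)] Nc[OF r(1)] sc by (simp add: s m_assoc)
    qed (use f Nc in \<open>simp add: s\<close>)
    have "\<exists>k. \<exists>c\<in>carrier R. s k = c \<otimes> s (Suc k)"
      using sc s(2) Nc[OF r(1)] by (intro left_descending) blast+
    then obtain k c where c: "c \<in> carrier R" "s k = c \<otimes> s (Suc k)" by blast
    \<comment> \<open>From s_k = c r_k s_k with c r_k nilpotent, the unit 1 - c r_k annihilates s_k,
      so s_k = 0.\<close>
    have "c \<otimes> r k \<in> ?N" using right_ideal_mult_left[OF right_ideal_nilpotents r(1) c(1)] .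
    then have u: "\<one> \<ominus> c \<otimes> r k \<in> Units R" by (rule one_minus_nilpotent_unit)
    have "(\<one> \<ominus> c \<otimes> r k) \<otimes> s k = s k \<ominus> c \<otimes> s (Suc k)"
      using c(1) Nc[OF r(1)] sc by (simp add: s l_distr l_minus minus_eq m_assoc)
    also have "\<dots> = s k \<ominus> s k" using c(2) by simp
    also have "\<dots> = \<zero>" using sc by (simp add: minus_eq r_neg)
    finally have "inv (\<one> \<ominus> c \<otimes> r k) \<otimes> ((\<one> \<ominus> c \<otimes> r k) \<otimes> s k) = \<zero>" using u by simp
    then have "s k = \<zero>" using u sc by (simp add: m_assoc[symmetric] Units_closed Units_l_inv)
    then show False using fs[of k] f(1,2) Nc by simp
  qed
  then obtain p where p: "p \<in> ?N" "\<forall>q\<in>?N. p divides q" by blast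
  then have "a \<in> ?N \<longleftrightarrow> p divides a" for a
    using right_ideal_divides[OF right_ideal_nilpotents p(1)] by blast
  then show ?thesis using Nc[OF p(1)] by blast
qed

end

section \<open>Direct sums of ideals modulo the nilpotent elements\<close>

context duo_ring
begin

lemma ideal_nilpotents: "ideal (nilpotents R) R"
  using right_ideal_nilpotents by (rule right_ideal_imp_ideal)

lemma nilpotents_coset_eq_zero_iff:
  assumes "a \<in> carrier R"
  shows "nilpotents R +> a = \<zero>\<^bsub>R Quot nilpotents R\<^esub> \<longleftrightarrow> a \<in> nilpotents R"
  using ideal.rcos_const_imp_mem[OF ideal_nilpotents assms] a_rcos_zero[OF ideal_nilpotents]
  by (auto simp: FactRing_def)

text \<open>Let I_n be the image of a_n A in A/P and K_n the image of the right annihilator of a_n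
  modulo P. K_n is an ideal containing all I_m with m \<noteq> n, hence also their sum, and I_n
  \<inter> K_n = 0 because a_n^2 c in P forces a_n c into P.\<close>

lemma infinite_direct_sum_if_orthogonal_sequence:
  assumes "has_orthogonal_sequence R"
  shows "contains_infinite_direct_sum_of_ideals (R Quot nilpotents R)"
proof -
  let ?N = "nilpotents R" and ?q = "(+>) (nilpotents R)"
  let ?Q = "R Quot ?N"
  note N = right_idealD[OF right_ideal_nilpotents]
  interpret N: ideal ?N R by (rule ideal_nilpotents)
  interpret Q: ring ?Q by (rule N.quotient_is_ring)
  from assms obtain a :: "nat \<Rightarrow> 'a" where
    a: "\<And>n. a n \<in> carrier R" "\<And>n. a n \<notin> ?N" "\<And>i j. i \<noteq> j \<Longrightarrow> a i \<otimes> a j \<in> ?N"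
    unfolding has_orthogonal_sequence_def by auto
  define I where "I n = ?q ` {r \<in> carrier R. a n divides r}" for n
  define K where "K n = ?q ` {b \<in> carrier R. a n \<otimes> b \<in> ?N}" for n
  have idI: "ideal (I n) ?Q" for n
    unfolding I_def using a
    by (intro ring_ideal_imp_quot_ideal ideal_nilpotents right_ideal_imp_ideal right_ideal_principal)
  have idK: "ideal (K n) ?Q" for n
    unfolding K_def
  proof (intro ring_ideal_imp_quot_ideal ideal_nilpotents right_ideal_imp_ideal right_idealI)
    show "\<zero> \<in> {b \<in> carrier R. a n \<otimes> b \<in> ?N}" using a N(2) by simp
    show "x \<oplus> y \<in> {b \<in> carrier R. a n \<otimes> b \<in> ?N}"
      if "x \<in> {b \<in> carrier R. a n \<otimes> b \<in> ?N}" "y \<in> {b \<in> carrier R. a n \<otimes> b \<in> ?N}" for x y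
      using that a(1) N(3) by (simp add: r_distr)
    show "x \<otimes> r \<in> {b \<in> carrier R. a n \<otimes> b \<in> ?N}"
      if "x \<in> {b \<in> carrier R. a n \<otimes> b \<in> ?N}" "r \<in> carrier R" for x r
      using that a(1) N(4) by (simp add: m_assoc[symmetric])
  qed auto
  have IK: "I m \<subseteq> K n" if "m \<noteq> n" for m n
    unfolding I_def K_def
  proof (rule image_mono, rule subsetI)
    fix r assume r: "r \<in> {r \<in> carrier R. a m divides r}"
    then obtain c where c: "c \<in> carrier R" "r = a m \<otimes> c" by (auto elim: dividesE)
    then have "a n \<otimes> r = a n \<otimes> a m \<otimes> c" using a(1) by (simp add: m_assoc)
    then show "r \<in> {b \<in> carrier R. a n \<otimes> b \<in> ?N}" using N(4)[OF a(3) c(1)] r that by auto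
  qed
  have IK0: "x = \<zero>\<^bsub>?Q\<^esub>" if "x \<in> I n" "x \<in> K n" for x n
  proof -
    from that obtain r b where r: "r \<in> carrier R" "a n divides r" "x = ?N +> r"
      and b: "b \<in> carrier R" "a n \<otimes> b \<in> ?N" "x = ?N +> b" unfolding I_def K_def by blast
    from r(2) obtain c where c: "c \<in> carrier R" "r = a n \<otimes> c" by (elim dividesE)
    have "r \<ominus> b \<in> ?N"
      using quotient_eq_iff_same_a_r_cos[OF ideal_nilpotents r(1) b(1)] r(3) b(3) by simp
    from N(3)[OF right_ideal_mult_left[OF right_ideal_nilpotents this a(1)] b(2)]
    have "a n \<otimes> (r \<ominus> b) \<oplus> a n \<otimes> b \<in> ?N" .
    also have "a n \<otimes> (r \<ominus> b) \<oplus> a n \<otimes> b = a n \<otimes> a n \<otimes> c"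
      unfolding c(2) using a(1) b(1) c(1) by (simp add: r_distr r_minus minus_eq a_assoc l_neg m_assoc)
    finally have "a n \<otimes> a n \<otimes> c \<in> ?N" .
    have "a n \<otimes> c \<in> Q" if Q: "completely_prime Q R" for Q
    proof -
      have rQ: "right_ideal Q R" using Q by (simp add: completely_prime_def)
      have "a n \<otimes> (a n \<otimes> c) \<in> Q"
        using \<open>a n \<otimes> a n \<otimes> c \<in> ?N\<close> Q a(1) c(1) by (simp add: nilpotents_iff m_assoc)
      then have "a n \<in> Q \<or> a n \<otimes> c \<in> Q" using Q a(1) c(1) by (simp add: completely_prime_def)
      then show ?thesis using right_idealD(4)[OF rQ] c(1) by blast
    qed
    then have "r \<in> ?N" unfolding c(2) nilpotents_iff using a(1) c(1) by simp
    then show ?thesis using nilpotents_coset_eq_zero_iff r by blast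
  qed
  have aI: "?N +> a n \<in> I n" for n using a(1) by (auto simp: I_def)
  have I0: "I n \<noteq> {\<zero>\<^bsub>?Q\<^esub>}" for n using aI[of n] nilpotents_coset_eq_zero_iff a by auto
  have inj: "inj I"
  proof (rule injI, rule ccontr)
    fix m n assume "I m = I n" "m \<noteq> n"
    then have "I n \<subseteq> K n" using IK by blast
    from IK0[OF aI subsetD[OF this aI]] have "a n \<in> ?N"
      using nilpotents_coset_eq_zero_iff[OF a(1)] by simp
    then show False using a(2) by simp
  qed
  have direct: "I n \<inter> Idl\<^bsub>?Q\<^esub> (\<Union>(range I - {I n})) = {\<zero>\<^bsub>?Q\<^esub>}" for n
  proof -
    have sub: "\<Union>(range I - {I n}) \<subseteq> K n"
    proof (rule Union_least)
      fix J assume "J \<in> range I - {I n}"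
      then obtain m where "J = I m" "m \<noteq> n" by auto
      then show "J \<subseteq> K n" using IK by simp
    qed
    then have "Idl\<^bsub>?Q\<^esub> (\<Union>(range I - {I n})) \<subseteq> K n" using idK by (intro Q.genideal_minimal)
    moreover have "\<Union>(range I - {I n}) \<subseteq> carrier ?Q"
      using ideal.Icarr[OF idK] by (intro subset_trans[OF sub] subsetI)
    then have "ideal (Idl\<^bsub>?Q\<^esub> (\<Union>(range I - {I n}))) ?Q" by (rule Q.genideal_ideal)
    then have "\<zero>\<^bsub>?Q\<^esub> \<in> Idl\<^bsub>?Q\<^esub> (\<Union>(range I - {I n}))" "\<zero>\<^bsub>?Q\<^esub> \<in> I n"
      using idI[of n] by (auto intro: additive_subgroup.zero_closed ideal.axioms(1))
    ultimately show ?thesis using IK0 by blast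
  qed
  show ?thesis unfolding contains_infinite_direct_sum_of_ideals_def
  proof (intro exI[of _ "range I"] conjI ballI)
    show "infinite (range I)" using inj infinite_UNIV_nat finite_imageD by blast
    fix J assume "J \<in> range I"
    then obtain n where J: "J = I n" by blast
    show "ideal J ?Q" "J \<noteq> {\<zero>\<^bsub>?Q\<^esub>}" "J \<inter> Idl\<^bsub>?Q\<^esub> (\<Union>(range I - {J})) = {\<zero>\<^bsub>?Q\<^esub>}"
      unfolding J by (rule idI, rule I0, rule direct)
  qed
qed

text \<open>By pigeonhole two ideals of the family contain classes of elements outside the same
  \<open>Q i\<close>; the product of these elements is nonzero modulo P and yet lies in both ideals.
  In the application \<open>Q i\<close> consists of the elements whose i-th component is
  nilpotent.\<close>

lemma no_infinite_direct_sum_if_finitely_many_primes: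
  assumes cover: "\<And>a. a \<in> carrier R \<Longrightarrow> a \<notin> nilpotents R \<Longrightarrow> \<exists>i<n. a \<notin> Q i"
    and prime: "\<And>i a b. i < (n::nat) \<Longrightarrow> a \<in> carrier R \<Longrightarrow> b \<in> carrier R \<Longrightarrow>
      a \<notin> Q i \<Longrightarrow> b \<notin> Q i \<Longrightarrow> a \<otimes> b \<notin> nilpotents R"
  shows "\<not> contains_infinite_direct_sum_of_ideals (R Quot nilpotents R)"
proof
  let ?N = "nilpotents R"
  let ?Q = "R Quot ?N"
  interpret N: ideal ?N R by (rule ideal_nilpotents)
  interpret Q: ring ?Q by (rule N.quotient_is_ring)
  assume "contains_infinite_direct_sum_of_ideals ?Q"
  then obtain \<F> where inf: "infinite \<F>"
    and \<F>: "\<forall>I\<in>\<F>. ideal I ?Q \<and> I \<noteq> {\<zero>\<^bsub>?Q\<^esub>}"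
    and dir: "\<forall>I\<in>\<F>. I \<inter> Idl\<^bsub>?Q\<^esub> (\<Union>(\<F> - {I})) = {\<zero>\<^bsub>?Q\<^esub>}"
    unfolding contains_infinite_direct_sum_of_ideals_def by (elim exE conjE)
  have id: "ideal I ?Q" and nz: "I \<noteq> {\<zero>\<^bsub>?Q\<^esub>}" if "I \<in> \<F>" for I
    using bspec[OF \<F> that] by (rule conjunct1, rule conjunct2)
  note direct = bspec[OF dir]
  have "\<exists>i a. i < n \<and> a \<in> carrier R \<and> ?N +> a \<in> I \<and> a \<notin> Q i" if I: "I \<in> \<F>" for I
  proof -
    interpret I: ideal I ?Q using id[OF I] .
    have "\<zero>\<^bsub>?Q\<^esub> \<in> I" by simp
    then obtain x where x: "x \<in> I" "x \<noteq> \<zero>\<^bsub>?Q\<^esub>" using nz[OF I] by blast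
    then have "x \<in> carrier ?Q" using I.Icarr by blast
    then obtain a where a: "a \<in> carrier R" "x = ?N +> a" unfolding FactRing_def A_RCOSETS_def' by auto
    then have "a \<notin> ?N" using x nilpotents_coset_eq_zero_iff by blast
    then show ?thesis using cover a x by blast
  qed
  then obtain i a where ia: "\<And>I. I \<in> \<F> \<Longrightarrow> i I < n" "\<And>I. I \<in> \<F> \<Longrightarrow> a I \<in> carrier R"
    "\<And>I. I \<in> \<F> \<Longrightarrow> ?N +> a I \<in> I" "\<And>I. I \<in> \<F> \<Longrightarrow> a I \<notin> Q (i I)" by metis
  have "i ` \<F> \<subseteq> {..<n}" using ia(1) by auto
  then have "\<not> inj_on i \<F>" using inf finite_imageD finite_subset by blast
  then obtain I J where IJ: "I \<in> \<F>" "J \<in> \<F>" "i I = i J" "I \<noteq> J" unfolding inj_on_def by blast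
  have "\<Union>(\<F> - {I}) \<subseteq> carrier ?Q"
  proof (rule Union_least)
    fix J assume "J \<in> \<F> - {I}"
    then have "ideal J ?Q" using id by simp
    then show "J \<subseteq> carrier ?Q" by (intro subsetI ideal.Icarr)
  qed
  then have "J \<subseteq> Idl\<^bsub>?Q\<^esub> (\<Union>(\<F> - {I}))" using Q.genideal_self IJ by blast
  moreover have prod: "(?N +> a I) \<otimes>\<^bsub>?Q\<^esub> (?N +> a J) = ?N +> (a I \<otimes> a J)"
    using N.rcoset_mult_add ia IJ by (simp add: FactRing_def)
  have "?N +> a I \<in> carrier ?Q" "?N +> a J \<in> carrier ?Q"
    using ideal.Icarr[OF id ia(3)] IJ by simp_all
  then have "?N +> (a I \<otimes> a J) \<in> I" "?N +> (a I \<otimes> a J) \<in> J"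
    unfolding prod[symmetric]
    using ideal.I_r_closed[OF id ia(3)] ideal.I_l_closed[OF id ia(3)] IJ(1,2) by simp_all
  ultimately have "?N +> (a I \<otimes> a J) = \<zero>\<^bsub>?Q\<^esub>" using direct[OF IJ(1)] by blast
  then have "a I \<otimes> a J \<in> ?N" using nilpotents_coset_eq_zero_iff ia IJ by simp
  moreover have "a I \<notin> Q (i I)" using ia(4)[OF IJ(1)] .
  moreover have "a J \<notin> Q (i I)" using ia(4)[OF IJ(2)] unfolding IJ(3) .
  ultimately show False using prime[of "i I" "a I" "a J"] ia IJ by blast
qed

end

section \<open>Finite products\<close>

text \<open>Properties chosen so that their consequences for a finite product can be verified
  coordinatewise. The nilpotent elements are required to form a principal right ideal, because a
  generator for the product can then be assembled from those of the factors.\<close>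

definition good_factor :: "('a, 'm) ring_scheme \<Rightarrow> bool" where
  "good_factor R \<longleftrightarrow> distributive_duo_ring R \<and> centrally_essential R \<and>
     (\<exists>p\<in>carrier R. \<forall>a\<in>carrier R. a \<in> nilpotents R \<longleftrightarrow> p divides\<^bsub>R\<^esub> a) \<and>
     (\<forall>a\<in>carrier R. \<forall>b\<in>carrier R. a \<otimes>\<^bsub>R\<^esub> b \<in> nilpotents R \<longrightarrow> a \<in> nilpotents R \<or> b \<in> nilpotents R)"

text \<open>Since a and b are comparable, t = 0 or t = 1 solves the distributivity
  condition.\<close>

lemma good_factor_artinian_uniserial:
  fixes R (structure)
  assumes "ring R" "\<one> \<noteq> \<zero>" "artinian R" "uniserial R" "centrally_essential R"
  shows "good_factor R"
proof -
  interpret artinian_uniserial_ring R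
    using assms by (intro artinian_uniserial_ring.intro artinian_uniserial_ring_axioms.intro)
  have "\<exists>t\<in>carrier R. b divides a \<otimes> t \<and> a divides b \<otimes> (\<one> \<ominus> t)"
    if ab: "a \<in> carrier R" "b \<in> carrier R" for a b
    using divides_total[OF ab]
  proof
    assume "a divides b"
    then show ?thesis using ab by (intro bexI[of _ \<zero>]) (auto simp: minus_eq)
  next
    assume "b divides a"
    then show ?thesis using ab by (intro bexI[of _ \<one>]) (auto simp: minus_eq r_neg)
  qed
  then have "distributive_duo_ring R"
    using duo_ring_axioms by (intro distributive_duo_ring.intro distributive_duo_ring_axioms.intro)
  then show ?thesis
    unfolding good_factor_def using assms(5) nilpotents_principal nilpotents_prime by blast
qed

lemma good_factor_pruefer:
  fixes R (structure)
  assumes "pruefer_domain R"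
  shows "good_factor R"
proof -
  interpret "domain" R using assms by (simp add: pruefer_domain_def)
  have "a divides b \<otimes> a" if "a \<in> carrier R" "b \<in> carrier R" for a b
    using that by (intro dividesI[of b]) (auto simp: m_comm)
  then have "distributive_duo_ring R"
    using pruefer_domain_distributive[OF assms] ring_axioms
    by (intro distributive_duo_ring.intro distributive_duo_ring_axioms.intro duo_ring.intro duo_ring_axioms.intro)
  moreover have "centrally_essential R" using is_cring by (simp add: centrally_essential_def)
  moreover have pow0: "a = \<zero>" if "a \<in> carrier R" "a [^] (n::nat) = \<zero>" for a n
    using that(2) by (induction n) (auto simp: integral_iff that(1))
  have nil: "a \<in> nilpotents R \<longleftrightarrow> a = \<zero>" for a
  proof
    have "\<zero> [^] (1::nat) = \<zero>" by simp
    then show "a = \<zero> \<Longrightarrow> a \<in> nilpotents R" unfolding nilpotents_def by blast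
  qed (auto simp: nilpotents_def pow0)
  moreover have "a \<in> nilpotents R \<longleftrightarrow> \<zero> divides a" if "a \<in> carrier R" for a
    using that by (auto simp: nil elim!: dividesE)
  moreover have "a \<in> nilpotents R \<or> b \<in> nilpotents R"
    if "a \<in> carrier R" "b \<in> carrier R" "a \<otimes> b \<in> nilpotents R" for a b
    using that by (simp add: nil integral_iff)
  ultimately show ?thesis unfolding good_factor_def using zero_closed by metis
qed

lemma nat_pow_eq_zero_mono:
  assumes "ring R" "a \<in> carrier R" "a [^]\<^bsub>R\<^esub> (k::nat) = \<zero>\<^bsub>R\<^esub>" "k \<le> m"
  shows "a [^]\<^bsub>R\<^esub> m = \<zero>\<^bsub>R\<^esub>"
proof -
  interpret ring R by fact
  have "a [^]\<^bsub>R\<^esub> m = a [^]\<^bsub>R\<^esub> k \<otimes>\<^bsub>R\<^esub> a [^]\<^bsub>R\<^esub> (m - k)"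
    using nat_pow_mult[OF assms(2), of k "m - k"] assms(4) by simp
  then show ?thesis using assms(2,3) by simp
qed

text \<open>A finite product seen through its projections: \<open>surj\<close> and
  \<open>inj\<close> say that each family of components belongs to exactly one element. Lists enter
  only when the locale is instantiated.\<close>

locale finite_ring_product = ring A for A :: "('a, 'm) ring_scheme" (structure) +
  fixes n :: nat and F :: "nat \<Rightarrow> ('b, 'k) ring_scheme" and \<pi> :: "nat \<Rightarrow> 'a \<Rightarrow> 'b"
  assumes rings: "i < n \<Longrightarrow> ring (F i)"
    and hom: "i < n \<Longrightarrow> \<pi> i \<in> ring_hom A (F i)"
    and surj: "(\<And>i. i < n \<Longrightarrow> f i \<in> carrier (F i)) \<Longrightarrow> \<exists>a\<in>carrier A. \<forall>i<n. \<pi> i a = f i"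
    and inj: "a \<in> carrier A \<Longrightarrow> b \<in> carrier A \<Longrightarrow> (\<And>i. i < n \<Longrightarrow> \<pi> i a = \<pi> i b) \<Longrightarrow> a = b"
begin

lemma hom_ring: "i < n \<Longrightarrow> ring_hom_ring A (F i) (\<pi> i)"
  using ring_axioms rings hom by (intro ring_hom_ringI2)

lemma proj_closed: "i < n \<Longrightarrow> a \<in> carrier A \<Longrightarrow> \<pi> i a \<in> carrier (F i)"
  by (rule ring_hom_memE(1)[OF hom])

lemma proj_mult: "i < n \<Longrightarrow> a \<in> carrier A \<Longrightarrow> b \<in> carrier A \<Longrightarrow> \<pi> i (a \<otimes> b) = \<pi> i a \<otimes>\<^bsub>F i\<^esub> \<pi> i b"
  by (rule ring_hom_memE(2)[OF hom])

lemma proj_zero: "i < n \<Longrightarrow> \<pi> i \<zero> = \<zero>\<^bsub>F i\<^esub>"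
  using ring_hom_zero[OF hom ring_axioms rings] .

lemma proj_one_minus:
  assumes "i < n" "a \<in> carrier A" shows "\<pi> i (\<one> \<ominus> a) = \<one>\<^bsub>F i\<^esub> \<ominus>\<^bsub>F i\<^esub> \<pi> i a"
proof -
  note A_minus_eq = minus_eq
  interpret ring_hom_ring A "F i" "\<pi> i" using hom_ring[OF assms(1)] .
  show ?thesis using assms(2) by (simp add: A_minus_eq S.minus_eq)
qed

lemma proj_pow:
  assumes "i < n" "a \<in> carrier A" shows "\<pi> i (a [^] (k::nat)) = \<pi> i a [^]\<^bsub>F i\<^esub> k"
  using ring_hom_ring.hom_nat_pow[OF hom_ring[OF assms(1)] assms(2)] .

lemma divides_iff:
  assumes a: "a \<in> carrier A" and b: "b \<in> carrier A"
  shows "a divides b \<longleftrightarrow> (\<forall>i<n. \<pi> i a divides\<^bsub>F i\<^esub> \<pi> i b)"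
proof
  assume "a divides b"
  then obtain c where "c \<in> carrier A" "b = a \<otimes> c" by (elim dividesE)
  then show "\<forall>i<n. \<pi> i a divides\<^bsub>F i\<^esub> \<pi> i b"
    using a proj_closed proj_mult by (auto intro!: dividesI)
next
  assume "\<forall>i<n. \<pi> i a divides\<^bsub>F i\<^esub> \<pi> i b"
  then have "\<forall>i. i < n \<longrightarrow> (\<exists>c. c \<in> carrier (F i) \<and> \<pi> i b = \<pi> i a \<otimes>\<^bsub>F i\<^esub> c)"
    by (auto elim!: dividesE)
  then obtain c where c: "\<And>i. i < n \<Longrightarrow> c i \<in> carrier (F i)"
    "\<And>i. i < n \<Longrightarrow> \<pi> i b = \<pi> i a \<otimes>\<^bsub>F i\<^esub> c i" by metis
  from surj[of c, OF c(1)] obtain d where d: "d \<in> carrier A" "\<forall>i<n. \<pi> i d = c i" by blast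
  have "b = a \<otimes> d" using a b d c(2) proj_mult by (intro inj) auto
  then show "a divides b" using d(1) by (intro dividesI)
qed

lemma centerI:
  assumes x: "x \<in> carrier A" and c: "\<And>i. i < n \<Longrightarrow> \<pi> i x \<in> ring_center (F i)"
  shows "x \<in> ring_center A"
proof -
  have "x \<otimes> a = a \<otimes> x" if a: "a \<in> carrier A" for a
  proof (rule inj)
    fix i assume i: "i < n"
    have "\<pi> i x \<otimes>\<^bsub>F i\<^esub> \<pi> i a = \<pi> i a \<otimes>\<^bsub>F i\<^esub> \<pi> i x"
      using ring.ring_centerD[OF rings[OF i] c[OF i] proj_closed[OF i a]] .
    then show "\<pi> i (x \<otimes> a) = \<pi> i (a \<otimes> x)" using proj_mult i x a by simp
  qed (use x a in auto)
  then show ?thesis using x unfolding ring_center_def by blast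
qed

lemma nilpotents_proj_iff:
  assumes a: "a \<in> carrier A"
  shows "a \<in> nilpotents A \<longleftrightarrow> (\<forall>i<n. \<pi> i a \<in> nilpotents (F i))"
proof
  assume "a \<in> nilpotents A"
  then obtain k :: nat where "a [^] k = \<zero>" by (auto simp: nilpotents_def)
  then have "\<pi> i a [^]\<^bsub>F i\<^esub> k = \<zero>\<^bsub>F i\<^esub>" if "i < n" for i
    using proj_pow[OF that a] proj_zero[OF that] by metis
  then show "\<forall>i<n. \<pi> i a \<in> nilpotents (F i)"
    using proj_closed a by (auto simp: nilpotents_def)
next
  assume "\<forall>i<n. \<pi> i a \<in> nilpotents (F i)"
  then have "\<forall>i. i < n \<longrightarrow> (\<exists>k::nat. \<pi> i a [^]\<^bsub>F i\<^esub> k = \<zero>\<^bsub>F i\<^esub>)" by (auto simp: nilpotents_def)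
  then obtain k :: "nat \<Rightarrow> nat" where k: "\<And>i. i < n \<Longrightarrow> \<pi> i a [^]\<^bsub>F i\<^esub> k i = \<zero>\<^bsub>F i\<^esub>" by metis
  \<comment> \<open>A common exponent for all factors: the sum dominates each k i.\<close>
  have "a [^] (\<Sum>i<n. k i) = \<zero>"
  proof (rule inj)
    fix i assume i: "i < n"
    then have "k i \<le> (\<Sum>i<n. k i)" by (intro member_le_sum) auto
    then show "\<pi> i (a [^] (\<Sum>i<n. k i)) = \<pi> i \<zero>"
      using nat_pow_eq_zero_mono[OF rings[OF i] proj_closed[OF i a] k[OF i]] proj_pow[OF i a]
        proj_zero[OF i] by simp
  qed (use a in auto)
  then show "a \<in> nilpotents A" using a by (auto simp: nilpotents_def)
qed

lemma conditions_of_good_factors: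
  assumes good: "\<And>i. i < n \<Longrightarrow> good_factor (F i)"
  shows "distributive_duo_ring A"
    and "centrally_essential A"
    and "fin_gen_right_ideal A (nilpotents A)"
    and "\<not> contains_infinite_direct_sum_of_ideals (A Quot nilpotents A)"
proof -
  have Fi: "distributive_duo_ring (F i)" if "i < n" for i using good[OF that] by (simp add: good_factor_def)
  have duo: "a divides b \<otimes> a" if "a \<in> carrier A" "b \<in> carrier A" for a b
    unfolding divides_iff[OF that(1) m_closed[OF that(2,1)]]
    using that proj_mult proj_closed Fi
    by (simp add: duo_ring.duo distributive_duo_ring.axioms(1))
  have "\<exists>t\<in>carrier A. b divides a \<otimes> t \<and> a divides b \<otimes> (\<one> \<ominus> t)"
    if ab: "a \<in> carrier A" "b \<in> carrier A" for a b
  proof -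
    have "\<forall>i. i < n \<longrightarrow> (\<exists>t. t \<in> carrier (F i) \<and> \<pi> i b divides\<^bsub>F i\<^esub> \<pi> i a \<otimes>\<^bsub>F i\<^esub> t
        \<and> \<pi> i a divides\<^bsub>F i\<^esub> \<pi> i b \<otimes>\<^bsub>F i\<^esub> (\<one>\<^bsub>F i\<^esub> \<ominus>\<^bsub>F i\<^esub> t))"
      using distributive_duo_ring.dist[OF Fi] proj_closed ab by blast
    then obtain t where t: "\<And>i. i < n \<Longrightarrow> t i \<in> carrier (F i)"
      "\<And>i. i < n \<Longrightarrow> \<pi> i b divides\<^bsub>F i\<^esub> \<pi> i a \<otimes>\<^bsub>F i\<^esub> t i"
      "\<And>i. i < n \<Longrightarrow> \<pi> i a divides\<^bsub>F i\<^esub> \<pi> i b \<otimes>\<^bsub>F i\<^esub> (\<one>\<^bsub>F i\<^esub> \<ominus>\<^bsub>F i\<^esub> t i)" by metis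
    from surj[of t, OF t(1)] obtain u where u: "u \<in> carrier A" "\<forall>i<n. \<pi> i u = t i" by blast
    have "b divides a \<otimes> u" "a divides b \<otimes> (\<one> \<ominus> u)"
      using ab u t(2,3) by (simp_all add: divides_iff proj_mult proj_one_minus)
    then show ?thesis using u(1) by blast
  qed
  then show D: "distributive_duo_ring A"
    using duo ring_axioms
    by (intro distributive_duo_ring.intro distributive_duo_ring_axioms.intro duo_ring.intro duo_ring_axioms.intro)
  interpret D: distributive_duo_ring A by (rule D)
  have "\<exists>x\<in>ring_center A. a \<otimes> x \<in> ring_center A \<and> a \<otimes> x \<noteq> \<zero>" if a: "a \<in> carrier A" "a \<noteq> \<zero>" for a
  proof -
    obtain i where i: "i < n" "\<pi> i a \<noteq> \<zero>\<^bsub>F i\<^esub>" using inj[OF a(1) zero_closed] a(2) proj_zero by auto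
    interpret Fi: ring "F i" using rings[OF i(1)] .
    obtain y where y: "y \<in> ring_center (F i)" "\<pi> i a \<otimes>\<^bsub>F i\<^esub> y \<in> ring_center (F i)"
      "\<pi> i a \<otimes>\<^bsub>F i\<^esub> y \<noteq> \<zero>\<^bsub>F i\<^esub>"
      using good[OF i(1)] Fi.central_multiple[OF _ proj_closed[OF i(1) a(1)] i(2)]
      unfolding good_factor_def by blast
    \<comment> \<open>The multiplier is y in one coordinate i where a does not vanish and 0 in all
      others, so that a x is central and nonzero whatever the other coordinates of a are.\<close>
    let ?f = "\<lambda>j. if j = i then y else \<zero>\<^bsub>F j\<^esub>"
    have zc: "\<zero>\<^bsub>F j\<^esub> \<in> ring_center (F j)" "\<zero>\<^bsub>F j\<^esub> \<in> carrier (F j)" if "j < n" for j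
    proof -
      interpret Fj: ring "F j" using rings[OF that] .
      show "\<zero>\<^bsub>F j\<^esub> \<in> ring_center (F j)" "\<zero>\<^bsub>F j\<^esub> \<in> carrier (F j)" by (auto simp: ring_center_def)
    qed
    have "?f j \<in> carrier (F j)" if "j < n" for j
      using Fi.ring_center_closed[OF y(1)] zc[OF that] by simp
    from surj[of ?f, OF this] obtain x where x: "x \<in> carrier A" "\<forall>j<n. \<pi> j x = ?f j" by blast
    have x_c: "x \<in> ring_center A" using x y zc by (intro centerI) auto
    have ax: "\<pi> j (a \<otimes> x) = (if j = i then \<pi> i a \<otimes>\<^bsub>F i\<^esub> y else \<zero>\<^bsub>F j\<^esub>)" if j: "j < n" for j
    proof -
      interpret Fj: ring "F j" using rings[OF j] .
      show ?thesis using x j a(1) proj_mult[OF j a(1) x(1)] proj_closed[OF j a(1)] by simp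
    qed
    have "a \<otimes> x \<in> ring_center A" using ax y(2) zc x(1) a(1) by (intro centerI) auto
    moreover have "a \<otimes> x \<noteq> \<zero>"
    proof
      assume "a \<otimes> x = \<zero>"
      then have "\<pi> i a \<otimes>\<^bsub>F i\<^esub> y = \<pi> i \<zero>" using ax[OF i(1)] by simp
      then show False using y(3) proj_zero[OF i(1)] by simp
    qed
    ultimately show ?thesis using x_c by blast
  qed
  then show "centrally_essential A" by (simp add: centrally_essential_iff)
  show "fin_gen_right_ideal A (nilpotents A)"
  proof -
    have "\<forall>i. i < n \<longrightarrow> (\<exists>p. p \<in> carrier (F i) \<and>
        (\<forall>a\<in>carrier (F i). a \<in> nilpotents (F i) \<longleftrightarrow> p divides\<^bsub>F i\<^esub> a))"
      using good unfolding good_factor_def by blast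
    then obtain p where p: "\<And>i. i < n \<Longrightarrow> p i \<in> carrier (F i)"
      "\<And>i a. i < n \<Longrightarrow> a \<in> carrier (F i) \<Longrightarrow> a \<in> nilpotents (F i) \<longleftrightarrow> p i divides\<^bsub>F i\<^esub> a" by metis
    from surj[of p, OF p(1)] obtain q where q: "q \<in> carrier A" "\<forall>i<n. \<pi> i q = p i" by blast
    have N: "a \<in> nilpotents A \<longleftrightarrow> a \<in> carrier A \<and> q divides a" for a
    proof (cases "a \<in> carrier A")
      case True
      then show ?thesis using q p(2) proj_closed by (simp add: nilpotents_proj_iff divides_iff)
    qed (simp add: nilpotents_def)
    have "q \<in> nilpotents A" using q(1) N by simp
    then have "nilpotents A = \<Inter>{J. right_ideal J A \<and> {q} \<subseteq> J}"
      using D.right_ideal_nilpotents N right_ideal_divides by (intro equalityI) blast+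
    then show ?thesis unfolding fin_gen_right_ideal_def using q(1) by (intro exI[of _ "{q}"]) simp
  qed
  show "\<not> contains_infinite_direct_sum_of_ideals (A Quot nilpotents A)"
  proof (rule D.no_infinite_direct_sum_if_finitely_many_primes)
    show "\<exists>i<n. a \<notin> {a. \<pi> i a \<in> nilpotents (F i)}" if "a \<in> carrier A" "a \<notin> nilpotents A" for a
      using that nilpotents_proj_iff by auto
    show "a \<otimes> b \<notin> nilpotents A" if "i < n" "a \<in> carrier A" "b \<in> carrier A"
      "a \<notin> {a. \<pi> i a \<in> nilpotents (F i)}" "b \<notin> {a. \<pi> i a \<in> nilpotents (F i)}" for i a b
    proof
      assume "a \<otimes> b \<in> nilpotents A"
      then have "\<pi> i a \<otimes>\<^bsub>F i\<^esub> \<pi> i b \<in> nilpotents (F i)"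
        using that(1-3) nilpotents_proj_iff proj_mult by auto
      moreover have "\<forall>a\<in>carrier (F i). \<forall>b\<in>carrier (F i). a \<otimes>\<^bsub>F i\<^esub> b \<in> nilpotents (F i) \<longrightarrow>
          a \<in> nilpotents (F i) \<or> b \<in> nilpotents (F i)"
        using good[OF that(1)] unfolding good_factor_def by (elim conjE)
      ultimately show False using that(4,5) proj_closed[OF that(1,2)] proj_closed[OF that(1,3)] by blast
    qed
  qed
qed

end

lemma RDirProd_list_nth:
  assumes "xs \<in> carrier (RDirProd_list Rs)" "ys \<in> carrier (RDirProd_list Rs)" "i < length Rs"
  shows "(xs \<otimes>\<^bsub>RDirProd_list Rs\<^esub> ys) ! i = xs ! i \<otimes>\<^bsub>Rs ! i\<^esub> ys ! i"
    and "(xs \<oplus>\<^bsub>RDirProd_list Rs\<^esub> ys) ! i = xs ! i \<oplus>\<^bsub>Rs ! i\<^esub> ys ! i"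
proof -
  have "(xs \<otimes>\<^bsub>RDirProd_list Rs\<^esub> ys) ! i = xs ! i \<otimes>\<^bsub>Rs ! i\<^esub> ys ! i \<and>
      (xs \<oplus>\<^bsub>RDirProd_list Rs\<^esub> ys) ! i = xs ! i \<oplus>\<^bsub>Rs ! i\<^esub> ys ! i"
    using assms
  proof (induction Rs arbitrary: xs ys i)
    case (Cons R Rs)
    from Cons.prems obtain x xs' y ys' where x: "xs = x # xs'" "x \<in> carrier R" "xs' \<in> carrier (RDirProd_list Rs)"
      and y: "ys = y # ys'" "y \<in> carrier R" "ys' \<in> carrier (RDirProd_list Rs)"
      unfolding RDirProd_list_carrier by auto
    have c: "(x, xs') \<in> carrier (RDirProd R (RDirProd_list Rs))" "(y, ys') \<in> carrier (RDirProd R (RDirProd_list Rs))"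
      using x y by (auto simp: RDirProd_carrier)
    have m: "(x, xs') \<otimes>\<^bsub>RDirProd R (RDirProd_list Rs)\<^esub> (y, ys') = (x \<otimes>\<^bsub>R\<^esub> y, xs' \<otimes>\<^bsub>RDirProd_list Rs\<^esub> ys')"
      "(x, xs') \<oplus>\<^bsub>RDirProd R (RDirProd_list Rs)\<^esub> (y, ys') = (x \<oplus>\<^bsub>R\<^esub> y, xs' \<oplus>\<^bsub>RDirProd_list Rs\<^esub> ys')"
      by (simp_all add: RDirProd_def DirProd_def monoid.defs)
    have "xs \<otimes>\<^bsub>RDirProd_list (R # Rs)\<^esub> ys = (x \<otimes>\<^bsub>R\<^esub> y) # (xs' \<otimes>\<^bsub>RDirProd_list Rs\<^esub> ys')"
      "xs \<oplus>\<^bsub>RDirProd_list (R # Rs)\<^esub> ys = (x \<oplus>\<^bsub>R\<^esub> y) # (xs' \<oplus>\<^bsub>RDirProd_list Rs\<^esub> ys')"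
      using ring_hom_mult[OF RDirProd_list_hom1 c] ring_hom_add[OF RDirProd_list_hom1 c]
      unfolding m by (simp_all add: x(1) y(1))
    then show ?case using Cons.IH[OF x(3) y(3)] Cons.prems(3) x(1) y(1) by (cases i) auto
  qed simp
  then show "(xs \<otimes>\<^bsub>RDirProd_list Rs\<^esub> ys) ! i = xs ! i \<otimes>\<^bsub>Rs ! i\<^esub> ys ! i"
    "(xs \<oplus>\<^bsub>RDirProd_list Rs\<^esub> ys) ! i = xs ! i \<oplus>\<^bsub>Rs ! i\<^esub> ys ! i" by auto
qed

lemma RDirProd_list_one_nth: "i < length Rs \<Longrightarrow> \<one>\<^bsub>RDirProd_list Rs\<^esub> ! i = \<one>\<^bsub>Rs ! i\<^esub>"
  unfolding RDirProd_list_one by (induction Rs arbitrary: i) (auto simp: nth_Cons split: nat.splits)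

lemma finite_ring_product_of_iso:
  assumes A: "ring A" and h: "h \<in> ring_iso A (RDirProd_list Rs)"
    and Rs: "\<And>R. R \<in> set Rs \<Longrightarrow> ring R"
  shows "finite_ring_product A (length Rs) (\<lambda>i. Rs ! i) (\<lambda>i a. h a ! i)"
proof -
  interpret ring A by (rule A)
  note h = ring_iso_memE[OF h]
  have len: "length (h a) = length Rs" if "a \<in> carrier A" for a
    using RDirProd_list_carrier_mem(1)[OF h(1)[OF that]] .
  show ?thesis
  proof (intro finite_ring_product.intro finite_ring_product_axioms.intro A)
    fix i assume i: "i < length Rs"
    show "ring (Rs ! i)" using Rs i by simp
    show "(\<lambda>a. h a ! i) \<in> ring_hom A (Rs ! i)"
      using RDirProd_list_carrier_mem(2)[OF h(1) i] RDirProd_list_nth[OF h(1) h(1) i]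
        RDirProd_list_one_nth[OF i]
      by (intro ring_hom_memI) (simp_all add: h(2,3,4))
  next
    fix f assume "\<And>i. i < length Rs \<Longrightarrow> f i \<in> carrier (Rs ! i)"
    then have "map f [0..<length Rs] \<in> carrier (RDirProd_list Rs)"
      by (intro RDirProd_list_carrier_memI) auto
    then obtain a where "a \<in> carrier A" "h a = map f [0..<length Rs]"
      using h(5) by (metis bij_betw_imp_surj_on imageE)
    then show "\<exists>a\<in>carrier A. \<forall>i<length Rs. h a ! i = f i" by (intro bexI[of _ a]) auto
  next
    fix a b assume ab: "a \<in> carrier A" "b \<in> carrier A" "\<And>i. i < length Rs \<Longrightarrow> h a ! i = h b ! i"
    then have "h a = h b" using len by (intro nth_equalityI) auto
    then show "a = b" using h(5) ab by (auto simp: bij_betw_def inj_on_def)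
  qed
qed

section \<open>Corners and decomposition into indecomposable factors\<close>

text \<open>For an idempotent e, which is central in a right invariant ring, this is the ring e R
  with identity e. Operations and element type are those of R, so computations in the corner are
  computations in R.\<close>

definition corner :: "('a, 'm) ring_scheme \<Rightarrow> 'a \<Rightarrow> 'a ring" where
  "corner R e = \<lparr>carrier = {x \<in> carrier R. e \<otimes>\<^bsub>R\<^esub> x = x}, monoid.mult = monoid.mult R, one = e,
     zero = zero R, add = add R\<rparr>"

lemma corner_simps [simp]:
  "carrier (corner R e) = {x \<in> carrier R. e \<otimes>\<^bsub>R\<^esub> x = x}"
  "monoid.mult (corner R e) = monoid.mult R" "one (corner R e) = e"
  "zero (corner R e) = zero R" "add (corner R e) = add R"
  by (simp_all add: corner_def)

context duo_ring
begin

lemma idempotent_commutes: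
  "e \<in> carrier R \<Longrightarrow> e \<otimes> e = e \<Longrightarrow> a \<in> carrier R \<Longrightarrow> a \<otimes> e = e \<otimes> a"
  using ring_centerD[OF idempotent_central] by metis

lemma idempotent_lcomm:
  "e \<in> carrier R \<Longrightarrow> e \<otimes> e = e \<Longrightarrow> a \<in> carrier R \<Longrightarrow> b \<in> carrier R \<Longrightarrow>
    a \<otimes> (e \<otimes> b) = e \<otimes> (a \<otimes> b)"
  by (metis m_assoc idempotent_commutes)

lemma idempotent_absorb:
  "e \<in> carrier R \<Longrightarrow> e \<otimes> e = e \<Longrightarrow> a \<in> carrier R \<Longrightarrow> e \<otimes> (e \<otimes> a) = e \<otimes> a"
  by (simp add: m_assoc[symmetric])

context
  fixes e assumes e: "e \<in> carrier R" "e \<otimes> e = e"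
begin

lemma ring_corner: "ring (corner R e)"
proof (rule ringI)
  show "abelian_group (corner R e)"
  proof (rule abelian_groupI)
    fix x assume "x \<in> carrier (corner R e)"
    then show "\<exists>y\<in>carrier (corner R e). y \<oplus>\<^bsub>corner R e\<^esub> x = \<zero>\<^bsub>corner R e\<^esub>"
      using e by (intro bexI[of _ "\<ominus> x"]) (auto simp: l_neg r_minus)
  qed (use e in \<open>auto simp: r_distr a_ac\<close>)
  show "monoid (corner R e)"
  proof (rule monoidI)
    fix x y assume xy: "x \<in> carrier (corner R e)" "y \<in> carrier (corner R e)"
    then have "e \<otimes> (x \<otimes> y) = e \<otimes> x \<otimes> y" using e by (intro m_assoc[symmetric]) auto
    then show "x \<otimes>\<^bsub>corner R e\<^esub> y \<in> carrier (corner R e)" using xy by simp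
    show "x \<otimes>\<^bsub>corner R e\<^esub> \<one>\<^bsub>corner R e\<^esub> = x" using xy idempotent_commutes[OF e, of x] by simp
  qed (use e in \<open>auto simp: m_assoc\<close>)
qed (auto simp: l_distr r_distr)

lemma corner_minus:
  assumes "x \<in> carrier (corner R e)" "y \<in> carrier (corner R e)"
  shows "x \<ominus>\<^bsub>corner R e\<^esub> y = x \<ominus> y"
proof -
  interpret C: ring "corner R e" by (rule ring_corner)
  have y: "y \<in> carrier R" "e \<otimes> y = y" using assms by auto
  have "\<ominus> y \<oplus>\<^bsub>corner R e\<^esub> y = \<zero>\<^bsub>corner R e\<^esub>" using y by (simp add: l_neg)
  moreover have "\<ominus> y \<in> carrier (corner R e)" using y e by (simp add: r_minus)
  ultimately have "\<ominus>\<^bsub>corner R e\<^esub> y = \<ominus> y" using C.minus_equality assms(2) by blast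
  then show ?thesis by (simp add: C.minus_eq minus_eq)
qed

lemma corner_divides:
  assumes "a \<in> carrier (corner R e)" "b \<in> carrier (corner R e)" "a divides b"
  shows "a divides\<^bsub>corner R e\<^esub> b"
proof -
  from assms(3) obtain c where c: "c \<in> carrier R" "b = a \<otimes> c" by (elim dividesE)
  have ab: "a \<in> carrier R" "e \<otimes> a = a" "e \<otimes> b = b" using assms by auto
  have "a \<otimes> (e \<otimes> c) = e \<otimes> b" unfolding c(2) by (rule idempotent_lcomm[OF e ab(1) c(1)])
  then have "b = a \<otimes> (e \<otimes> c)" using ab by simp
  then show ?thesis using e c(1) by (intro dividesI[of "e \<otimes> c"]) (auto simp: idempotent_absorb)
qed

lemma nilpotents_corner: "nilpotents (corner R e) = nilpotents R \<inter> carrier (corner R e)"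
proof -
  have "a \<in> nilpotents (corner R e) \<longleftrightarrow> a \<in> nilpotents R" if a: "a \<in> carrier (corner R e)" for a
  proof -
    have ac: "a \<in> carrier R" "e \<otimes> a = a" using a by auto
    interpret C: ring "corner R e" by (rule ring_corner)
    \<comment> \<open>The zeroth power in the corner is e, whence the factor e. Multiplication by a
      absorbs it, at the cost of one more power of a.\<close>
    have pow: "a [^]\<^bsub>corner R e\<^esub> n = e \<otimes> a [^] n" for n :: nat
      by (induction n) (use e ac in \<open>auto simp: m_assoc\<close>)
    have suc: "a [^] Suc n = a \<otimes> (e \<otimes> a [^] n)" for n
    proof -
      have "a [^] Suc n = (a \<otimes> e) \<otimes> a [^] n"
        unfolding nat_pow_Suc2[OF ac(1)] idempotent_commutes[OF e ac(1)] ac(2) ..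
      then show ?thesis using ac e by (simp add: m_assoc)
    qed
    show ?thesis
    proof
      assume "a \<in> nilpotents (corner R e)"
      then obtain n :: nat where "e \<otimes> a [^] n = \<zero>" by (auto simp: nilpotents_def pow)
      then have "a [^] Suc n = \<zero>" using suc[of n] ac(1) by simp
      then show "a \<in> nilpotents R" using ac(1) unfolding nilpotents_def by blast
    next
      assume "a \<in> nilpotents R"
      then obtain n :: nat where "a [^] n = \<zero>" by (auto simp: nilpotents_def)
      then have "a [^]\<^bsub>corner R e\<^esub> n = \<zero>\<^bsub>corner R e\<^esub>" using e by (simp add: pow)
      then show "a \<in> nilpotents (corner R e)" using a unfolding nilpotents_def by blast
    qed
  qed
  moreover have "nilpotents (corner R e) \<subseteq> carrier (corner R e)" by (auto simp: nilpotents_def)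
  ultimately show ?thesis by blast
qed

lemma no_orthogonal_sequence_corner:
  assumes "\<not> has_orthogonal_sequence R" shows "\<not> has_orthogonal_sequence (corner R e)"
proof
  assume "has_orthogonal_sequence (corner R e)"
  then obtain a :: "nat \<Rightarrow> 'a" where a: "\<And>n. a n \<in> carrier (corner R e) - nilpotents (corner R e)"
    "\<And>i j. i \<noteq> j \<Longrightarrow> a i \<otimes> a j \<in> nilpotents (corner R e)"
    unfolding has_orthogonal_sequence_def corner_simps(2) by blast
  have "has_orthogonal_sequence R"
    unfolding has_orthogonal_sequence_def
    by (intro exI[of _ a] conjI allI impI) (use a nilpotents_corner in auto)
  with assms show False ..
qed

text \<open>If x is a central multiplier for a in R, then e x is one in the corner, because e is
  central and a = e a.\<close>

lemma centrally_essential_corner: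
  assumes ce: "centrally_essential R"
  shows "centrally_essential (corner R e)"
  unfolding ring.centrally_essential_iff[OF ring_corner]
proof (intro ballI impI)
  fix a assume a: "a \<in> carrier (corner R e)" "a \<noteq> \<zero>\<^bsub>corner R e\<^esub>"
  have ac: "a \<in> carrier R" "e \<otimes> a = a" "a \<noteq> \<zero>" using a by auto
  from central_multiple[OF ce ac(1,3)] obtain x where x: "x \<in> ring_center R" "a \<otimes> x \<in> ring_center R" "a \<otimes> x \<noteq> \<zero>" by blast
  have xc: "x \<in> carrier R" using x(1) by (rule ring_center_closed)
  have sub: "z \<in> ring_center (corner R e)" if "z \<in> ring_center R" "e \<otimes> z = z" for z
    using that unfolding ring_center_def by auto
  have ax: "e \<otimes> (a \<otimes> x) = a \<otimes> x" using ac xc e by (simp add: m_assoc[symmetric])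
  have "a \<otimes> (e \<otimes> x) = a \<otimes> x" using idempotent_lcomm[OF e ac(1) xc] ax by simp
  moreover have "e \<otimes> x \<in> ring_center (corner R e)"
    using ring_center_mult[OF idempotent_central[OF e] x(1)] xc e by (intro sub) (auto simp: idempotent_absorb)
  moreover have "a \<otimes> x \<in> ring_center (corner R e)" using x(2) ax by (rule sub)
  ultimately show "\<exists>x\<in>ring_center (corner R e). a \<otimes>\<^bsub>corner R e\<^esub> x \<in> ring_center (corner R e) \<and>
      a \<otimes>\<^bsub>corner R e\<^esub> x \<noteq> \<zero>\<^bsub>corner R e\<^esub>"
    using x(3) by (intro bexI[of _ "e \<otimes> x"]) auto
qed

text \<open>The generators are multiplied by e. A right ideal J of the corner containing them has
  the preimage {a. e a \<in> J}, a right ideal of R that contains the old generators and hence all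
  nilpotent elements.\<close>

lemma fin_gen_nilpotents_corner:
  assumes "fin_gen_right_ideal R (nilpotents R)"
  shows "fin_gen_right_ideal (corner R e) (nilpotents (corner R e))"
proof -
  let ?C = "corner R e"
  interpret C: ring ?C by (rule ring_corner)
  from assms obtain S where S: "finite S" "S \<subseteq> carrier R"
    "nilpotents R = \<Inter>{J. right_ideal J R \<and> S \<subseteq> J}" unfolding fin_gen_right_ideal_def by blast
  note N = right_idealD[OF right_ideal_nilpotents]
  let ?S = "(\<lambda>s. e \<otimes> s) ` S"
  have SC: "?S \<subseteq> carrier ?C" using S(2) e by (auto simp: idempotent_absorb)
  have "S \<subseteq> nilpotents R" unfolding S(3) by blast
  then have SN: "?S \<subseteq> nilpotents ?C"
    unfolding nilpotents_corner using SC right_ideal_mult_left[OF right_ideal_nilpotents] e by blast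
  have "right_ideal (nilpotents ?C) ?C"
    unfolding nilpotents_corner
    by (rule C.right_idealI) (use N e in \<open>auto simp: r_distr m_assoc[symmetric]\<close>)
  then have sub1: "\<Inter>{J. right_ideal J ?C \<and> ?S \<subseteq> J} \<subseteq> nilpotents ?C" using SN by blast
  have sub2: "x \<in> J" if x: "x \<in> nilpotents ?C" and J: "right_ideal J ?C" "?S \<subseteq> J" for x J
  proof -
    note Jd = C.right_idealD[OF J(1)]
    have "right_ideal {a \<in> carrier R. e \<otimes> a \<in> J} R"
    proof (rule right_idealI)
      show "\<zero> \<in> {a \<in> carrier R. e \<otimes> a \<in> J}" using Jd(2) e by simp
      show "a \<oplus> b \<in> {a \<in> carrier R. e \<otimes> a \<in> J}"
        if "a \<in> {a \<in> carrier R. e \<otimes> a \<in> J}" "b \<in> {a \<in> carrier R. e \<otimes> a \<in> J}" for a b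
        using that Jd(3)[of "e \<otimes> a" "e \<otimes> b"] e by (simp add: r_distr)
      show "a \<otimes> r \<in> {a \<in> carrier R. e \<otimes> a \<in> J}"
        if ar: "a \<in> {a \<in> carrier R. e \<otimes> a \<in> J}" "r \<in> carrier R" for a r
      proof -
        have "(e \<otimes> a) \<otimes> (e \<otimes> r) \<in> J"
          using ar Jd(4)[of "e \<otimes> a" "e \<otimes> r"] e by (simp add: idempotent_absorb)
        also have "(e \<otimes> a) \<otimes> (e \<otimes> r) = e \<otimes> (a \<otimes> r)"
          using ar e idempotent_lcomm[OF e, of a r] by (simp add: m_assoc idempotent_absorb)
        finally show ?thesis using ar by simp
      qed
    qed auto
    moreover have "S \<subseteq> {a \<in> carrier R. e \<otimes> a \<in> J}" using S(2) J(2) by auto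
    ultimately have "nilpotents R \<subseteq> {a \<in> carrier R. e \<otimes> a \<in> J}" unfolding S(3) by blast
    then show ?thesis using x unfolding nilpotents_corner by auto
  qed
  have "nilpotents ?C = \<Inter>{J. right_ideal J ?C \<and> ?S \<subseteq> J}"
    using sub1 sub2 by (intro equalityI subsetI InterI) auto
  then show ?thesis unfolding fin_gen_right_ideal_def using S(1) SC by blast
qed

end

text \<open>Orthogonality is recorded recursively: each new e annihilates the sum s of the others.
  This is the form in which the corner of e + s splits off the corner of e.\<close>

inductive idempotent_sum :: "'a list \<Rightarrow> 'a \<Rightarrow> bool" where
  Nil: "idempotent_sum [] \<zero>"
| Cons: "e \<in> carrier R \<Longrightarrow> e \<otimes> e = e \<Longrightarrow> idempotent_sum es s \<Longrightarrow> e \<otimes> s = \<zero> \<Longrightarrow>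
    idempotent_sum (e # es) (e \<oplus> s)"

lemma idempotent_sum_idempotent:
  assumes "idempotent_sum es s" shows "s \<in> carrier R" "s \<otimes> s = s"
proof -
  have "s \<in> carrier R \<and> s \<otimes> s = s"
    using assms
  proof (induction rule: idempotent_sum.induct)
    case (Cons e es s)
    then have "s \<otimes> e = \<zero>" using idempotent_commutes[of e s] by simp
    then show ?case using Cons by (simp add: l_distr r_distr)
  qed simp
  then show "s \<in> carrier R" "s \<otimes> s = s" by auto
qed

lemma idempotent_sum_append:
  assumes "idempotent_sum es s" "idempotent_sum fs t" "s \<otimes> t = \<zero>"
  shows "idempotent_sum (es @ fs) (s \<oplus> t)"
  using assms
proof (induction rule: idempotent_sum.induct)
  case Nil
  then show ?case using idempotent_sum_idempotent by simp
next
  case (Cons e es s)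
  have s: "s \<in> carrier R" "s \<otimes> s = s" using idempotent_sum_idempotent[OF Cons.hyps(3)] by auto
  have t: "t \<in> carrier R" using idempotent_sum_idempotent[OF Cons.prems(1)] by auto
  have et: "e \<otimes> t = \<zero>"
  proof -
    have "e \<otimes> ((e \<oplus> s) \<otimes> t) = e \<otimes> e \<otimes> t \<oplus> e \<otimes> s \<otimes> t"
      using Cons.hyps(1) s t by (simp add: l_distr r_distr m_assoc)
    then show ?thesis using Cons.hyps(1,2,4) Cons.prems(2) t by simp
  qed
  have "(e \<oplus> s) \<otimes> t = e \<otimes> t \<oplus> s \<otimes> t" using Cons.hyps(1) s t by (simp add: l_distr)
  then have st: "s \<otimes> t = \<zero>" using Cons.prems(2) et s t by simp
  have "idempotent_sum (e # (es @ fs)) (e \<oplus> (s \<oplus> t))"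
    using Cons.IH[OF Cons.prems(1) st] Cons.hyps(1,2,4) s t et
    by (intro idempotent_sum.Cons) (auto simp: r_distr)
  then show ?case using Cons.hyps(1) s t by (simp add: a_assoc)
qed

text \<open>The map a \<mapsto> (e a, s a) has the inverse (x, y) \<mapsto> x + y; it preserves
  products because e and s are central idempotents.\<close>

lemma corner_product_iso:
  assumes "idempotent_sum es s"
  shows "corner R s \<simeq> RDirProd_list (map (corner R) es)"
  using assms
proof (induction rule: idempotent_sum.induct)
  case Nil
  have "(\<lambda>_. []) \<in> ring_iso (corner R \<zero>) (RDirProd_list (map (corner R) []))"
    by (rule ring_iso_memI) (auto simp: monoid.defs bij_betw_def inj_on_def)
  then show ?case unfolding is_ring_iso_def by blast
next
  case (Cons e es s)
  have e: "e \<in> carrier R" "e \<otimes> e = e" "e \<otimes> s = \<zero>" by fact+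
  have s: "s \<in> carrier R" "s \<otimes> s = s" using idempotent_sum_idempotent[OF Cons.hyps(3)] by auto
  have se: "s \<otimes> e = \<zero>" using e idempotent_commutes[OF e(1,2) s(1)] by simp
  let ?f = "\<lambda>a. (e \<otimes> a, s \<otimes> a)"
  have es0: "e \<otimes> (s \<otimes> a) = \<zero>" "s \<otimes> (e \<otimes> a) = \<zero>" if "a \<in> carrier R" for a
    using that e s se by (simp_all add: m_assoc[symmetric])
  have "?f \<in> ring_iso (corner R (e \<oplus> s)) (RDirProd (corner R e) (corner R s))"
  proof (rule ring_iso_memI)
    fix x y assume xy: "x \<in> carrier (corner R (e \<oplus> s))" "y \<in> carrier (corner R (e \<oplus> s))"
    have mult: "g \<otimes> (x \<otimes> y) = (g \<otimes> x) \<otimes> (g \<otimes> y)" if "g \<in> carrier R" "g \<otimes> g = g" for g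
      using xy that idempotent_lcomm[OF that, of x y] by (simp add: m_assoc idempotent_absorb)
    show "?f x \<in> carrier (RDirProd (corner R e) (corner R s))"
      using xy e s by (simp add: RDirProd_carrier idempotent_absorb)
    show "?f (x \<otimes>\<^bsub>corner R (e \<oplus> s)\<^esub> y) =
        ?f x \<otimes>\<^bsub>RDirProd (corner R e) (corner R s)\<^esub> ?f y"
      using mult[OF e(1,2)] mult[OF s] by (simp add: RDirProd_def DirProd_def monoid.defs)
    show "?f (x \<oplus>\<^bsub>corner R (e \<oplus> s)\<^esub> y) =
        ?f x \<oplus>\<^bsub>RDirProd (corner R e) (corner R s)\<^esub> ?f y"
      using xy e s by (simp add: RDirProd_def DirProd_def monoid.defs r_distr)
  next
    show "?f \<one>\<^bsub>corner R (e \<oplus> s)\<^esub> = \<one>\<^bsub>RDirProd (corner R e) (corner R s)\<^esub>"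
      using e s se by (simp add: RDirProd_def DirProd_def monoid.defs r_distr)
    show "bij_betw ?f (carrier (corner R (e \<oplus> s))) (carrier (RDirProd (corner R e) (corner R s)))"
    proof (rule bij_betwI[where g = "\<lambda>(x, y). x \<oplus> y"])
      show "?f \<in> carrier (corner R (e \<oplus> s)) \<rightarrow> carrier (RDirProd (corner R e) (corner R s))"
        using e s by (auto simp: RDirProd_carrier idempotent_absorb)
      show "(\<lambda>(x, y). x \<oplus> y) \<in> carrier (RDirProd (corner R e) (corner R s)) \<rightarrow> carrier (corner R (e \<oplus> s))"
      proof (clarsimp simp: RDirProd_carrier)
        fix x y assume x: "x \<in> carrier R" "e \<otimes> x = x" and y: "y \<in> carrier R" "s \<otimes> y = y"
        have "e \<otimes> y = \<zero>" "s \<otimes> x = \<zero>" using es0[OF y(1)] es0[OF x(1)] x y by auto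
        then show "(e \<oplus> s) \<otimes> (x \<oplus> y) = x \<oplus> y" using e(1) s(1) x y by (simp add: l_distr r_distr)
      qed
      show "(\<lambda>(x, y). x \<oplus> y) (?f x) = x" if "x \<in> carrier (corner R (e \<oplus> s))" for x
        using that l_distr[OF e(1) s(1), of x] by simp
      show "?f ((\<lambda>(x, y). x \<oplus> y) z) = z" if z: "z \<in> carrier (RDirProd (corner R e) (corner R s))" for z
      proof -
        obtain x y where zxy: "z = (x, y)" by (cases z)
        then have x: "x \<in> carrier R" "e \<otimes> x = x" and y: "y \<in> carrier R" "s \<otimes> y = y"
          using z by (auto simp: RDirProd_carrier)
        have "e \<otimes> y = \<zero>" "s \<otimes> x = \<zero>" using es0[OF y(1)] es0[OF x(1)] x y by auto
        then show ?thesis using e(1) s(1) x y by (simp add: zxy r_distr)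
      qed
    qed
  qed
  moreover obtain g where "g \<in> ring_iso (corner R s) (RDirProd_list (map (corner R) es))"
    using Cons.IH unfolding is_ring_iso_def by blast
  note RDirProd_iso5[OF this, of "corner R e"]
  ultimately have "(\<lambda>(a, as). a # as) \<circ> ((\<lambda>(r, t). (r, g t)) \<circ> ?f)
      \<in> ring_iso (corner R (e \<oplus> s)) (RDirProd_list (corner R e # map (corner R) es))"
    by (intro ring_iso_set_trans[OF ring_iso_set_trans RDirProd_list_iso1])
  then show ?case unfolding is_ring_iso_def by auto
qed

section \<open>Decomposition of the identity into primitive idempotents\<close>

definition primitive :: "'a \<Rightarrow> bool" where
  "primitive e \<longleftrightarrow> e \<in> carrier R \<and> e \<otimes> e = e \<and> e \<noteq> \<zero> \<and>
     (\<forall>f\<in>carrier R. f \<otimes> f = f \<and> e \<otimes> f = f \<longrightarrow> f = \<zero> \<or> f = e)"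

definition primitively_decomposable :: "'a \<Rightarrow> bool" where
  "primitively_decomposable e \<longleftrightarrow> (\<exists>es. idempotent_sum es e \<and> (\<forall>f\<in>set es. primitive f))"

lemma idempotent_complement:
  assumes e: "e \<in> carrier R" "e \<otimes> e = e" and f: "f \<in> carrier R" "f \<otimes> f = f" "e \<otimes> f = f"
  shows "(e \<ominus> f) \<otimes> (e \<ominus> f) = e \<ominus> f" "f \<otimes> (e \<ominus> f) = \<zero>" "e \<otimes> (e \<ominus> f) = e \<ominus> f" "f \<oplus> (e \<ominus> f) = e"
proof -
  have fe: "f \<otimes> e = f" using f idempotent_commutes[OF e f(1)] by simp
  show 1: "f \<otimes> (e \<ominus> f) = \<zero>" using e(1) f(1,2) fe by (simp add: minus_eq r_distr r_minus r_neg)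
  show 2: "e \<otimes> (e \<ominus> f) = e \<ominus> f" using e f(1,3) by (simp add: minus_eq r_distr r_minus)
  show "(e \<ominus> f) \<otimes> (e \<ominus> f) = e \<ominus> f"
  proof -
    have "(e \<ominus> f) \<otimes> (e \<ominus> f) = e \<otimes> (e \<ominus> f) \<ominus> f \<otimes> (e \<ominus> f)"
      using e(1) f(1) minus_closed[OF e(1) f(1)] by (simp add: minus_eq l_distr l_minus)
    then show ?thesis using 1 2 e(1) f(1) by (simp add: minus_eq)
  qed
  show "f \<oplus> (e \<ominus> f) = e" using e(1) f(1) by (simp add: minus_eq a_lcomm[of f] r_neg)
qed

text \<open>If f and e - f were both decomposable, concatenating their lists would decompose e. So
  one of the two parts of a proper splitting is again not decomposable.\<close>

lemma not_decomposable_step: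
  assumes e: "e \<in> carrier R" "e \<otimes> e = e" and nd: "\<not> primitively_decomposable e"
  shows "\<exists>f. f \<in> carrier R \<and> f \<otimes> f = f \<and> e \<otimes> f = f \<and> f \<noteq> e \<and> \<not> primitively_decomposable f"
proof -
  have "idempotent_sum [] \<zero>" by (rule idempotent_sum.Nil)
  then have "primitively_decomposable \<zero>" unfolding primitively_decomposable_def by force
  then have "e \<noteq> \<zero>" using nd by blast
  moreover have "\<not> primitive e"
  proof
    assume p: "primitive e"
    have "idempotent_sum [e] (e \<oplus> \<zero>)" using e by (intro idempotent_sum.intros) auto
    then have "idempotent_sum [e] e" using e by simp
    moreover have "\<forall>f\<in>set [e]. primitive f" using p by simp
    ultimately show False using nd unfolding primitively_decomposable_def by blast
  qed
  ultimately obtain f where f: "f \<in> carrier R" "f \<otimes> f = f" "e \<otimes> f = f" "f \<noteq> \<zero>" "f \<noteq> e"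
    using e unfolding primitive_def by blast
  note c = idempotent_complement[OF e f(1-3)]
  have "\<not> (primitively_decomposable f \<and> primitively_decomposable (e \<ominus> f))"
  proof
    assume "primitively_decomposable f \<and> primitively_decomposable (e \<ominus> f)"
    then obtain es fs where es: "idempotent_sum es f" "\<forall>f\<in>set es. primitive f"
      and fs: "idempotent_sum fs (e \<ominus> f)" "\<forall>f\<in>set fs. primitive f"
      unfolding primitively_decomposable_def by blast
    have "idempotent_sum (es @ fs) e" using idempotent_sum_append[OF es(1) fs(1) c(2)] c(4) by simp
    moreover have "\<forall>f\<in>set (es @ fs). primitive f" using es(2) fs(2) by auto
    ultimately show False using nd unfolding primitively_decomposable_def by blast
  qed
  moreover have "e \<ominus> f \<noteq> e"
  proof
    assume ef: "e \<ominus> f = e"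
    have "f \<otimes> e = \<zero>" using c(2) unfolding ef .
    then show False using f(3,4) idempotent_commutes[OF e f(1)] by simp
  qed
  ultimately show ?thesis using f c(1,3) e(1) by (meson minus_closed)
qed

text \<open>A failure produces a strictly decreasing sequence of idempotents f_n. The differences
  f_n - f_(n+1) are nonzero orthogonal idempotents, hence not nilpotent, and form an orthogonal
  sequence.\<close>

lemma one_decomposable:
  assumes no: "\<not> has_orthogonal_sequence R"
  shows "primitively_decomposable \<one>"
proof (rule ccontr)
  assume nd: "\<not> primitively_decomposable \<one>"
  let ?good = "\<lambda>e. e \<in> carrier R \<and> e \<otimes> e = e \<and> \<not> primitively_decomposable e"
  have "\<exists>f. \<forall>n::nat. ?good (f n) \<and> (f n \<otimes> f (Suc n) = f (Suc n) \<and> f (Suc n) \<noteq> f n)"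
  proof (rule dependent_nat_choice)
    show "\<exists>e. ?good e" using nd by (intro exI[of _ \<one>]) auto
    show "\<exists>f. ?good f \<and> (e \<otimes> f = f \<and> f \<noteq> e)" if "?good e" for e using that not_decomposable_step[of e] by blast
  qed
  then obtain f where f: "\<And>n::nat. f n \<in> carrier R" "\<And>n. f n \<otimes> f n = f n"
    "\<And>n. f n \<otimes> f (Suc n) = f (Suc n)" "\<And>n. f (Suc n) \<noteq> f n" by blast
  define g where "g n = f n \<ominus> f (Suc n)" for n
  note c = idempotent_complement[OF f(1) f(2) f(1) f(2) f(3)]
  have g: "g n \<in> carrier R" "g n \<otimes> g n = g n" "f (Suc n) \<otimes> g n = \<zero>" "f n \<otimes> g n = g n" for n
    unfolding g_def using f(1) c by auto
  have g0: "g n \<noteq> \<zero>" for n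
    unfolding g_def using f(1,4) minus_eq_zero_iff by metis
  have gN: "g n \<notin> nilpotents R" for n
  proof
    assume "g n \<in> nilpotents R"
    then obtain k :: nat where k: "g n [^] k = \<zero>" by (auto simp: nilpotents_def)
    have "g n [^] Suc m = g n" for m by (induction m) (use g in auto)
    moreover have "g n [^] Suc k = \<zero>" using k g(1) by simp
    ultimately show False using g0 by metis
  qed
  have le: "f i \<otimes> f j = f j" if "i \<le> j" for i j
    using that
  proof (induction j rule: dec_induct)
    case (step j)
    have "f i \<otimes> f (Suc j) = f i \<otimes> (f j \<otimes> f (Suc j))" using f(3) by simp
    also have "\<dots> = (f i \<otimes> f j) \<otimes> f (Suc j)" using f(1) by (intro m_assoc[symmetric])
    also have "\<dots> = f (Suc j)" using step.IH f(3) by simp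
    finally show ?case .
  qed (rule f(2))
  have orth: "g i \<otimes> g j = \<zero>" if "i < j" for i j
  proof -
    have fg: "f k \<otimes> g j = g j" if "k \<le> j" for k
    proof -
      have "f k \<otimes> g j = f k \<otimes> (f j \<otimes> g j)" using g(4) by simp
      also have "\<dots> = f j \<otimes> g j" using le[OF that] f(1) g(1) by (simp add: m_assoc[symmetric])
      finally show ?thesis using g(4) by simp
    qed
    have "g i \<otimes> g j = f i \<otimes> g j \<ominus> f (Suc i) \<otimes> g j"
      unfolding g_def[of i] using f(1) g(1) by (simp add: minus_eq l_distr l_minus)
    also have "\<dots> = \<zero>" using fg that g(1) by (simp add: minus_eq r_neg)
    finally show ?thesis .
  qed
  have "g i \<otimes> g j = \<zero>" if "i \<noteq> j" for i j
  proof (cases "i < j")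
    case False
    then have "g j \<otimes> g i = \<zero>" using that by (intro orth) auto
    then show ?thesis using idempotent_commutes[OF g(1,2) g(1), of i j] by simp
  qed (rule orth)
  then have "\<forall>i j. i \<noteq> j \<longrightarrow> g i \<otimes> g j \<in> nilpotents R"
    using right_idealD(2)[OF right_ideal_nilpotents] by simp
  then have "has_orthogonal_sequence R"
    unfolding has_orthogonal_sequence_def using g(1) gN by blast
  with no show False ..
qed

lemma corner_one_iso: "R \<simeq> corner R \<one>"
proof -
  have "id \<in> ring_iso R (corner R \<one>)"
    by (rule ring_iso_memI) (auto simp: bij_betw_def)
  then show ?thesis unfolding is_ring_iso_def by blast
qed

end

section \<open>Decomposition of right distributive, right invariant rings\<close>

context distributive_duo_ring
begin

lemma distributive_duo_ring_corner:
  assumes e: "e \<in> carrier R" "e \<otimes> e = e"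
  shows "distributive_duo_ring (corner R e)"
proof (intro distributive_duo_ring.intro distributive_duo_ring_axioms.intro duo_ring.intro duo_ring_axioms.intro)
  show "ring (corner R e)" using e by (rule ring_corner)
  interpret C: ring "corner R e" using e by (rule ring_corner)
  show "a divides\<^bsub>corner R e\<^esub> b \<otimes>\<^bsub>corner R e\<^esub> a"
    if "a \<in> carrier (corner R e)" "b \<in> carrier (corner R e)" for a b
  proof (rule corner_divides[OF e that(1)])
    show "a divides b \<otimes>\<^bsub>corner R e\<^esub> a" using duo that by simp
    show "b \<otimes>\<^bsub>corner R e\<^esub> a \<in> carrier (corner R e)" using that(2,1) by (rule C.m_closed)
  qed
  show "\<exists>t\<in>carrier (corner R e). b divides\<^bsub>corner R e\<^esub> a \<otimes>\<^bsub>corner R e\<^esub> t \<and>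
      a divides\<^bsub>corner R e\<^esub> b \<otimes>\<^bsub>corner R e\<^esub> (\<one>\<^bsub>corner R e\<^esub> \<ominus>\<^bsub>corner R e\<^esub> t)"
    if ab: "a \<in> carrier (corner R e)" "b \<in> carrier (corner R e)" for a b
  proof -
    have abc: "a \<in> carrier R" "b \<in> carrier R" "e \<otimes> a = a" "e \<otimes> b = b" using ab by auto
    from dist[OF abc(1,2)] obtain t where
      t: "t \<in> carrier R" "b divides a \<otimes> t" "a divides b \<otimes> (\<one> \<ominus> t)" by blast
    \<comment> \<open>The element t is replaced by e t, which lies in the corner: a e t = a t and e
      - e t = e (1 - t).\<close>
    have et: "e \<otimes> t \<in> carrier (corner R e)" using e t(1) by (simp add: idempotent_absorb)
    have "a \<otimes> (e \<otimes> t) = e \<otimes> a \<otimes> t" using e abc(1) t(1) idempotent_lcomm[OF e abc(1) t(1)] by (simp add: m_assoc)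
    then have 1: "b divides a \<otimes> (e \<otimes> t)" using t(2) abc by simp
    have m: "\<one>\<^bsub>corner R e\<^esub> \<ominus>\<^bsub>corner R e\<^esub> (e \<otimes> t) = e \<otimes> (\<one> \<ominus> t)"
      using corner_minus[OF e C.one_closed et] e t(1) by (simp add: minus_eq r_distr r_minus)
    have "b \<otimes> (e \<otimes> (\<one> \<ominus> t)) = e \<otimes> b \<otimes> (\<one> \<ominus> t)"
      using e abc(2) t(1) idempotent_lcomm[OF e abc(2), of "\<one> \<ominus> t"] m_assoc[of e b "\<one> \<ominus> t"] by simp
    then have 2: "a divides b \<otimes> (e \<otimes> (\<one> \<ominus> t))" using t(3) abc by simp
    have c: "b \<otimes>\<^bsub>corner R e\<^esub> (\<one>\<^bsub>corner R e\<^esub> \<ominus>\<^bsub>corner R e\<^esub> (e \<otimes> t)) \<in> carrier (corner R e)"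
      using ab et by (intro C.m_closed C.minus_closed C.one_closed)
    show ?thesis
    proof (intro bexI[OF _ et] conjI corner_divides[OF e ab(2)] corner_divides[OF e ab(1)] c)
      show "a \<otimes>\<^bsub>corner R e\<^esub> (e \<otimes> t) \<in> carrier (corner R e)" using ab(1) et by (rule C.m_closed)
      show "b divides a \<otimes>\<^bsub>corner R e\<^esub> (e \<otimes> t)" using 1 by simp
      show "a divides b \<otimes>\<^bsub>corner R e\<^esub> (\<one>\<^bsub>corner R e\<^esub> \<ominus>\<^bsub>corner R e\<^esub> (e \<otimes> t))"
        unfolding m using 2 by simp
    qed
  qed
qed

lemma indecomposable_cases:
  assumes one: "\<one> \<noteq> \<zero>" and "\<not> has_orthogonal_sequence R"
    and "\<And>e. e \<in> carrier R \<Longrightarrow> e \<otimes> e = e \<Longrightarrow> e = \<zero> \<or> e = \<one>"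
    and ce: "centrally_essential R"
    and fg: "fin_gen_right_ideal R (nilpotents R)"
  shows "pruefer_domain R \<or> (artinian R \<and> uniserial R \<and> centrally_essential R)"
proof -
  note prime = nilpotents_prime_if_indecomposable[OF assms(2,3)]
  show ?thesis
  proof (cases "nilpotents R = {\<zero>}")
    case True
    then show ?thesis using pruefer_domain_if_reduced[OF one prime _ ce] by blast
  next
    case False
    from local_if_nilpotents_prime[OF prime ce fg False] obtain p where
      units: "\<And>a. a \<in> carrier R \<Longrightarrow> a \<notin> nilpotents R \<Longrightarrow> a \<in> Units R"
      and p: "p \<in> nilpotents R" "\<And>q. q \<in> nilpotents R \<Longrightarrow> p divides q" by blast
    have "p \<noteq> \<zero>"
    proof
      assume "p = \<zero>"
      then have "q = \<zero>" if "q \<in> nilpotents R" for q using p(2)[OF that] by (auto elim!: dividesE)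
      then show False using False p(1) \<open>p = \<zero>\<close> by blast
    qed
    then have "artinian R" "uniserial R"
      using artinian_uniserial_if_local[OF units p(1) _ p(2) ce] by blast+
    then show ?thesis using ce by blast
  qed
qed

text \<open>The corner of a primitive idempotent has only the trivial idempotents and inherits every
  hypothesis, so the indecomposable case applies to it.\<close>

lemma decomposition:
  assumes no: "\<not> has_orthogonal_sequence R"
    and ce: "centrally_essential R"
    and fg: "fin_gen_right_ideal R (nilpotents R)"
  shows "\<exists>Rs :: 'a ring list. R \<simeq> RDirProd_list Rs \<and>
    (\<forall>S\<in>set Rs. ring S \<and> \<one>\<^bsub>S\<^esub> \<noteq> \<zero>\<^bsub>S\<^esub> \<and>
      (pruefer_domain S \<or> (artinian S \<and> uniserial S \<and> centrally_essential S)))"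
proof -
  from one_decomposable[OF no] obtain es where
    es: "idempotent_sum es \<one>" "\<And>e. e \<in> set es \<Longrightarrow> primitive e"
    unfolding primitively_decomposable_def by blast
  have "R \<simeq> RDirProd_list (map (corner R) es)"
    using corner_one_iso corner_product_iso[OF es(1)] ring_iso_set_trans unfolding is_ring_iso_def by blast
  moreover have "ring (corner R e) \<and> \<one>\<^bsub>corner R e\<^esub> \<noteq> \<zero>\<^bsub>corner R e\<^esub> \<and>
      (pruefer_domain (corner R e) \<or>
        (artinian (corner R e) \<and> uniserial (corner R e) \<and> centrally_essential (corner R e)))"
    if "e \<in> set es" for e
  proof -
    have e: "e \<in> carrier R" "e \<otimes> e = e" "e \<noteq> \<zero>"
      and prim: "\<And>f. f \<in> carrier R \<Longrightarrow> f \<otimes> f = f \<Longrightarrow> e \<otimes> f = f \<Longrightarrow> f = \<zero> \<or> f = e"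
      using es(2)[OF that] unfolding primitive_def by blast+
    interpret C: distributive_duo_ring "corner R e" using e(1,2) by (rule distributive_duo_ring_corner)
    have "pruefer_domain (corner R e) \<or>
        (artinian (corner R e) \<and> uniserial (corner R e) \<and> centrally_essential (corner R e))"
    proof (rule C.indecomposable_cases)
      show "\<not> has_orthogonal_sequence (corner R e)" using no_orthogonal_sequence_corner[OF e(1,2) no] .
      show "f = \<zero>\<^bsub>corner R e\<^esub> \<or> f = \<one>\<^bsub>corner R e\<^esub>"
        if "f \<in> carrier (corner R e)" "f \<otimes>\<^bsub>corner R e\<^esub> f = f" for f
        using prim[of f] that by simp
      show "fin_gen_right_ideal (corner R e) (nilpotents (corner R e))"
        using fin_gen_nilpotents_corner[OF e(1,2) fg] .
      show "centrally_essential (corner R e)" using centrally_essential_corner[OF e(1,2) ce] .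
    qed (use e(3) in simp)
    then show ?thesis using ring_corner[OF e(1,2)] e(3) by simp
  qed
  ultimately show ?thesis by (intro exI[of _ "map (corner R) es"]) auto
qed

end

text \<open>A noncommutative division ring is Artinian and uniserial without being centrally
  essential: a x = y with nonzero central x and y would make a central. Hence central essentiality
  stands as a condition on the Artinian factors. The factors can be sought over the element type of
  A because corners live inside A.\<close>

theorem theorem1p4:
  fixes A :: "('a, 'm) ring_scheme" and P :: "'a set"
  assumes "ring A" and "\<one>\<^bsub>A\<^esub> \<noteq> \<zero>\<^bsub>A\<^esub>"
    and "P = prime_radical A"
  shows
    "(right_distributive A \<and> right_invariant A \<and> centrally_essential A \<and>
      fin_gen_right_ideal A P \<and> \<not> contains_infinite_direct_sum_of_ideals (A Quot P))
     \<longleftrightarrow>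
     (\<exists>Rs :: 'a ring list.
        A \<simeq> RDirProd_list Rs \<and>
        (\<forall>R\<in>set Rs. ring R \<and> \<one>\<^bsub>R\<^esub> \<noteq> \<zero>\<^bsub>R\<^esub> \<and>
           (pruefer_domain R \<or> (artinian R \<and> uniserial R \<and> centrally_essential R))))"
    (is "?L \<longleftrightarrow> ?R")
proof
  interpret A: ring A by fact
  {
    assume L: ?L
    interpret D: distributive_duo_ring A
    proof (intro distributive_duo_ring.intro distributive_duo_ring_axioms.intro duo_ring.intro
        duo_ring_axioms.intro A.ring_axioms)
      show "a divides\<^bsub>A\<^esub> b \<otimes>\<^bsub>A\<^esub> a" if "a \<in> carrier A" "b \<in> carrier A" for a b
        using L that by (simp add: A.right_invariant_iff)
      show "\<exists>t\<in>carrier A. b divides\<^bsub>A\<^esub> a \<otimes>\<^bsub>A\<^esub> t \<and> a divides\<^bsub>A\<^esub> b \<otimes>\<^bsub>A\<^esub> (\<one>\<^bsub>A\<^esub> \<ominus>\<^bsub>A\<^esub> t)"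
        if "a \<in> carrier A" "b \<in> carrier A" for a b
        using L that by (intro A.right_distributive_imp) auto
    qed
    have P: "P = nilpotents A" using assms(3) D.prime_radical_eq_nilpotents by simp
    show ?R
    proof (rule D.decomposition)
      show "\<not> has_orthogonal_sequence A"
        using L D.infinite_direct_sum_if_orthogonal_sequence unfolding P by blast
      show "centrally_essential A" using L by blast
      show "fin_gen_right_ideal A (nilpotents A)" using L unfolding P by blast
    qed
  next
    assume ?R
    then obtain Rs :: "'a ring list" where iso: "A \<simeq> RDirProd_list Rs"
      and Rs: "\<And>R. R \<in> set Rs \<Longrightarrow> ring R \<and> \<one>\<^bsub>R\<^esub> \<noteq> \<zero>\<^bsub>R\<^esub> \<and>
           (pruefer_domain R \<or> (artinian R \<and> uniserial R \<and> centrally_essential R))" by blast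
    from iso obtain h where h: "h \<in> ring_iso A (RDirProd_list Rs)" unfolding is_ring_iso_def by blast
    interpret prod: finite_ring_product A "length Rs" "\<lambda>i. Rs ! i" "\<lambda>i a. h a ! i"
      using Rs by (intro finite_ring_product_of_iso A.ring_axioms h) blast
    have "good_factor (Rs ! i)" if "i < length Rs" for i
      using Rs[OF nth_mem[OF that]] good_factor_pruefer good_factor_artinian_uniserial by blast
    note cond = prod.conditions_of_good_factors[OF this]
    interpret D: distributive_duo_ring A by (rule cond(1))
    have P: "P = nilpotents A" using assms(3) D.prime_radical_eq_nilpotents by simp
    show ?L
      unfolding P A.right_invariant_iff
      using A.right_distributiveI D.dist D.duo cond(2-4) by blast
  }
qed

end
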